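(* Let $p$ be a prime and let $n\in\mathbb{Z}_{\ge 0}$. Then every $p$-origami of degree $p^n$ either has no singularity and genus $1$, or lies in one of the following strata: (a) if $p=2$: $\mathcal{H}\left(2^{n-k}\times(2^k-1)\right)$ for some integer $k$ with $1\le k\le n-2$; (b) if $p>2$: $\mathcal{H}\left(p^{n-k}\times(p^k-1)\right)$ for some integer $k$ with $1\le k<\frac n2$. Moreover, all of these strata occur, i.e. each stratum listed for the given $p$ and $n$ contains a $p$-origami of degree $p^n$.
   Context: An origami is a connected closed surface obtained from finitely many copies of the Euclidean unit square by gluing edges via translations, so that each left edge is glued to exactly one right edge and each upper edge to exactly one lower edge. It comes with a covering $c:\mathcal{O}\to\mathbb{T}$ of the torus ramified over at most one point $\infty$ (the image of the corners); the number of squares is its degree. The deck transformation group consists of all homeomorphisms $f:\mathcal{O}\to\mathcal{O}$ with $c\circ f=c$. The origami is normal if the deck group acts transitively on the squares. Given a finite group $G$ generated by two elements $x,y$, the normal origami $(G,x,y)$ has squares labeled by the elements of $G$, the right neighbor of the square $g$ being $gx$ and its upper neighbor being $gy$; its deck group is $G$, and every normal origami is of this form. A $p$-origami is a normal origami whose deck group is a finite $p$-group. The cone angle at a point of an origami is $2\pi a$ with $a$ a positive integer; $a$ is the multiplicity of the point. A singularity is a point of multiplicity $>1$. For positive integers $k,a$, the stratum $\mathcal{H}(k\times a)$ is the set of translation surfaces with exactly $k$ singularities, each of multiplicity $a+1$. *)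

theory Defs
  imports "HOL-Analysis.Analysis" "HOL-Algebra.Bij" "HOL-Algebra.Coset" "HOL-Computational_Algebra.Primes"
begin

section \<open>Gluing unit squares\<close>

text \<open>The right edge of the square \<open>g\<close> is glued to the left edge of \<open>right_nb g\<close>, and its upper
  edge to the lower edge of \<open>upper_nb g\<close>. Only the values on \<open>squares\<close> matter.\<close>

record 'a origami_gluing =
  squares :: "'a set"
  right_nb :: "'a \<Rightarrow> 'a"
  upper_nb :: "'a \<Rightarrow> 'a"

type_synonym 'a point = "('a \<times> real \<times> real) set"

definition unit_square :: "(real \<times> real) set" where
  "unit_square = {0..1} \<times> {0..1}"

definition disjoint_squares :: "'a origami_gluing \<Rightarrow> ('a \<times> real \<times> real) topology" where
  "disjoint_squares \<O> = sum_topology (\<lambda>_. top_of_set unit_square) (squares \<O>)"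

inductive glued :: "'a origami_gluing \<Rightarrow> 'a \<times> real \<times> real \<Rightarrow> 'a \<times> real \<times> real \<Rightarrow> bool"
  for \<O> where
  horizontal: "g \<in> squares \<O> \<Longrightarrow> t \<in> {0..1} \<Longrightarrow> glued \<O> (g, 1, t) (right_nb \<O> g, 0, t)"
| vertical: "g \<in> squares \<O> \<Longrightarrow> t \<in> {0..1} \<Longrightarrow> glued \<O> (g, t, 1) (upper_nb \<O> g, t, 0)"

text \<open>Points of the surface are the classes of the equivalence relation generated by the
  gluing; \<open>surface\<close> carries the quotient topology.\<close>

definition glue_class :: "'a origami_gluing \<Rightarrow> 'a \<times> real \<times> real \<Rightarrow> 'a point" where
  "glue_class \<O> q = {q'. equivclp (glued \<O>) q q'}"

definition surface_points :: "'a origami_gluing \<Rightarrow> 'a point set" where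
  "surface_points \<O> = glue_class \<O> ` (squares \<O> \<times> unit_square)"

definition surface :: "'a origami_gluing \<Rightarrow> 'a point topology" where
  "surface \<O> = topology (\<lambda>U. U \<subseteq> surface_points \<O> \<and>
     openin (disjoint_squares \<O>) {q \<in> squares \<O> \<times> unit_square. glue_class \<O> q \<in> U})"

lemma topspace_disjoint_squares: "topspace (disjoint_squares \<O>) = squares \<O> \<times> unit_square"
  by (auto simp: disjoint_squares_def)

lemma openin_surface:
  "openin (surface \<O>) U \<longleftrightarrow> U \<subseteq> surface_points \<O> \<and>
     openin (disjoint_squares \<O>) {q \<in> squares \<O> \<times> unit_square. glue_class \<O> q \<in> U}"
proof -
  let ?S = "squares \<O> \<times> unit_square"
  have 1: "{q \<in> ?S. glue_class \<O> q \<in> U \<inter> V} =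
        {q \<in> ?S. glue_class \<O> q \<in> U} \<inter> {q \<in> ?S. glue_class \<O> q \<in> V}" for U V
    by auto
  have 2: "{q \<in> ?S. glue_class \<O> q \<in> \<Union>\<K>} = (\<Union>K\<in>\<K>. {q \<in> ?S. glue_class \<O> q \<in> K})" for \<K>
    by auto
  have "istopology (\<lambda>U. U \<subseteq> surface_points \<O> \<and>
     openin (disjoint_squares \<O>) {q \<in> ?S. glue_class \<O> q \<in> U})"
    unfolding istopology_def 1 2 by blast
  then show ?thesis
    by (simp add: surface_def topology_inverse')
qed

lemma topspace_surface: "topspace (surface \<O>) = surface_points \<O>"
proof -
  have "{q \<in> squares \<O> \<times> unit_square. glue_class \<O> q \<in> surface_points \<O>} = topspace (disjoint_squares \<O>)"
    by (auto simp: surface_points_def topspace_disjoint_squares)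
  then have "openin (surface \<O>) (surface_points \<O>)"
    by (simp add: openin_surface)
  then show ?thesis
    by (meson openin_subset openin_surface openin_topspace subset_antisym)
qed

lemma quotient_map_surface: "quotient_map (disjoint_squares \<O>) (surface \<O>) (glue_class \<O>)"
  unfolding quotient_map_def topspace_surface topspace_disjoint_squares openin_surface
  by (auto simp: surface_points_def)

definition origami :: "'a origami_gluing \<Rightarrow> bool" where
  "origami \<O> \<longleftrightarrow> finite (squares \<O>) \<and> squares \<O> \<noteq> {} \<and>
     bij_betw (right_nb \<O>) (squares \<O>) (squares \<O>) \<and>
     bij_betw (upper_nb \<O>) (squares \<O>) (squares \<O>) \<and>
     connected_space (surface \<O>)"

section \<open>The covering of the torus and deck transformations\<close>

definition torus :: "unit origami_gluing" where
  "torus = \<lparr>squares = {()}, right_nb = id, upper_nb = id\<rparr>"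

text \<open>All representatives of a point of the surface yield the same point of the torus, by
  \<open>covering_glue_class\<close> below.\<close>

definition covering :: "'a origami_gluing \<Rightarrow> 'a point \<Rightarrow> unit point" where
  "covering \<O> P = the_elem ((\<lambda>(g, z). glue_class torus ((), z)) ` P)"

lemma covering_glue_class: "covering \<O> (glue_class \<O> (g, z)) = glue_class torus ((), z)"
proof -
  have step: "glue_class torus ((), snd q) = glue_class torus ((), snd q')"
    if "equivclp (glued \<O>) q q'" for q q' :: "'a \<times> real \<times> real"
    using that
  proof (induction rule: equivclp_induct)
    case base
    then show ?case by simp
  next
    case (step y z)
    have "equivclp (glued torus) ((), snd a) ((), snd b)" if "glued \<O> a b" for a b
      using that
    proof cases
      case (horizontal g t)
      then have "glued torus ((), snd a) ((), snd b)"
        using glued.horizontal[of "()" torus t] by (simp add: torus_def)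
      then show ?thesis by blast
    next
      case (vertical g t)
      then have "glued torus ((), snd a) ((), snd b)"
        using glued.vertical[of "()" torus t] by (simp add: torus_def)
      then show ?thesis by blast
    qed
    then have "equivclp (glued torus) ((), snd y) ((), snd z)"
      using step by (metis equivclp_sym)
    then have "glue_class torus ((), snd y) = glue_class torus ((), snd z)"
      by (auto simp: glue_class_def intro: equivclp_trans equivclp_sym)
    with step show ?case by simp
  qed
  have "(\<lambda>(g, z). glue_class torus ((), z)) ` glue_class \<O> (g, z) = {glue_class torus ((), z)}"
    (is "?f ` _ = {?c}")
  proof (intro equalityI subsetI)
    fix x assume "x \<in> ?f ` glue_class \<O> (g, z)"
    then obtain q where "equivclp (glued \<O>) (g, z) q" "x = ?f q"
      by (auto simp: glue_class_def)
    with step show "x \<in> {?c}"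
      by (cases q) fastforce
  next
    fix x assume "x \<in> {?c}"
    moreover have "(g, z) \<in> glue_class \<O> (g, z)"
      by (simp add: glue_class_def)
    ultimately show "x \<in> ?f ` glue_class \<O> (g, z)"
      by (intro image_eqI[where x = "(g, z)"]) auto
  qed
  then show ?thesis
    by (simp add: covering_def)
qed

definition origami_degree :: "'a origami_gluing \<Rightarrow> nat" where
  "origami_degree \<O> = card (squares \<O>)"

definition deck_transformations :: "'a origami_gluing \<Rightarrow> ('a point \<Rightarrow> 'a point) set" where
  "deck_transformations \<O> = {f \<in> extensional (topspace (surface \<O>)).
     homeomorphic_map (surface \<O>) (surface \<O>) f \<and>
     (\<forall>P \<in> topspace (surface \<O>). covering \<O> (f P) = covering \<O> P)}"

definition deck_group :: "'a origami_gluing \<Rightarrow> ('a point \<Rightarrow> 'a point) monoid" where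
  "deck_group \<O> = BijGroup (topspace (surface \<O>)) \<lparr>carrier := deck_transformations \<O>\<rparr>"

definition square_in_surface :: "'a origami_gluing \<Rightarrow> 'a \<Rightarrow> 'a point set" where
  "square_in_surface \<O> g = glue_class \<O> ` ({g} \<times> unit_square)"

definition normal_origami :: "'a origami_gluing \<Rightarrow> bool" where
  "normal_origami \<O> \<longleftrightarrow> origami \<O> \<and>
     (\<forall>g \<in> squares \<O>. \<forall>h \<in> squares \<O>. \<exists>f \<in> carrier (deck_group \<O>).
        f ` square_in_surface \<O> g = square_in_surface \<O> h)"

definition finite_p_group :: "nat \<Rightarrow> ('b, 'c) monoid_scheme \<Rightarrow> bool" where
  "finite_p_group p G \<longleftrightarrow> group G \<and> finite (carrier G) \<and> (\<exists>m. Coset.order G = p ^ m)"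

definition p_origami :: "nat \<Rightarrow> 'a origami_gluing \<Rightarrow> bool" where
  "p_origami p \<O> \<longleftrightarrow> normal_origami \<O> \<and> finite_p_group p (deck_group \<O>)"

section \<open>Cone angles, singularities and strata\<close>

text \<open>The angle of the unit square at one of its points: \<open>2 * pi\<close> in the interior, \<open>pi\<close> inside an
  edge and \<open>pi / 2\<close> at a corner. The cone angle at a point of the surface is the sum of the
  angles at all its (finitely many) representatives.\<close>

definition square_angle :: "real \<times> real \<Rightarrow> real" where
  "square_angle z = 2 * pi * (if fst z \<in> {0, 1} then 1 / 2 else 1) * (if snd z \<in> {0, 1} then 1 / 2 else 1)"

definition cone_angle :: "'a point \<Rightarrow> real" where
  "cone_angle P = (\<Sum>(g, z) \<in> P. square_angle z)"

definition point_multiplicity :: "'a point \<Rightarrow> nat" where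
  "point_multiplicity P = (THE a. a > 0 \<and> cone_angle P = 2 * pi * real a)"

definition singularities :: "'a origami_gluing \<Rightarrow> 'a point set" where
  "singularities \<O> = {P \<in> topspace (surface \<O>). point_multiplicity P > 1}"

text \<open>The part of the stratum of translation surfaces \<open>\<H>(k \<times> a)\<close> that consists of origamis.\<close>

definition stratum :: "nat \<Rightarrow> nat \<Rightarrow> 'a origami_gluing set" where
  "stratum k a = {\<O>. origami \<O> \<and> finite (singularities \<O>) \<and> card (singularities \<O>) = k \<and>
     (\<forall>P \<in> singularities \<O>. point_multiplicity P = a + 1)}"

text \<open>The genus is computed from the cell structure given by the squares, with open cells as
  subsets of the surface.\<close>

definition origami_vertices :: "'a origami_gluing \<Rightarrow> 'a point set" where
  "origami_vertices \<O> = glue_class \<O> ` (squares \<O> \<times> ({0, 1} \<times> {0, 1}))"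

definition open_sides :: "(real \<times> real) set set" where
  "open_sides = {{0} \<times> {0<..<1}, {1} \<times> {0<..<1}, {0<..<1} \<times> {0}, {0<..<1} \<times> {1}}"

definition origami_edges :: "'a origami_gluing \<Rightarrow> 'a point set set" where
  "origami_edges \<O> = {glue_class \<O> ` ({g} \<times> s) | g s. g \<in> squares \<O> \<and> s \<in> open_sides}"

definition origami_faces :: "'a origami_gluing \<Rightarrow> 'a point set set" where
  "origami_faces \<O> = {glue_class \<O> ` ({g} \<times> ({0<..<1} \<times> {0<..<1})) | g. g \<in> squares \<O>}"

definition euler_characteristic :: "'a origami_gluing \<Rightarrow> int" where
  "euler_characteristic \<O> =
     int (card (origami_vertices \<O>)) - int (card (origami_edges \<O>)) + int (card (origami_faces \<O>))"

definition genus :: "'a origami_gluing \<Rightarrow> nat" where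
  "genus \<O> = (THE \<gamma>. euler_characteristic \<O> = 2 - 2 * int \<gamma>)"

end

theory Submission
  imports Defs "HOL-Algebra.Group_Action" "HOL-Algebra.Multiplicative_Group" "HOL-Number_Theory.Residues"
begin

text \<open>
  The gluing of an origami is given by two permutations of its squares, \<open>r\<close> (right neighbour) and
  \<open>u\<close> (upper neighbour). Walking once around the lower left corner of a square leads to the square
  obtained by applying \<open>u r u\<^sup>-\<^sup>1 r\<^sup>-\<^sup>1\<close>. So the vertices of the surface are the cycles of this
  commutator, the multiplicity of a vertex is the length of its cycle, and all other points have
  multiplicity one.

  A deck transformation moves a point of a square to the point in the same position of another square.
  By continuity the other square depends on the first square only, and so deck transformations are
  the same as maps of the squares that commute with \<open>r\<close> and \<open>u\<close>
  (\<open>deck_transformation_cases\<close>, \<open>lift_deck\<close>). On a normal origami these maps act transitively.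
  Hence the permutations that commute with all of them act freely, and they form a group that contains
  \<open>r\<close> and \<open>u\<close> and acts transitively because the surface is connected. The order of this group is the
  degree \<open>p\<^sup>n\<close>, and all cycles of the commutator have the same length, its order \<open>p\<^sup>k\<close>
  (\<open>card_corner_orbit_eq_ord\<close>). If \<open>k = 0\<close>, there are no singularities and counting cells gives
  genus one; otherwise there are \<open>p\<^sup>n\<^sup>-\<^sup>k\<close> singularities of multiplicity \<open>p\<^sup>k\<close>.

  It remains to find the orders \<open>p\<^sup>k > 1\<close> of a commutator \<open>c\<close> in a group of order \<open>p\<^sup>n\<close>. If \<open>E\<close> is a
  normal subgroup of exponent \<open>p\<close>, then passing to the quotient by \<open>E\<close> divides the order of \<open>c\<close> by at
  most \<open>p\<close> and the order of the group by the order of \<open>E\<close>. Such an \<open>E\<close> of order at least \<open>p\<close> is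
  generated by a central element; if \<open>p\<close> is odd and the group is not abelian, one of order at least
  \<open>p\<^sup>2\<close> exists (\<open>large_normal_subgroup_of_exponent_p\<close>). Since a nonabelian group of order \<open>p\<^sup>n\<close>
  has \<open>n \<ge> 3\<close>, induction yields \<open>k + 2 \<le> n\<close> in general and \<open>2 k + 1 \<le> n\<close> for odd \<open>p\<close>
  (\<open>commutator_order_bound\<close>).

  Conversely, all these \<open>k\<close> come from semidirect products of a cyclic group of order \<open>p\<^sup>k\<^sup>+\<^sup>1\<close>,
  generated by \<open>x\<close>, with a cyclic group of order \<open>p\<^sup>n\<^sup>-\<^sup>k\<^sup>-\<^sup>1\<close>, generated by \<open>y\<close>, where
  \<open>y x y\<^sup>-\<^sup>1\<close> is \<open>x\<^sup>1\<^sup>+\<^sup>p\<close> for odd \<open>p\<close> and \<open>x\<^sup>-\<^sup>1\<close> for \<open>p = 2\<close>: the commutator generates the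
  subgroup of \<open>p\<close>-th powers of \<open>x\<close>, which has order \<open>p\<^sup>k\<close>.
\<close>

section \<open>Commutators in groups of prime power order\<close>

text \<open>Collecting the factors \<open>v\<close> of \<open>(v w)\<^sup>m\<close> on the left moves them past \<open>0 + 1 + \<dots> + (m - 1)\<close> factors
  \<open>w\<close>, and each such step produces one factor \<open>t\<close>.\<close>

lemma (in group) pow_mult_central_commutator:
  assumes v: "v \<in> carrier G" and w: "w \<in> carrier G" and t: "t \<in> carrier G"
    and comm: "w \<otimes> v = v \<otimes> w \<otimes> t" and tv: "t \<otimes> v = v \<otimes> t" and tw: "t \<otimes> w = w \<otimes> t"
  shows "(v \<otimes> w) [^] m = v [^] m \<otimes> w [^] m \<otimes> t [^] (m choose 2)"
proof (induction m)
  case (Suc m)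
  have tpow_v: "t [^] i \<otimes> v = v \<otimes> t [^] i" for i :: nat
    using group_commutes_pow[OF tv t v] .
  have tpow_w: "t [^] i \<otimes> w = w \<otimes> t [^] i" for i :: nat
    using group_commutes_pow[OF tw t w] .
  have wpow_v: "w [^] i \<otimes> v = v \<otimes> w [^] i \<otimes> t [^] i" for i :: nat
  proof (induction i)
    case (Suc i)
    have "w [^] Suc i \<otimes> v = w [^] i \<otimes> (w \<otimes> v)"
      using v w by (simp add: m_assoc)
    also have "\<dots> = w [^] i \<otimes> v \<otimes> w \<otimes> t"
      using v w t by (simp add: comm m_assoc)
    also have "\<dots> = v \<otimes> w [^] i \<otimes> (t [^] i \<otimes> w) \<otimes> t"
      using v w t by (simp add: Suc m_assoc)
    also have "\<dots> = v \<otimes> w [^] Suc i \<otimes> t [^] Suc i"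
      using v w t by (simp add: tpow_w m_assoc)
    finally show ?case .
  qed (use v in simp)
  have tpow_w': "t [^] i \<otimes> (w \<otimes> g) = w \<otimes> (t [^] i \<otimes> g)" if "g \<in> carrier G" for i :: nat and g
    using that t w by (simp add: tpow_w flip: m_assoc)
  have "(v \<otimes> w) [^] Suc m = v [^] m \<otimes> w [^] m \<otimes> (t [^] (m choose 2) \<otimes> v) \<otimes> w"
    using v w t by (simp add: Suc m_assoc)
  also have "\<dots> = v [^] m \<otimes> (w [^] m \<otimes> v) \<otimes> (t [^] (m choose 2) \<otimes> w)"
    using v w t by (simp add: tpow_v m_assoc)
  also have "\<dots> = v [^] Suc m \<otimes> w [^] m \<otimes> (t [^] m \<otimes> w) \<otimes> t [^] (m choose 2)"
    using v w t by (simp add: tpow_w tpow_w' wpow_v m_assoc)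
  also have "\<dots> = v [^] Suc m \<otimes> w [^] Suc m \<otimes> (t [^] m \<otimes> t [^] (m choose 2))"
    using v w t tpow_w[of m] by (simp add: m_assoc)
  also have "t [^] m \<otimes> t [^] (m choose 2) = t [^] (Suc m choose 2)"
    using t by (simp add: nat_pow_mult numeral_2_eq_2)
  finally show ?case .
qed (simp add: numeral_2_eq_2)

lemma (in group) group_hom_conjugation:
  "g \<in> carrier G \<Longrightarrow> group_hom G G (\<lambda>h. g \<otimes> h \<otimes> inv g)"
  by unfold_locales (auto simp: hom_def m_assoc inv_solve_left)

lemma (in group) conjugation_int_pow:
  assumes "g \<in> carrier G" "a \<in> carrier G"
  shows "g \<otimes> a [^] (i::int) \<otimes> inv g = (g \<otimes> a \<otimes> inv g) [^] i"
  using group_hom.hom_int_pow[OF group_hom_conjugation[OF assms(1)] assms(2)] .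

lemma (in group) generate_normalI:
  assumes a: "a \<in> carrier G" and conj: "\<And>g. g \<in> carrier G \<Longrightarrow> g \<otimes> a \<otimes> inv g \<in> generate G {a}"
  shows "generate G {a} \<lhd> G"
  unfolding normal_inv_iff
proof (intro conjI ballI)
  show sub: "subgroup (generate G {a}) G"
    using a by (intro generate_is_subgroup) auto
  fix g h assume g: "g \<in> carrier G" and "h \<in> generate G {a}"
  then obtain k :: int where h: "h = a [^] k"
    using generate_pow[OF a] by auto
  have "g \<otimes> h \<otimes> inv g = (g \<otimes> a \<otimes> inv g) [^] k"
    unfolding h by (rule conjugation_int_pow[OF g a])
  then show "g \<otimes> h \<otimes> inv g \<in> generate G {a}"
    using subgroup_int_pow_closed[OF sub conj[OF g]] by simp
qed

lemma (in group) generate_central_normal: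
  assumes z: "z \<in> carrier G" and comm: "\<And>g. g \<in> carrier G \<Longrightarrow> z \<otimes> g = g \<otimes> z"
  shows "generate G {z} \<lhd> G"
proof (rule generate_normalI[OF z])
  fix g assume g: "g \<in> carrier G"
  have "g \<otimes> z \<otimes> inv g = z"
    using z g by (simp flip: comm add: m_assoc)
  then show "g \<otimes> z \<otimes> inv g \<in> generate G {z}"
    by (simp add: generate.incl)
qed

text \<open>The elements of \<open>G Mod H\<close> are sets. A copy of the quotient on coset representatives stays in
  the type of \<open>G\<close>, which is what an induction over groups needs in order to pass to quotients.\<close>

lemma (in normal) factor_group_in_same_type:
  assumes "finite (carrier G)"
  shows "\<exists>(Q :: 'a monoid) h. group_hom G Q h \<and> h ` carrier G = carrier Q \<and> kernel G Q h = H \<and>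
    card (carrier Q) * card H = card (carrier G)"
proof -
  let ?rep = "\<lambda>U. SOME g. g \<in> U"
  let ?Q = "flatten (G Mod H) ?rep"
  let ?h = "\<lambda>g. ?rep (H #> g)"
  have inj: "inj_on ?rep (carrier (G Mod H))"
    by (rule flatten_set_group_mod_inj)
  have grp: "group ?Q"
    by (rule flatten_set_group_mod)
  have rep: "?rep \<in> hom (G Mod H) ?Q"
    by (rule flatten_set_group_hom[OF factorgroup_is_group inj])
  have "compose (carrier G) ?rep ((#>) H) \<in> hom G ?Q"
    by (rule hom_compose[OF r_coset_hom_Mod rep])
  then have hom: "group_hom G ?Q ?h"
    using grp by (simp add: group_hom_def group_hom_axioms_def is_group hom_def compose_def Pi_def)
  have car: "carrier ?Q = ?rep ` carrier (G Mod H)" "\<one>\<^bsub>?Q\<^esub> = ?rep H"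
    by (simp_all add: flatten_def)
  have surj: "?h ` carrier G = carrier ?Q"
    by (auto simp: car carrier_FactGroup)
  have "kernel G ?Q ?h = {g \<in> carrier G. H #> g = H}"
  proof -
    have "H \<in> carrier (G Mod H)"
      using subgroup_in_rcosets[OF is_group] by (simp add: FactGroup_def)
    moreover have "H #> g \<in> carrier (G Mod H)" if "g \<in> carrier G" for g
      using that by (auto simp: carrier_FactGroup)
    ultimately show ?thesis
      using inj by (auto simp: kernel_def car inj_on_def)
  qed
  also have "\<dots> = H"
    using rcos_const[OF is_group] coset_join1[OF _ _ is_subgroup] subset by auto
  finally have ker: "kernel G ?Q ?h = H" .
  have "card (carrier ?Q) = card (rcosets H)"
    unfolding car(1) card_image[OF inj] by (simp add: FactGroup_def)
  then have "card (carrier ?Q) * card H = card (carrier G)"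
    using lagrange[OF is_subgroup] by (simp add: Coset.order_def)
  with hom surj ker show ?thesis by blast
qed

locale prime_power_group = group G for G (structure) +
  fixes p n :: nat
  assumes prime: "prime p" and card_carrier: "card (carrier G) = p ^ n"
begin

lemma finite_carrier: "finite (carrier G)"
  using card_carrier prime prime_gt_0_nat by (metis card.infinite power_not_zero not_gr0)

lemma card_subgroup:
  assumes "subgroup H G"
  obtains i where "card H = p ^ i"
proof -
  have "card H dvd p ^ n"
    using lagrange[OF assms] card_carrier by (metis Coset.order_def dvd_triv_right)
  then show ?thesis
    using that prime by (auto simp: divides_primepow_nat)
qed

lemma ord_prime_power:
  assumes "a \<in> carrier G"
  obtains i where "ord a = p ^ i"
  using card_subgroup[OF generate_is_subgroup[of "{a}"]] assms generate_pow_card[OF assms]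
  by auto

text \<open>This is the class equation: the sizes of the conjugacy classes are powers of \<open>p\<close> and add up to
  \<open>p\<^sup>n\<close>, so \<open>{\<one>}\<close> cannot be the only class with one element. A power of a nontrivial central element
  has order \<open>p\<close>.\<close>

lemma central_element_of_prime_order:
  assumes "n > 0"
  obtains z where "z \<in> carrier G" "ord z = p" "\<And>g. g \<in> carrier G \<Longrightarrow> z \<otimes> g = g \<otimes> z"
proof -
  define \<phi> where "\<phi> = (\<lambda>g. \<lambda>h \<in> carrier G. g \<otimes> h \<otimes> inv g)"
  interpret act: group_action G "carrier G" \<phi>
    unfolding \<phi>_def by (rule action_by_conjugation)
  let ?orb = "orbit G \<phi>"
  have fixed: "g \<otimes> h = h \<otimes> g" if "card (?orb h) = 1" "g \<in> carrier G" "h \<in> carrier G" for g h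
  proof -
    have "h \<in> ?orb h"
      using act.orbit_refl that by blast
    moreover have "g \<otimes> h \<otimes> inv g \<in> ?orb h"
      using that by (auto simp: orbit_def \<phi>_def)
    ultimately have "g \<otimes> h \<otimes> inv g = h"
      using that(1) by (auto simp: card_1_singleton_iff)
    then show ?thesis
      using that(2,3) inv_solve_right[of h "g \<otimes> h" g] by simp
  qed
  have orb_one: "?orb \<one> = {\<one>}"
    using one_closed by (force simp: orbit_def \<phi>_def)
  have "\<exists>h \<in> carrier G. h \<noteq> \<one> \<and> card (?orb h) = 1"
  proof (rule ccontr)
    assume no: "\<not> ?thesis"
    have fin: "finite (orbits G (carrier G) \<phi>)"
      using finite_carrier by (simp add: orbits_def)
    have part: "partition (carrier G) (orbits G (carrier G) \<phi>)"
      by (rule act.orbit_partition)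
    have un: "\<Union> (orbits G (carrier G) \<phi>) = carrier G"
      using partition.partition_coverture[OF part] .
    have disj: "pairwise disjnt (orbits G (carrier G) \<phi>)"
      unfolding pairwise_def disjnt_def using partition.disjoint_union[OF part] by blast
    have dv: "p dvd card C" if C: "C \<in> orbits G (carrier G) \<phi> - {{\<one>}}" for C
    proof -
      obtain h where h: "h \<in> carrier G" "C = ?orb h"
        using C by (auto simp: orbits_def)
      then have "h \<noteq> \<one>" using that orb_one by auto
      then have "card C \<noteq> 1" using no h by auto
      moreover have "card C dvd p ^ n"
        using act.orbit_stabilizer_theorem[OF h(1)] card_carrier h(2)
        by (metis Coset.order_def dvd_triv_left)
      ultimately show ?thesis
        using prime by (metis divides_primepow_nat dvd_power not_gr0 power_0)
    qed
    have "card (carrier G) = (\<Sum>C\<in>orbits G (carrier G) \<phi>. card C)"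
      using card_Union_disjoint[OF disj] un finite_carrier
      by (metis Union_upper finite_subset)
    also have "\<dots> = card {\<one>} + (\<Sum>C\<in>orbits G (carrier G) \<phi> - {{\<one>}}. card C)"
      using orb_one by (intro sum.remove[OF fin]) (auto simp: orbits_def)
    finally have "p ^ n = 1 + (\<Sum>C\<in>orbits G (carrier G) \<phi> - {{\<one>}}. card C)"
      by (simp add: card_carrier)
    moreover have "p dvd (\<Sum>C\<in>orbits G (carrier G) \<phi> - {{\<one>}}. card C)"
      by (intro dvd_sum dv)
    moreover have "p dvd p ^ n" using assms by simp
    ultimately have "p dvd 1" by (metis dvd_add_left_iff)
    then show False using prime by (simp add: not_prime_unit)
  qed
  then obtain h where h: "h \<in> carrier G" "h \<noteq> \<one>" "card (?orb h) = 1" by auto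
  obtain i where i: "ord h = p ^ i"
    using ord_prime_power h(1) .
  with h ord_eq_1 have "i \<noteq> 0" by (metis power_0)
  then obtain j where j: "i = Suc j" by (cases i) auto
  let ?z = "h [^] (p ^ j)"
  have "ord ?z = p"
    using ord_pow[OF h(1), of "p ^ j"] prime by (simp add: i j prime_gt_0_nat)
  moreover have "?z \<otimes> g = g \<otimes> ?z" if "g \<in> carrier G" for g
    using group_commutes_pow[OF _ h(1) that] fixed[OF h(3) that h(1)] by simp
  ultimately show thesis
    using that h(1) by blast
qed

text \<open>The centre, the centralizer of \<open>x\<close> and the whole group are a strictly increasing chain of
  subgroups that starts above the trivial group.\<close>

lemma nonabelian_exponent:
  assumes x: "x \<in> carrier G" and y: "y \<in> carrier G" and ne: "x \<otimes> y \<noteq> y \<otimes> x"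
  shows "n \<ge> 3"
proof -
  let ?C = "\<lambda>X. {g \<in> carrier G. \<forall>h \<in> X. g \<otimes> h = h \<otimes> g}"
  have sub: "subgroup (?C X) G" if X: "X \<subseteq> carrier G" for X
  proof
    show "inv g \<in> ?C X" if "g \<in> ?C X" for g
    proof -
      have "inv g \<otimes> h = h \<otimes> inv g" if "h \<in> X" for h
      proof -
        have "g \<in> carrier G" "h \<in> carrier G" "g \<otimes> h = h \<otimes> g"
          using \<open>g \<in> ?C X\<close> X that by auto
        then show ?thesis
          by (metis inv_closed inv_solve_left inv_solve_right m_assoc m_closed)
      qed
      then show ?thesis using that by auto
    qed
    show "g \<otimes> g' \<in> ?C X" if "g \<in> ?C X" "g' \<in> ?C X" for g g'
      using that X by (auto simp: subset_iff m_assoc) (metis m_assoc)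
  qed (use X in auto)
  obtain i where i: "card (?C (carrier G)) = p ^ i" using card_subgroup[OF sub] by blast
  obtain j where j: "card (?C {x}) = p ^ j" using card_subgroup[OF sub[of "{x}"]] x by blast
  have "n > 0"
  proof (rule ccontr)
    assume "\<not> n > 0"
    then have "card (carrier G) = 1" using card_carrier by simp
    then show False using x y ne by (metis card_1_singletonE singletonD)
  qed
  then obtain z where z: "z \<in> carrier G" "ord z = p" "\<And>g. g \<in> carrier G \<Longrightarrow> z \<otimes> g = g \<otimes> z"
    using central_element_of_prime_order by blast
  then have "{\<one>, z} \<subseteq> ?C (carrier G)" "\<one> \<noteq> z"
    using prime by (auto simp: prime_gt_1_nat)
  then have "card {\<one>, z} \<le> p ^ i"
    unfolding i[symmetric] using finite_carrier by (intro card_mono) auto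
  then have "i > 0" using \<open>\<one> \<noteq> z\<close> by (cases i) auto
  moreover have "x \<in> ?C {x}" "x \<notin> ?C (carrier G)" "y \<in> carrier G" "y \<notin> ?C {x}"
    using x y ne by auto
  then have "?C (carrier G) \<subset> ?C {x}" "?C {x} \<subset> carrier G"
    using x by blast+
  then have "p ^ i < p ^ j" "p ^ j < p ^ n"
    unfolding i[symmetric] j[symmetric] card_carrier[symmetric] using finite_carrier
    by (auto intro!: psubset_card_mono)
  then have "i < j" "j < n"
    using prime_gt_1_nat[OF prime] by auto
  ultimately show ?thesis by linarith
qed

end

text \<open>Modulo \<open>p\<close> the power \<open>s\<^sup>p\<close> is \<open>s\<close> itself. Once \<open>s\<close> is known to be \<open>1\<close> modulo \<open>p\<close>, the cofactor
  \<open>1 + s + \<dots> + s\<^sup>p\<^sup>-\<^sup>1\<close> of \<open>s - 1\<close> in \<open>s\<^sup>p - 1\<close> is \<open>p\<close> times a number prime to \<open>p\<close>. This is where \<open>p\<close> has to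
  be odd, so that \<open>p\<close> divides \<open>0 + 1 + \<dots> + (p - 1)\<close>; for \<open>p = 2\<close>, \<open>s = -1\<close> and \<open>m = 3\<close> the second claim fails.\<close>

lemma cong_one_if_prime_power_cong_one:
  fixes s :: int
  assumes p: "prime p" "odd p" and m: "m > 0" and s: "int p ^ m dvd s ^ p - 1"
  shows "int p dvd s - 1" "int p ^ m dvd int p * (s - 1)"
proof -
  have "int p dvd s ^ p - 1"
    using s m by (metis dvd_power dvd_trans)
  moreover have "int p dvd s ^ p - s"
  proof (cases "int p dvd s")
    case True
    moreover have "int p dvd s ^ p"
      using True p by (meson dvd_power dvd_trans prime_gt_0_nat)
    ultimately show ?thesis by simp
  next
    case False
    then have "[s ^ (p - 1) = 1] (mod int p)"
    proof -
      define r where "r = nat (s mod int p)"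
      have r: "int r = s mod int p"
        using prime_gt_0_nat[OF p(1)] by (simp add: r_def)
      then have "\<not> p dvd r"
        using False by (metis dvd_mod_iff dvd_refl int_dvd_int_iff)
      then have "[r ^ (p - 1) = 1] (mod p)"
        using fermat_theorem p(1) by blast
      then have "[int r ^ (p - 1) = 1] (mod int p)"
        by (metis cong_int_iff of_nat_1 of_nat_power)
      moreover have "[s ^ (p - 1) = int r ^ (p - 1)] (mod int p)"
        unfolding r by (intro cong_pow) (simp add: cong_def)
      ultimately show ?thesis by (metis cong_trans)
    qed
    then have "[s * s ^ (p - 1) = s * 1] (mod int p)"
      by (rule cong_scalar_left)
    then show ?thesis
      using p prime_gt_0_nat[of p] by (simp add: cong_iff_dvd_diff flip: power_Suc)
  qed
  ultimately have "int p dvd (s ^ p - 1) - (s ^ p - s)" by (rule dvd_diff)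
  then show 1: "int p dvd s - 1" by simp
  then obtain q where q: "s = 1 + int p * q"
    by (metis add_diff_cancel_left' diff_add_cancel dvd_def add.commute)
  \<comment> \<open>The binomial expansion of the powers of \<open>1 + p q\<close> up to multiples of \<open>p\<^sup>2\<close>.\<close>
  have "\<exists>r. s ^ i = 1 + int i * int p * q + int p ^ 2 * r" for i :: nat
  proof (induction i)
    case (Suc i)
    then obtain r where "s ^ i = 1 + int i * int p * q + int p ^ 2 * r" by blast
    then have "s ^ Suc i = 1 + int (Suc i) * int p * q + int p ^ 2 * (int i * q ^ 2 + r * s)"
      by (simp add: q algebra_simps power2_eq_square)
    then show ?case by blast
  qed auto
  then obtain r where r: "\<And>i. s ^ i = 1 + int i * int p * q + int p ^ 2 * r i" by metis
  have "2 * (\<Sum>i<p. int i) = int p * (int p - 1)"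
    by (induction p) (auto simp: algebra_simps)
  moreover obtain k where k: "int p - 1 = 2 * k"
  proof -
    obtain j where "p = 2 * j + 1" using p(2) by (rule oddE)
    then have "int p - 1 = 2 * int j" by simp
    then show thesis by (rule that)
  qed
  ultimately have sum: "(\<Sum>i<p. int i) = int p * k" by simp
  have "(\<Sum>i<p. s ^ i) = int p + (\<Sum>i<p. int i) * (int p * q) + int p ^ 2 * (\<Sum>i<p. r i)"
    by (simp add: r sum.distrib sum_distrib_left sum_distrib_right mult.assoc)
  also have "\<dots> = int p * (1 + int p * (k * q + (\<Sum>i<p. r i)))"
    unfolding sum by (simp add: algebra_simps power2_eq_square)
  finally have "s ^ p - 1 = (int p * (s - 1)) * (1 + int p * (k * q + (\<Sum>i<p. r i)))"
    using power_diff_1_eq[of s p] by (simp add: algebra_simps)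
  moreover have "coprime (int p ^ m) (1 + int p * f)" for f
  proof -
    have "gcd (int p) (f * int p + 1) = 1"
      by (simp only: gcd_add_mult) simp
    then show ?thesis
      by (simp add: coprime_iff_gcd_eq_1[symmetric] ac_simps)
  qed
  ultimately show "int p ^ m dvd int p * (s - 1)"
    using s by (simp add: coprime_dvd_mult_left_iff)
qed

context prime_power_group
begin

text \<open>Let \<open>A\<close> be a normal cyclic subgroup, generated by \<open>a\<close>, of the largest possible order. As the group
  is not cyclic, \<open>A\<close> is proper, and some \<open>b\<close> outside \<open>A\<close> becomes central of order \<open>p\<close> modulo \<open>A\<close>. The
  subgroup \<open>B\<close> generated by \<open>a\<close> and \<open>b\<close> is normal. Conjugation by \<open>b\<close> raises the elements of \<open>A\<close> to the
  \<open>s\<close>-th power, where \<open>s\<^sup>p\<close> is \<open>1\<close> modulo the order of \<open>a\<close>. Hence the commutators in \<open>B\<close>, which are powers of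
  \<open>a\<^sup>s\<^sup>-\<^sup>1\<close>, are central in \<open>B\<close> and their \<open>p\<close>-th powers are trivial. For odd \<open>p\<close> it follows that taking
  \<open>p\<close>-th powers is a homomorphism on \<open>B\<close>, and \<open>E\<close> is its kernel. The elements of \<open>A\<close> in \<open>E\<close> form a group of
  order \<open>p\<close>. Moreover \<open>b\<^sup>p\<close> is the \<open>p\<close>-th power of an element of \<open>A\<close>, since otherwise \<open>b\<close> would generate a
  larger normal cyclic subgroup; dividing \<open>b\<close> by this element gives an element of \<open>E\<close> outside \<open>A\<close>.\<close>

lemma large_normal_subgroup_of_exponent_p:
  assumes odd: "odd p" and x: "x \<in> carrier G" and y: "y \<in> carrier G" and ne: "x \<otimes> y \<noteq> y \<otimes> x"
  obtains E where "E \<lhd> G" "\<And>g. g \<in> E \<Longrightarrow> g [^] p = \<one>" "p ^ 2 \<le> card E"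
proof -
  define cyc where "cyc = {a \<in> carrier G. generate G {a} \<lhd> G}"
  have "\<one> \<in> cyc"
    using one_is_normal by (simp add: cyc_def generate_one)
  then have cyc: "finite cyc" "cyc \<noteq> {}"
    using finite_carrier by (auto simp: cyc_def)
  obtain a where a_cyc: "a \<in> cyc" and a_max: "\<And>b. b \<in> cyc \<Longrightarrow> ord b \<le> ord a"
  proof -
    have "Max (ord ` cyc) \<in> ord ` cyc" using cyc by simp
    then obtain a where "a \<in> cyc" "ord a = Max (ord ` cyc)" by auto
    then show thesis using that cyc by auto
  qed
  define A where "A = generate G {a}"
  have a: "a \<in> carrier G" and "A \<lhd> G"
    using a_cyc by (auto simp: cyc_def A_def)
  interpret A: normal A G by fact
  have A_pow: "A = {a [^] i | i. i \<in> (UNIV :: int set)}"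
    using generate_pow[OF a] by (simp add: A_def)
  have a_comm: "a [^] i \<otimes> a [^] j = a [^] j \<otimes> a [^] i" for i j :: int
    using int_pow_mult[OF a, of i j] int_pow_mult[OF a, of j i] by (simp add: add.commute)
  have "A \<noteq> carrier G"
  proof
    assume "A = carrier G"
    then obtain i j :: int where "x = a [^] i" "y = a [^] j"
      using x y unfolding A_pow by blast
    then show False using ne a_comm by blast
  qed
  obtain Q :: "'a monoid" and h where h: "group_hom G Q h" "h ` carrier G = carrier Q"
      "kernel G Q h = A" and Q: "card (carrier Q) * card A = card (carrier G)"
    using A.factor_group_in_same_type[OF finite_carrier] by blast
  interpret h: group_hom G Q h by fact
  have "card (carrier Q) dvd p ^ n"
    using Q card_carrier by (metis dvd_triv_left)
  then obtain q where q: "card (carrier Q) = p ^ q"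
    using prime by (auto simp: divides_primepow_nat)
  interpret Q: prime_power_group Q p q
    by unfold_locales (use prime q in auto)
  have "q \<noteq> 0"
  proof
    assume "q = 0"
    then have "card A = card (carrier G)" using Q q by simp
    then show False
      using \<open>A \<noteq> carrier G\<close> A.subset finite_carrier by (metis card_subset_eq)
  qed
  then obtain w where w: "w \<in> carrier Q" "group.ord Q w = p"
      "\<And>g. g \<in> carrier Q \<Longrightarrow> w \<otimes>\<^bsub>Q\<^esub> g = g \<otimes>\<^bsub>Q\<^esub> w"
    using Q.central_element_of_prime_order by blast
  obtain b where b: "b \<in> carrier G" "h b = w"
    using w h by (metis imageE)
  have A_iff: "g \<in> A \<longleftrightarrow> h g = \<one>\<^bsub>Q\<^esub>" if "g \<in> carrier G" for g
    using that h(3) by (auto simp: kernel_def)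
  have "b \<notin> A"
    using A_iff b w(2) prime by (auto simp: prime_gt_1_nat)
  have "b [^] p \<in> A"
    using A_iff b w h.H.pow_ord_eq_1[of w] by (simp add: h.hom_nat_pow)
  have comm_b: "\<exists>i::int. g \<otimes> b \<otimes> inv g = a [^] i \<otimes> b" if g: "g \<in> carrier G" for g
  proof -
    have "h (g \<otimes> b \<otimes> inv g \<otimes> inv b) = \<one>\<^bsub>Q\<^esub>"
      using g b w by (simp add: h.H.m_assoc flip: w(3))
    then have "g \<otimes> b \<otimes> inv g \<otimes> inv b \<in> A"
      using A_iff[of "g \<otimes> b \<otimes> inv g \<otimes> inv b"] g b by simp
    then obtain i :: int where "g \<otimes> b \<otimes> inv g \<otimes> inv b = a [^] i"
      by (auto simp: A_pow)
    then have "g \<otimes> b \<otimes> inv g = a [^] i \<otimes> b"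
      using g b a by (simp add: inv_solve_right')
    then show ?thesis by blast
  qed
  obtain m where m: "ord a = p ^ m"
    using ord_prime_power[OF a] .
  \<comment> \<open>A central element of order \<open>p\<close> generates a nontrivial normal cyclic subgroup.\<close>
  have "m > 0"
  proof (rule ccontr)
    assume "\<not> m > 0"
    then have "ord a = 1" using m by simp
    have "n > 0" using nonabelian_exponent[OF x y ne] by simp
    then obtain z where z: "z \<in> carrier G" "ord z = p" "\<And>g. g \<in> carrier G \<Longrightarrow> z \<otimes> g = g \<otimes> z"
      using central_element_of_prime_order by blast
    have "generate G {z} \<lhd> G"
      using generate_central_normal[OF z(1,3)] .
    then have "ord z \<le> ord a" using a_max z(1) by (simp add: cyc_def)
    then show False using z(2) prime \<open>ord a = 1\<close> by (simp add: prime_nat_iff)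
  qed
  obtain s :: int where s: "b \<otimes> a \<otimes> inv b = a [^] s"
  proof -
    have "a \<in> A" by (simp add: A_def generate.incl)
    then have "b \<otimes> a \<otimes> inv b \<in> A" using b by (intro A.inv_op_closed2)
    then show thesis using that by (auto simp: A_pow)
  qed
  have b_a: "b \<otimes> a [^] i = a [^] (s * i) \<otimes> b" for i :: int
    using conjugation_int_pow[OF b(1) a, of i] a b s
    by (simp add: int_pow_pow inv_solve_right')
  have bj_a: "b [^] j \<otimes> a [^] i = a [^] (s ^ j * i) \<otimes> b [^] j" for i :: int and j :: nat
  proof (induction j arbitrary: i)
    case (Suc j)
    have "b [^] Suc j \<otimes> a [^] i = b [^] j \<otimes> a [^] (s * i) \<otimes> b"
      using a b by (simp add: m_assoc b_a)
    also have "\<dots> = a [^] (s ^ Suc j * i) \<otimes> b [^] Suc j"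
      using a b by (simp add: Suc m_assoc ac_simps)
    finally show ?case .
  qed (use a in simp)
  have a_cong: "a [^] i = a [^] j \<longleftrightarrow> int p ^ m dvd i - j" for i j :: int
    using int_pow_eq[OF a, of j i] by (auto simp: m)
  have "int p ^ m dvd s ^ p - 1"
  proof -
    obtain i :: int where i: "b [^] p = a [^] i"
      using \<open>b [^] p \<in> A\<close> by (auto simp: A_pow)
    have "a [^] (s ^ p) \<otimes> b [^] p = b [^] p \<otimes> a [^] (1::int)"
      using bj_a[of p 1] by simp
    also have "\<dots> = a [^] (1::int) \<otimes> b [^] p"
      unfolding i by (rule a_comm)
    finally have "a [^] (s ^ p) = a [^] (1::int)"
      using a b by (metis int_pow_closed nat_pow_closed right_cancel)
    then show ?thesis using a_cong by simp
  qed
  then have s1: "int p dvd s - 1" and s2: "int p ^ m dvd int p * (s - 1)"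
    using cong_one_if_prime_power_cong_one[OF prime odd \<open>m > 0\<close>] by auto
  have central: "b \<otimes> a [^] ((s - 1) * f) = a [^] ((s - 1) * f) \<otimes> b" for f
  proof -
    have "int p ^ m dvd (s - 1) * (s - 1) * f"
      using s1 s2 by (meson dvd_mult2 dvd_trans mult_dvd_mono dvd_refl)
    then have "a [^] (s * ((s - 1) * f)) = a [^] ((s - 1) * f)"
      unfolding a_cong by (simp add: algebra_simps)
    then show ?thesis using b_a by simp
  qed
  define B where "B = {a [^] i \<otimes> b [^] j | (i::int) (j::nat). True}"
  have BI: "a [^] i \<otimes> b [^] j \<in> B" for i :: int and j :: nat
    by (auto simp: B_def)
  have B_car: "B \<subseteq> carrier G"
    using a b by (auto simp: B_def)
  have mult_eq: "(a [^] i \<otimes> b [^] j) \<otimes> (a [^] k \<otimes> b [^] l) = a [^] (i + s ^ j * k) \<otimes> b [^] (j + l)"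
    for i k :: int and j l :: nat
  proof -
    have "(a [^] i \<otimes> b [^] j) \<otimes> (a [^] k \<otimes> b [^] l) = a [^] i \<otimes> (b [^] j \<otimes> a [^] k) \<otimes> b [^] l"
      using a b by (simp add: m_assoc)
    also have "\<dots> = a [^] i \<otimes> a [^] (s ^ j * k) \<otimes> (b [^] j \<otimes> b [^] l)"
      using a b by (simp add: m_assoc bj_a)
    finally show ?thesis
      using a b by (simp add: int_pow_mult nat_pow_mult)
  qed
  have B_mult: "v \<otimes> w \<in> B" if vw: "v \<in> B" "w \<in> B" for v w
    using vw mult_eq BI unfolding B_def by (auto 4 0)
  have B_one: "\<one> \<in> B"
    using BI[of 0 0] by simp
  have B_pow: "v [^] (j::nat) \<in> B" if "v \<in> B" for v j
    by (induction j) (use that B_one B_mult in auto)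
  have pow_p: "(v \<otimes> w) [^] p = v [^] p \<otimes> w [^] p" if vw: "v \<in> B" "w \<in> B" for v w
  proof -
    obtain i k :: int and j l :: nat where v: "v = a [^] i \<otimes> b [^] j" and w: "w = a [^] k \<otimes> b [^] l"
      using vw by (auto simp: B_def)
    have "s - 1 dvd s ^ l - 1" "s - 1 dvd s ^ j - 1"
      using power_diff_1_eq[of s] by (metis dvd_triv_left)+
    then have "s - 1 dvd (s ^ l - 1) * i - (s ^ j - 1) * k"
      by (simp add: dvd_diff dvd_mult2)
    then obtain f where "(s ^ l - 1) * i - (s ^ j - 1) * k = (s - 1) * f"
      by (auto simp: dvd_def)
    then have f: "k + s ^ l * i = (s - 1) * f + (i + s ^ j * k)"
      by (simp add: algebra_simps)
    define t where "t = a [^] ((s - 1) * f)"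
    have t: "t \<in> carrier G" using a by (simp add: t_def)
    have tB: "t \<otimes> g = g \<otimes> t" if g: "g \<in> B" for g
    proof -
      obtain i :: int and j :: nat where g: "g = a [^] i \<otimes> b [^] j" using g by (auto simp: B_def)
      have "b [^] j \<otimes> t = t \<otimes> b [^] j"
        using group_commutes_pow[OF central[of f] b(1)] a by (simp add: t_def)
      then show ?thesis
        using a b t a_comm[of "(s - 1) * f" i] unfolding g by (simp add: m_assoc t_def) (simp add: m_assoc[symmetric])
    qed
    have "w \<otimes> v = t \<otimes> (v \<otimes> w)"
      using a b unfolding v w mult_eq f t_def by (simp add: int_pow_mult m_assoc add.commute)
    then have "w \<otimes> v = v \<otimes> w \<otimes> t"
      using tB B_mult vw by simp
    then have "(v \<otimes> w) [^] p = v [^] p \<otimes> w [^] p \<otimes> t [^] (p choose 2)"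
      using vw B_car t tB by (intro pow_mult_central_commutator) auto
    \<comment> \<open>Here \<open>p\<close> is odd, so that \<open>p\<close> divides \<open>p choose 2\<close>.\<close>
    also have "t [^] (p choose 2) = \<one>"
    proof -
      obtain d where "p = 2 * d + 1" using odd by (rule oddE)
      then have d: "p choose 2 = p * d" by (simp add: choose_two)
      have "int p ^ m dvd int p * (s - 1) * (f * int d)"
        using s2 by (rule dvd_mult2)
      then have "a [^] ((s - 1) * f * int (p choose 2)) = a [^] (0::int)"
        unfolding a_cong by (simp add: d algebra_simps)
      then show ?thesis
        using a by (simp add: t_def int_pow_pow flip: int_pow_int)
    qed
    finally show ?thesis using vw B_car by (simp add: subset_iff)
  qed
  define E where "E = {g \<in> B. g [^] p = \<one>}"
  have E_sub: "subgroup E G"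
  proof
    show "inv g \<in> E" if "g \<in> E" for g
    proof -
      have g: "g \<in> carrier G" "g [^] p = \<one>" "g \<in> B" using that B_car by (auto simp: E_def)
      have "g \<otimes> g [^] (p - 1) = \<one>"
        using g prime_gt_0_nat[OF prime] nat_pow_Suc2[of g "p - 1"] by simp
      then have "inv g = g [^] (p - 1)"
        using g by (metis inv_equality nat_pow_closed inv_comm)
      then show ?thesis
        using g B_pow[OF g(3), of "p - 1"] nat_pow_pow[OF g(1), of p "p - 1"] nat_pow_pow[OF g(1), of "p - 1" p]
        by (simp add: E_def mult.commute)
    qed
  qed (use B_car B_mult B_one pow_p in \<open>auto simp: E_def\<close>)
  have E_normal: "E \<lhd> G"
    unfolding normal_inv_iff
  proof (intro conjI ballI E_sub)
    fix g v assume g: "g \<in> carrier G" and v: "v \<in> E"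
    then obtain i :: int and j :: nat where ij: "v = a [^] i \<otimes> b [^] j" and vp: "v [^] p = \<one>"
      by (auto simp: E_def B_def)
    have vG: "v \<in> carrier G" using a b ij by simp
    interpret c: group_hom G G "\<lambda>h. g \<otimes> h \<otimes> inv g"
      by (rule group_hom_conjugation[OF g])
    have "g \<otimes> a \<otimes> inv g \<in> A"
      using g by (intro A.inv_op_closed2) (simp_all add: A_def generate.incl)
    then obtain r :: int where r: "g \<otimes> a \<otimes> inv g = a [^] r" by (auto simp: A_pow)
    obtain r' :: int where r': "g \<otimes> b \<otimes> inv g = a [^] r' \<otimes> b" using comm_b[OF g] by blast
    have "g \<otimes> v \<otimes> inv g = (g \<otimes> a \<otimes> inv g) [^] i \<otimes> (g \<otimes> b \<otimes> inv g) [^] j"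
      using a b by (simp only: ij c.hom_mult int_pow_closed nat_pow_closed c.hom_int_pow c.hom_nat_pow)
    also have "\<dots> = (a [^] (r * i) \<otimes> b [^] (0::nat)) \<otimes> (a [^] r' \<otimes> b [^] (1::nat)) [^] j"
      using a b unfolding r r' by (simp add: int_pow_pow)
    also have "\<dots> \<in> B"
      by (intro B_mult B_pow BI)
    finally have "g \<otimes> v \<otimes> inv g \<in> B" .
    moreover have "(g \<otimes> v \<otimes> inv g) [^] p = \<one>"
      using c.hom_nat_pow[OF vG, of p] vp by simp
    ultimately show "g \<otimes> v \<otimes> inv g \<in> E" by (simp add: E_def)
  qed
  obtain k :: int where k: "b [^] p = a [^] k"
    using \<open>b [^] p \<in> A\<close> by (auto simp: A_pow)
  have "int p dvd k"
  proof (rule ccontr)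
    assume "\<not> int p dvd k"
    then have "coprime (int p) k"
      using prime by (intro prime_imp_coprime) simp_all
    then have "coprime k (int p ^ m)"
      by (simp add: coprime_commute)
    then obtain l where "[k * l = 1] (mod int p ^ m)"
      using cong_solve_coprime_int by blast
    then have "a [^] (k * l) = a [^] (1::int)"
      unfolding a_cong by (simp add: cong_iff_dvd_diff)
    then have "a = b [^] (int p * l)"
      using a b k by (simp flip: int_pow_pow add: int_pow_int)
    then have "a \<in> generate G {b}"
      using generate_pow[OF b(1)] by auto
    have sub_b: "subgroup (generate G {b}) G"
      using b by (intro generate_is_subgroup) auto
    have "generate G {b} \<lhd> G"
    proof (rule generate_normalI[OF b(1)])
      fix g assume "g \<in> carrier G"
      then obtain i :: int where i: "g \<otimes> b \<otimes> inv g = a [^] i \<otimes> b" using comm_b by blast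
      show "g \<otimes> b \<otimes> inv g \<in> generate G {b}"
        unfolding i using sub_b \<open>a \<in> generate G {b}\<close>
        by (simp add: subgroup.m_closed subgroup_int_pow_closed generate.incl)
    qed
    then have "ord b \<le> ord a"
      using a_max b by (simp add: cyc_def)
    moreover have "A \<subset> generate G {b}"
      using \<open>b \<notin> A\<close> generate.incl[of b "{b}" G] subgroup_int_pow_closed[OF sub_b \<open>a \<in> generate G {b}\<close>]
      by (auto simp: A_pow)
    then have "card A < card (generate G {b})"
      using subgroup.subset[OF sub_b] finite_carrier by (intro psubset_card_mono) (auto intro: finite_subset)
    ultimately show False
      using generate_pow_card[OF a] generate_pow_card[OF b(1)] by (simp add: A_def)
  qed
  then obtain k' where k': "k = int p * k'" by (auto simp: dvd_def)
  let ?e = "a [^] (- k') \<otimes> b"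
  have "?e \<in> E"
  proof -
    have B: "a [^] (- k') \<in> B" "b \<in> B"
      using BI[of "- k'" 0] BI[of 0 1] a b by simp_all
    have "?e [^] p = (a [^] (- k')) [^] (int p) \<otimes> b [^] p"
      using pow_p[OF B] by (simp add: int_pow_int)
    also have "\<dots> = \<one>"
      using a unfolding k k' by (simp only: int_pow_pow int_pow_mult[symmetric]) simp
    finally show ?thesis using B_mult[OF B] by (simp add: E_def)
  qed
  have "?e \<notin> A"
  proof
    assume "?e \<in> A"
    then obtain i :: int where "a [^] (- k') \<otimes> b = a [^] i" by (auto simp: A_pow)
    moreover have "a [^] k' \<otimes> (a [^] (- k') \<otimes> b) = b"
      using a b by (simp add: int_pow_neg flip: m_assoc)
    ultimately have "b = a [^] k' \<otimes> a [^] i" by simp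
    then have "b = a [^] (k' + i)"
      using a by (simp add: int_pow_mult)
    then show False using \<open>b \<notin> A\<close> by (auto simp: A_pow)
  qed
  let ?a0 = "a [^] (p ^ (m - 1))"
  have "p ^ m = p ^ (m - 1) * p"
    using \<open>m > 0\<close> by (cases m) auto
  then have ord_a0: "ord ?a0 = p"
    using ord_pow[OF a, of "p ^ (m - 1)"] prime by (simp add: m prime_gt_0_nat)
  then have "?a0 \<in> E"
    using pow_ord_eq_1[of ?a0] BI[of "int (p ^ (m - 1))" 0] a unfolding E_def int_pow_int by simp
  moreover have "?a0 \<in> A"
    unfolding A_pow int_pow_int[symmetric] by blast
  ultimately have "generate G {?a0} \<subset> E"
    using generate_subgroup_incl[OF _ E_sub, of "{?a0}"] generate_subgroup_incl[OF _ A.is_subgroup, of "{?a0}"]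
      \<open>?e \<in> E\<close> \<open>?e \<notin> A\<close> by blast
  then have "card (generate G {?a0}) < card E"
    using subgroup.subset[OF E_sub] finite_carrier by (intro psubset_card_mono) (auto intro: finite_subset)
  then have "p < card E"
    using generate_pow_card[of ?a0] ord_a0 a by simp
  moreover obtain i where i: "card E = p ^ i"
    using card_subgroup[OF E_sub] .
  ultimately have "p ^ 1 < p ^ i" by simp
  then have "2 \<le> i"
    using prime_gt_1_nat[OF prime] by (metis power_less_imp_less_exp Suc_leI one_add_one plus_1_eq_Suc)
  then have "p ^ 2 \<le> card E"
    unfolding i using prime_ge_1_nat[OF prime] by (simp add: power_increasing)
  then show thesis
    using that E_normal by (auto simp: E_def)
qed

text \<open>For \<open>e = 1\<close> a central subgroup of order \<open>p\<close> suffices.\<close>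

lemma normal_subgroup_of_exponent_p:
  assumes x: "x \<in> carrier G" and y: "y \<in> carrier G" and ne: "x \<otimes> y \<noteq> y \<otimes> x"
    and e: "e = 1 \<or> e = 2 \<and> odd p"
  obtains E where "E \<lhd> G" "\<And>g. g \<in> E \<Longrightarrow> g [^] p = \<one>" "p ^ e \<le> card E"
  using e
proof
  assume "e = 2 \<and> odd p"
  then show thesis
    using large_normal_subgroup_of_exponent_p[OF _ x y ne] that by blast
next
  assume e: "e = 1"
  have "n > 0" using nonabelian_exponent[OF x y ne] by simp
  then obtain z where z: "z \<in> carrier G" "ord z = p" "\<And>g. g \<in> carrier G \<Longrightarrow> z \<otimes> g = g \<otimes> z"
    using central_element_of_prime_order by blast
  show thesis
  proof (rule that)
    show "generate G {z} \<lhd> G"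
      using generate_central_normal[OF z(1,3)] .
    show "g [^] p = \<one>" if "g \<in> generate G {z}" for g
    proof -
      obtain i :: int where "g = z [^] i" using generate_pow[OF z(1)] \<open>g \<in> _\<close> by auto
      then have "g [^] p = (z [^] int p) [^] i"
        using z(1) by (simp add: int_pow_pow mult.commute flip: int_pow_int)
      then show ?thesis using pow_ord_eq_1[OF z(1)] z(2) by (simp add: int_pow_int)
    qed
    show "p ^ e \<le> card (generate G {z})"
      using generate_pow_card[OF z(1)] z(2) e by simp
  qed
qed

end

text \<open>In the quotient by a normal subgroup \<open>E\<close> of exponent \<open>p\<close> the commutator has order at least
  \<open>p\<^sup>k\<^sup>-\<^sup>1\<close>, because a power of it that lies in \<open>E\<close> is killed by taking \<open>p\<close>-th powers. So each step of the
  induction lowers \<open>k\<close> by at most \<open>1\<close> and \<open>n\<close> by at least \<open>e\<close>. For \<open>k = 1\<close> the group is merely nonabelian.\<close>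

theorem commutator_order_bound:
  fixes G :: "'a monoid" (structure)
  assumes "prime_power_group G p n" "x \<in> carrier G" "y \<in> carrier G"
    and "group.ord G (x \<otimes> y \<otimes> inv x \<otimes> inv y) = p ^ k" "k \<ge> 1"
    and e: "e = 1 \<or> e = 2 \<and> odd p"
  shows "e * (k - 1) + 3 \<le> n"
  using assms(1-5)
proof (induction n arbitrary: G x y k rule: less_induct)
  case (less n G x y k)
  interpret prime_power_group G p n by (rule less.prems)
  let ?c = "x \<otimes>\<^bsub>G\<^esub> y \<otimes>\<^bsub>G\<^esub> inv\<^bsub>G\<^esub> x \<otimes>\<^bsub>G\<^esub> inv\<^bsub>G\<^esub> y"
  have x: "x \<in> carrier G" and y: "y \<in> carrier G" and c: "?c \<in> carrier G"
    using less.prems by auto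
  have ne: "x \<otimes>\<^bsub>G\<^esub> y \<noteq> y \<otimes>\<^bsub>G\<^esub> x"
  proof
    assume "x \<otimes>\<^bsub>G\<^esub> y = y \<otimes>\<^bsub>G\<^esub> x"
    then have "?c = \<one>\<^bsub>G\<^esub>" using x y by (simp add: m_assoc)
    then have "p ^ k = 1" using less.prems(4) by simp
    then show False using \<open>k \<ge> 1\<close> prime by (auto simp: prime_nat_iff)
  qed
  show ?case
  proof (cases "k = 1")
    case True
    then show ?thesis using nonabelian_exponent[OF x y ne] by simp
  next
    case False
    obtain E where E: "E \<lhd> G" "\<And>g. g \<in> E \<Longrightarrow> g [^]\<^bsub>G\<^esub> p = \<one>\<^bsub>G\<^esub>" "p ^ e \<le> card E"
      using normal_subgroup_of_exponent_p[OF x y ne e] by blast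
    interpret E: normal E G by (rule E(1))
    obtain Q :: "'a monoid" and h where h: "group_hom G Q h" "h ` carrier G = carrier Q"
        "kernel G Q h = E" and Q: "card (carrier Q) * card E = card (carrier G)"
      using E.factor_group_in_same_type[OF finite_carrier] by blast
    interpret h: group_hom G Q h by (rule h(1))
    have "card (carrier Q) dvd p ^ n"
      using Q card_carrier by (metis dvd_triv_left)
    then obtain q where q: "card (carrier Q) = p ^ q"
      using prime by (auto simp: divides_primepow_nat)
    have Qp: "prime_power_group Q p q"
      by unfold_locales (use prime q in auto)
    have "p ^ (q + e) \<le> p ^ n"
      unfolding card_carrier[symmetric] Q[symmetric] q power_add using E(3) by (rule mult_le_mono2)
    then have qn: "q + e \<le> n"
      using prime_gt_1_nat[OF prime] by simp
    have hc: "h ?c = h x \<otimes>\<^bsub>Q\<^esub> h y \<otimes>\<^bsub>Q\<^esub> inv\<^bsub>Q\<^esub> h x \<otimes>\<^bsub>Q\<^esub> inv\<^bsub>Q\<^esub> h y"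
      using x y by simp
    obtain l where l: "group.ord Q (h ?c) = p ^ l"
      using prime_power_group.ord_prime_power[OF Qp h.hom_closed[OF c]] .
    have "h (?c [^]\<^bsub>G\<^esub> (p ^ l)) = \<one>\<^bsub>Q\<^esub>"
      using h.hom_nat_pow[OF c, of "p ^ l"] h.H.pow_ord_eq_1[OF h.hom_closed[OF c]] by (simp only: l)
    then have "?c [^]\<^bsub>G\<^esub> (p ^ l) \<in> E"
      unfolding h(3)[symmetric] kernel_def using c by simp
    then have "?c [^]\<^bsub>G\<^esub> (p ^ l * p) = \<one>\<^bsub>G\<^esub>"
      using E(2) c nat_pow_pow[OF c, of "p ^ l" p] by simp
    then have "p ^ k dvd p ^ Suc l"
      using pow_eq_id[OF c] less.prems(4) by (simp add: mult.commute)
    then have kl: "k \<le> Suc l"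
      using prime_gt_1_nat[OF prime] by (metis dvd_power_iff_le Suc_leI one_add_one plus_1_eq_Suc)
    moreover have "e \<ge> 1" using e by auto
    ultimately have "e * (l - 1) + 3 \<le> q"
      using False less.prems(5) qn less.IH[OF _ Qp, of "h x" "h y" l] l hc x y by auto
    moreover have "k - 1 \<le> (l - 1) + 1" using kl False less.prems(5) by linarith
    then have "e * (k - 1) \<le> e * (l - 1) + e"
      by (metis mult_le_mono2 distrib_left mult.right_neutral)
    ultimately show ?thesis using qn by linarith
  qed
qed

section \<open>Surfaces glued from squares\<close>

lemma bij_betw_funpow_periodic:
  assumes "finite A" "bij_betw f A A" "x \<in> A"
  obtains m where "m > 0" "(f ^^ m) x = x"
proof -
  have bij: "bij_betw (f ^^ i) A A" for i
    using assms(2) by (rule bij_betw_funpow)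
  have mem: "(f ^^ i) x \<in> A" for i
    using bij_betwE[OF bij] assms(3) by blast
  then have "(\<lambda>i. (f ^^ i) x) ` UNIV \<subseteq> A"
    by blast
  then have "\<not> inj (\<lambda>i. (f ^^ i) x)"
    using assms(1) finite_imageD finite_subset infinite_UNIV_nat by blast
  then obtain i j where "i \<noteq> j" "(f ^^ i) x = (f ^^ j) x"
    unfolding inj_def by blast
  then obtain i j where ij: "i < j" "(f ^^ i) x = (f ^^ j) x"
    by (cases "i < j") (force, metis linorder_neqE_nat)
  have "(f ^^ i) ((f ^^ (j - i)) x) = (f ^^ i) x"
    using ij funpow_add[of i "j - i" f] by (simp add: fun_eq_iff)
  then have "(f ^^ (j - i)) x = x"
    using inj_onD[OF bij_betw_imp_inj_on[OF bij]] assms(3) mem by blast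
  then show thesis using that[of "j - i"] ij by simp
qed

lemma card_image_same_fibres:
  assumes "\<And>a b. a \<in> A \<Longrightarrow> b \<in> A \<Longrightarrow> f a = f b \<longleftrightarrow> k a = k b"
  shows "card (f ` A) = card (k ` A)"
proof -
  have key: "k (inv_into A f (f a)) = k a" if "a \<in> A" for a
    using assms[of "inv_into A f (f a)" a] that by (simp add: f_inv_into_f inv_into_into)
  have "inj_on (\<lambda>y. k (inv_into A f y)) (f ` A)"
  proof (rule inj_onI)
    fix y y' assume "y \<in> f ` A" "y' \<in> f ` A" and eq: "k (inv_into A f y) = k (inv_into A f y')"
    then obtain a b where "a \<in> A" "y = f a" "b \<in> A" "y' = f b" by blast
    then show "y = y'" using eq key assms by simp
  qed
  moreover have "(\<lambda>y. k (inv_into A f y)) ` (f ` A) = k ` A"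
    using key by (simp add: image_image)
  ultimately show ?thesis by (metis card_image)
qed

lemma glue_class_eq_iff: "glue_class \<O> a = glue_class \<O> b \<longleftrightarrow> equivclp (glued \<O>) a b"
proof
  assume "glue_class \<O> a = glue_class \<O> b"
  moreover have "b \<in> glue_class \<O> b" by (simp add: glue_class_def)
  ultimately have "b \<in> glue_class \<O> a" by simp
  then show "equivclp (glued \<O>) a b" by (simp add: glue_class_def)
qed (auto simp: glue_class_def intro: equivclp_trans equivclp_sym)

locale square_gluing =
  fixes \<O> :: "'a origami_gluing"
  assumes finite_squares: "finite (squares \<O>)"
    and bij_right: "bij_betw (right_nb \<O>) (squares \<O>) (squares \<O>)"
    and bij_upper: "bij_betw (upper_nb \<O>) (squares \<O>) (squares \<O>)"
begin

abbreviation "S \<equiv> squares \<O>"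
abbreviation "r \<equiv> right_nb \<O>"
abbreviation "u \<equiv> upper_nb \<O>"

definition left_nb :: "'a \<Rightarrow> 'a" where "left_nb = inv_into S r"
definition lower_nb :: "'a \<Rightarrow> 'a" where "lower_nb = inv_into S u"

lemma neighbours_in [simp]:
  "g \<in> S \<Longrightarrow> r g \<in> S" "g \<in> S \<Longrightarrow> u g \<in> S" "g \<in> S \<Longrightarrow> left_nb g \<in> S" "g \<in> S \<Longrightarrow> lower_nb g \<in> S"
  using bij_right bij_upper
  by (auto simp: bij_betw_def left_nb_def lower_nb_def intro: inv_into_into)

lemma neighbours_inverse [simp]:
  "g \<in> S \<Longrightarrow> r (left_nb g) = g" "g \<in> S \<Longrightarrow> u (lower_nb g) = g"
  "g \<in> S \<Longrightarrow> left_nb (r g) = g" "g \<in> S \<Longrightarrow> lower_nb (u g) = g"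
  using bij_right bij_upper
  by (auto simp: bij_betw_def left_nb_def lower_nb_def f_inv_into_f)

text \<open>One full turn around the lower left corner of \<open>g\<close>, starting and ending above and to the right of
  it: the squares on the way are reached by going left, down, right and up.\<close>

definition turn :: "'a \<Rightarrow> 'a" where
  "turn g = u (r (lower_nb (left_nb g)))"

lemma turn_eq: "g \<in> S \<Longrightarrow> turn (r (u g)) = u (r g)"
  by (simp add: turn_def)

lemma turn_in [simp]: "g \<in> S \<Longrightarrow> turn g \<in> S"
  by (simp add: turn_def)

lemma bij_turn: "bij_betw turn S S"
  by (rule bij_betw_byWitness[where f' = "\<lambda>g. r (u (left_nb (lower_nb g)))"]) (auto simp: turn_def)

lemma turn_funpow_in [simp]: "g \<in> S \<Longrightarrow> (turn ^^ i) g \<in> S"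
  by (induction i) auto

text \<open>The squares that have the same point of the surface as their lower left corner.\<close>

definition corner_orbit :: "'a \<Rightarrow> 'a set" where
  "corner_orbit g = range (\<lambda>i. (turn ^^ i) g)"

lemma corner_orbit_self [simp]: "g \<in> corner_orbit g"
  unfolding corner_orbit_def by (rule range_eqI[of _ _ 0]) simp

lemma corner_orbit_subset: "g \<in> S \<Longrightarrow> corner_orbit g \<subseteq> S"
  by (auto simp: corner_orbit_def)

lemma corner_orbit_turn:
  assumes "g \<in> S"
  shows "corner_orbit (turn g) = corner_orbit g"
proof
  have "(turn ^^ i) (turn g) = (turn ^^ Suc i) g" for i
    by (simp only: funpow_Suc_right comp_apply)
  then show "corner_orbit (turn g) \<subseteq> corner_orbit g"
    unfolding corner_orbit_def by blast
  obtain m where m: "m > 0" "(turn ^^ m) g = g"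
    using bij_betw_funpow_periodic[OF finite_squares bij_turn assms] .
  have "(turn ^^ i) g \<in> corner_orbit (turn g)" for i
  proof -
    have "(turn ^^ i) g = (turn ^^ i) ((turn ^^ Suc (m - 1)) g)"
      using m by simp
    also have "\<dots> = (turn ^^ (i + (m - 1))) (turn g)"
      by (simp only: funpow_add funpow_Suc_right comp_apply)
    finally show ?thesis by (auto simp: corner_orbit_def)
  qed
  then show "corner_orbit g \<subseteq> corner_orbit (turn g)"
    by (auto simp: corner_orbit_def)
qed

lemma corner_orbit_eq:
  assumes "g \<in> S" "h \<in> corner_orbit g"
  shows "corner_orbit h = corner_orbit g"
proof -
  have "corner_orbit ((turn ^^ i) g) = corner_orbit g" for i
    by (induction i) (use assms(1) in \<open>auto simp: corner_orbit_turn\<close>)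
  then show ?thesis using assms(2) by (auto simp: corner_orbit_def)
qed

section \<open>Points of the surface and their representatives\<close>

text \<open>Replacing the coordinate \<open>1\<close> by \<open>0\<close> in the neighbouring square, every point of the surface gets a
  representative with coordinates in the half-open unit interval. It is unique except at the vertices,
  where the squares of a corner orbit are equally good. Remembering only the orbit there turns it into
  a complete invariant of the points, the label.\<close>

definition canonical_rep :: "'a \<times> real \<times> real \<Rightarrow> 'a \<times> real \<times> real" where
  "canonical_rep = (\<lambda>(g, s, t). let h = (if t = 1 then u g else g) in
     (if s = 1 then r h else h, if s = 1 then 0 else s, if t = 1 then 0 else t))"

definition point_label :: "'a \<times> real \<times> real \<Rightarrow> 'a set \<times> real \<times> real" where
  "point_label q = (case canonical_rep q of (g, z) \<Rightarrow> (if z = (0, 0) then corner_orbit g else {g}, z))"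

abbreviation "cells \<equiv> S \<times> unit_square"

lemma cells_iff: "(g, s, t) \<in> cells \<longleftrightarrow> g \<in> S \<and> 0 \<le> s \<and> s \<le> 1 \<and> 0 \<le> t \<and> t \<le> 1"
  by (auto simp: unit_square_def)

lemma point_label_glued:
  assumes "glued \<O> a b"
  shows "point_label a = point_label b"
  using assms
proof cases
  case (horizontal g t)
  then show ?thesis
    \<comment> \<open>At \<open>t = 1\<close> the two sides are normalized along different paths around a square, which lead to
    squares that differ by one turn.\<close>
    using corner_orbit_turn[of "r (u g)"]
    by (auto simp: point_label_def canonical_rep_def turn_eq)
next
  case (vertical g t)
  then show ?thesis
    by (auto simp: point_label_def canonical_rep_def)
qed

lemma point_label_equivclp:
  assumes "equivclp (glued \<O>) a b"
  shows "point_label a = point_label b"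
  using assms by (induction rule: equivclp_induct) (auto dest: point_label_glued)

lemma glued_in_cells:
  assumes "glued \<O> a b"
  shows "a \<in> cells" "b \<in> cells"
  using assms by (cases; auto simp: unit_square_def)+

lemma equivclp_in_cells:
  assumes "equivclp (glued \<O>) a b" "a \<in> cells"
  shows "b \<in> cells"
  using assms by (induction rule: equivclp_induct) (auto dest: glued_in_cells)

lemma canonical_rep_equivclp:
  assumes "a \<in> cells"
  shows "equivclp (glued \<O>) a (canonical_rep a)"
proof -
  obtain g s t where a: "a = (g, s, t)" by (cases a)
  have gst: "g \<in> S" "s \<in> {0..1}" "t \<in> {0..1}" using assms unfolding a cells_iff by auto
  define h where "h = (if t = 1 then u g else g)"
  define t' where "t' = (if t = 1 then 0 else t)"
  have ht: "h \<in> S" "t' \<in> {0..1}" using gst by (auto simp: h_def t'_def)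
  have 1: "equivclp (glued \<O>) a (h, s, t')"
    unfolding a h_def t'_def using glued.vertical[of g \<O> s] gst by auto
  have 2: "equivclp (glued \<O>) (h, s, t') (if s = 1 then (r h, 0, t') else (h, s, t'))"
    using glued.horizontal[of h \<O> t'] ht by auto
  have "canonical_rep a = (if s = 1 then (r h, 0, t') else (h, s, t'))"
    by (simp add: a canonical_rep_def h_def t'_def Let_def)
  then show ?thesis using equivclp_trans[OF 1 2] by simp
qed

lemma turn_equivclp:
  assumes "g \<in> S"
  shows "equivclp (glued \<O>) (g, 0, 0) (turn g, 0, 0)"
proof -
  define h where "h = lower_nb (left_nb g)"
  have h: "h \<in> S" "r (u h) = g" "turn g = u (r h)" using assms by (auto simp: h_def turn_def)
  have "equivclp (glued \<O>) (h, 1, 1) (u h, 1, 0)" "equivclp (glued \<O>) (u h, 1, 0) (g, 0, 0)"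
    "equivclp (glued \<O>) (h, 1, 1) (r h, 0, 1)" "equivclp (glued \<O>) (r h, 0, 1) (turn g, 0, 0)"
    using h glued.vertical[of h \<O> 1] glued.horizontal[of "u h" \<O> 0] glued.horizontal[of h \<O> 1]
      glued.vertical[of "r h" \<O> 0] by auto
  then show ?thesis by (meson equivclp_sym equivclp_trans)
qed

lemma corner_orbit_equivclp:
  assumes "g \<in> S" "h \<in> corner_orbit g"
  shows "equivclp (glued \<O>) (g, 0, 0) (h, 0, 0)"
proof -
  have "equivclp (glued \<O>) (g, 0, 0) ((turn ^^ i) g, 0, 0)" for i
  proof (induction i)
    case (Suc i)
    then show ?case using turn_equivclp[of "(turn ^^ i) g"] assms(1) by (auto intro: equivclp_trans)
  qed simp
  then show ?thesis using assms(2) by (auto simp: corner_orbit_def)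
qed

lemma equivclp_iff_label:
  assumes "a \<in> cells" "b \<in> cells"
  shows "equivclp (glued \<O>) a b \<longleftrightarrow> point_label a = point_label b"
proof
  assume eq: "point_label a = point_label b"
  obtain g z where a: "canonical_rep a = (g, z)" by (rule prod.exhaust)
  obtain h z' where b: "canonical_rep b = (h, z')" by (rule prod.exhaust)
  have "equivclp (glued \<O>) a (g, z)" "equivclp (glued \<O>) b (h, z')"
    using canonical_rep_equivclp assms a b by metis+
  moreover from this have "(g, z) \<in> cells" "(h, z') \<in> cells"
    using assms equivclp_in_cells by blast+
  moreover have "z' = z" "if z = (0, 0) then corner_orbit g = corner_orbit h else g = h"
    using eq by (auto simp: point_label_def a b split: if_splits)
  then have "equivclp (glued \<O>) (g, z) (h, z')"
    using corner_orbit_equivclp[of g h] corner_orbit_self[of h] calculation(3) by (cases "z = (0, 0)") auto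
  ultimately show "equivclp (glued \<O>) a b"
    by (meson equivclp_sym equivclp_trans)
qed (rule point_label_equivclp)

abbreviation "glue \<equiv> glue_class \<O>"

lemma glue_eq_iff:
  assumes "a \<in> cells" "b \<in> cells"
  shows "glue a = glue b \<longleftrightarrow> point_label a = point_label b"
  unfolding glue_class_eq_iff by (rule equivclp_iff_label[OF assms])

lemma glue_eq_set:
  assumes "a \<in> cells"
  shows "glue a = {b \<in> cells. point_label b = point_label a}"
proof -
  have "equivclp (glued \<O>) a b \<longleftrightarrow> b \<in> cells \<and> point_label b = point_label a" for b
    using equivclp_iff_label[OF assms, of b] equivclp_in_cells[OF _ assms, of b]
    by (cases "b \<in> cells") auto
  then show ?thesis by (simp only: glue_class_def)
qed

lemma self_in_glue: "a \<in> glue a"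
  by (simp add: glue_class_def)

lemma glue_eqI: "b \<in> glue a \<Longrightarrow> glue b = glue a"
  unfolding glue_class_eq_iff by (auto simp: glue_class_def intro: equivclp_sym)

lemma glue_horizontal: "g \<in> S \<Longrightarrow> t \<in> {0..1} \<Longrightarrow> glue (g, 1, t) = glue (r g, 0, t)"
  using glued.horizontal[of g \<O> t] by (intro glue_eqI[symmetric]) (auto simp: glue_class_def)

lemma glue_vertical: "g \<in> S \<Longrightarrow> t \<in> {0..1} \<Longrightarrow> glue (g, t, 1) = glue (u g, t, 0)"
  using glued.vertical[of g \<O> t] by (intro glue_eqI[symmetric]) (auto simp: glue_class_def)

lemma glue_canonical: "a \<in> cells \<Longrightarrow> glue (canonical_rep a) = glue a"
  using canonical_rep_equivclp by (intro glue_eqI) (auto simp: glue_class_def)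

lemma point_label_simps:
  "0 \<le> s \<Longrightarrow> s < 1 \<Longrightarrow> 0 \<le> t \<Longrightarrow> t < 1 \<Longrightarrow>
    point_label (g, s, t) = (if s = 0 \<and> t = 0 then corner_orbit g else {g}, s, t)"
  by (simp add: point_label_def canonical_rep_def)

lemma glue_eq_noncorner:
  assumes "g \<in> S" "h \<in> S" "0 \<le> s" "s < 1" "0 \<le> t" "t < 1" "s \<noteq> 0 \<or> t \<noteq> 0"
    and "glue (g, s, t) = glue (h, s, t)"
  shows "g = h"
  using assms by (subst (asm) glue_eq_iff) (auto simp: point_label_simps unit_square_def)

section \<open>Open stars\<close>

text \<open>Open stars serve as neighbourhoods: in each coordinate they extend over the open unit interval
  if the coordinate of the point is interior, and up to distance \<open>1 / 2\<close> if it is an end point. This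
  makes them compatible with the gluing, because crossing a side interchanges end points and keeps
  interior coordinates; a ball of fixed radius around a point close to a vertex would not be.\<close>

definition near :: "real \<Rightarrow> real \<Rightarrow> bool" where
  "near a b \<longleftrightarrow> (if b \<in> {0, 1} then \<bar>a - b\<bar> < 1 / 2 else 0 < a \<and> a < 1)"

definition star :: "'a point \<Rightarrow> ('a \<times> real \<times> real) set" where
  "star P = {(g, s, t) \<in> cells. \<exists>s1 t1. (g, s1, t1) \<in> P \<and> near s s1 \<and> near t t1}"

lemma near_refl: "b \<in> {0..1} \<Longrightarrow> near b b"
  by (auto simp: near_def)

lemma near_ends: "near 1 b \<Longrightarrow> b \<in> {0..1} \<Longrightarrow> b = 1" "near 0 b \<Longrightarrow> b \<in> {0..1} \<Longrightarrow> b = 0" "near 0 0" "near 1 1"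
  by (auto simp: near_def split: if_splits)

lemma open_near: "open {a. near a b}"
proof (cases "b \<in> {0, 1}")
  case True
  then have "{a. near a b} = ball b (1 / 2)"
    by (auto simp: near_def dist_real_def abs_minus_commute)
  then show ?thesis by simp
next
  case False
  then have "{a. near a b} = {0<..<1}"
    by (auto simp: near_def)
  then show ?thesis by simp
qed

lemma star_self: "q \<in> cells \<Longrightarrow> q \<in> star (glue q)"
  using self_in_glue[of q] by (cases q) (auto simp: star_def unit_square_def intro!: exI near_refl)

lemma star_glued:
  assumes "q0 \<in> cells" "glued \<O> q q'"
  shows "q \<in> star (glue q0) \<longleftrightarrow> q' \<in> star (glue q0)"
proof -
  have cls: "b \<in> glue q0" if "a \<in> glue q0" "glued \<O> a b \<or> glued \<O> b a" for a b
    using that by (auto simp: glue_class_def intro: equivclp_trans)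
  have sub: "s \<in> {0..1}" "t \<in> {0..1}" if "(g, s, t) \<in> glue q0" for g s t
    using equivclp_in_cells[OF _ assms(1), of "(g, s, t)"] that by (simp_all add: glue_class_def unit_square_def)
  have inj: "g = h" if "r g = r h \<or> u g = u h" "g \<in> S" "h \<in> S" for g h
    using that neighbours_inverse(3,4) by metis
  from assms(2) show ?thesis
  proof cases
    case (horizontal g t)
    have "(g, 1, t1) \<in> glue q0 \<longleftrightarrow> (r g, 0, t1) \<in> glue q0" if "t1 \<in> {0..1}" for t1
      using cls glued.horizontal[of g \<O> t1] horizontal that by blast
    then show ?thesis
      using horizontal sub near_ends unfolding star_def horizontal
      by (auto simp: unit_square_def) (metis near_ends)+
  next
    case (vertical g t)
    have "(g, t1, 1) \<in> glue q0 \<longleftrightarrow> (u g, t1, 0) \<in> glue q0" if "t1 \<in> {0..1}" for t1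
      using cls glued.vertical[of g \<O> t1] vertical that by blast
    then show ?thesis
      using vertical sub near_ends unfolding star_def vertical
      by (auto simp: unit_square_def) (metis near_ends)+
  qed
qed

text \<open>The star contains every representative of each of its points, so that its image is open as
  soon as it is open itself.\<close>

lemma glue_in_star_iff:
  assumes "q0 \<in> cells"
  shows "glue q \<in> glue ` star (glue q0) \<longleftrightarrow> q \<in> star (glue q0)"
proof
  assume "glue q \<in> glue ` star (glue q0)"
  then obtain q' where q': "q' \<in> star (glue q0)" "glue q' = glue q" by force
  then have "equivclp (glued \<O>) q' q"
    by (simp add: glue_class_eq_iff)
  then show "q \<in> star (glue q0)"
    using q'(1) by (induction rule: equivclp_induct) (use star_glued[OF assms] in blast)+
qed simp

lemma openin_cells_iff:
  "openin (disjoint_squares \<O>) V \<longleftrightarrow>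
    V \<subseteq> cells \<and> (\<forall>g \<in> S. openin (top_of_set unit_square) {z. (g, z) \<in> V})"
  by (simp add: disjoint_squares_def openin_sum_topology comp_def)

lemma openin_star:
  assumes "q0 \<in> cells"
  shows "openin (surface \<O>) (glue ` star (glue q0))"
  unfolding openin_surface glue_in_star_iff[OF assms] openin_cells_iff
proof (intro conjI ballI)
  show "glue ` star (glue q0) \<subseteq> surface_points \<O>"
    by (auto simp: star_def surface_points_def)
  fix g assume g: "g \<in> S"
  define W where "W = (\<Union>(s1, t1) \<in> {z. (g, z) \<in> glue q0}. {a. near a s1} \<times> {a. near a t1})"
  have "open W"
    unfolding W_def by (intro open_UN ballI) (auto intro!: open_Times open_near)
  moreover have "{z. (g, z) \<in> {q \<in> cells. q \<in> star (glue q0)}} = unit_square \<inter> W"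
    using g by (auto simp: star_def W_def)
  ultimately show "openin (top_of_set unit_square) {z. (g, z) \<in> {q \<in> cells. q \<in> star (glue q0)}}"
    by (auto simp: openin_open)
qed auto

section \<open>Deck transformations permute the squares\<close>

text \<open>Whenever a path of identifications crosses a side of the square of the torus, cross the
  corresponding side of the current square of the surface.\<close>

lemma glue_lift_torus:
  assumes "equivclp (glued torus) ((), z) ((), z')" "h \<in> S"
  shows "\<exists>h' \<in> S. glue (h, z) = glue (h', z')"
proof -
  have lift: "\<exists>h' \<in> S. glue (h, snd a) = glue (h', snd b)" if "glued torus a b \<or> glued torus b a" "h \<in> S" for a b h
    using that
  proof (elim disjE glued.cases)
    fix g t assume "a = (g, 1, t)" "b = (right_nb torus g, 0, t)" "t \<in> {0..1}"
    then show ?thesis using glue_horizontal[of h t] that(2) by (intro bexI[of _ "r h"]) auto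
  next
    fix g t assume "a = (g, t, 1)" "b = (upper_nb torus g, t, 0)" "t \<in> {0..1}"
    then show ?thesis using glue_vertical[of h t] that(2) by (intro bexI[of _ "u h"]) auto
  next
    fix g t assume "b = (g, 1, t)" "a = (right_nb torus g, 0, t)" "t \<in> {0..1}"
    then show ?thesis using glue_horizontal[of "left_nb h" t] that(2) by (intro bexI[of _ "left_nb h"]) auto
  next
    fix g t assume "b = (g, t, 1)" "a = (upper_nb torus g, t, 0)" "t \<in> {0..1}"
    then show ?thesis using glue_vertical[of "lower_nb h" t] that(2) by (intro bexI[of _ "lower_nb h"]) auto
  qed
  have "\<exists>h' \<in> S. glue (h, z) = glue (h', snd b)" if "equivclp (glued torus) ((), z) b" for b
    using that
  proof (induction rule: equivclp_induct)
    case base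
    then show ?case using assms(2) by auto
  next
    case (step y y')
    then obtain h' where h': "h' \<in> S" "glue (h, z) = glue (h', snd y)" by blast
    show ?case using lift[OF step.hyps(2) h'(1)] h'(2) by simp
  qed
  then show ?thesis using assms(1) by fastforce
qed

lemma fibre_of_covering:
  assumes "P \<in> surface_points \<O>" "covering \<O> P = covering \<O> (glue (g, z))"
  shows "\<exists>h \<in> S. P = glue (h, z)"
proof -
  obtain h' z' where h': "h' \<in> S" "P = glue (h', z')"
    using assms(1) by (auto simp: surface_points_def)
  then have "equivclp (glued torus) ((), z') ((), z)"
    using assms(2) by (simp add: covering_glue_class flip: glue_class_eq_iff)
  then show ?thesis using glue_lift_torus h' by metis
qed

lemma coordinates_in_class:
  assumes "(h, s1, t1) \<in> glue (g, s0, t0)"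
  shows "s1 = s0 \<or> s1 \<in> {0, 1} \<and> s0 \<in> {0, 1}" "t1 = t0 \<or> t1 \<in> {0, 1} \<and> t0 \<in> {0, 1}"
proof -
  \<comment> \<open>Gluing changes coordinates only by interchanging the end points, which \<open>end0\<close> identifies.\<close>
  define end0 :: "real \<Rightarrow> real" where "end0 = (\<lambda>x. if x = 1 then 0 else x)"
  have glued: "end0 (fst (snd a)) = end0 (fst (snd b)) \<and> end0 (snd (snd a)) = end0 (snd (snd b))"
    if "glued \<O> a b" for a b
    using that by cases (auto simp: end0_def)
  have "end0 (fst (snd q)) = end0 s0 \<and> end0 (snd (snd q)) = end0 t0" if "equivclp (glued \<O>) (g, s0, t0) q" for q
    using that by (induction rule: equivclp_induct) (auto dest: glued)
  then have "end0 s1 = end0 s0 \<and> end0 t1 = end0 t0"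
    using assms by (fastforce simp: glue_class_def)
  then show "s1 = s0 \<or> s1 \<in> {0, 1} \<and> s0 \<in> {0, 1}" "t1 = t0 \<or> t1 \<in> {0, 1} \<and> t0 \<in> {0, 1}"
    by (auto simp: end0_def split: if_splits)
qed

lemma near_unique:
  assumes "near s s1" "\<bar>s - s0\<bar> < 1 / 2" "s1 = s0 \<or> s1 \<in> {0, 1} \<and> s0 \<in> {0, 1}"
  shows "s1 = s0"
  using assms by (auto simp: near_def split: if_splits)

definition open_square :: "(real \<times> real) set" where
  "open_square = {0<..<1} \<times> {0<..<1}"

text \<open>For \<open>z\<close> close to \<open>z0\<close> the value at \<open>z\<close> lies in the star of the value at \<open>z0\<close>. So the square \<open>h\<close> has
  a representative of the latter close to \<open>z\<close>, and \<open>z0\<close> is the only possible position for it.\<close>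

lemma continuous_value_near:
  assumes f: "continuous_map (surface \<O>) (surface \<O>) f"
    and g: "g \<in> S" and z0: "z0 \<in> unit_square" and h0: "h0 \<in> S" and val: "f (glue (g, z0)) = glue (h0, z0)"
  obtains W where "openin (top_of_set unit_square) W" "z0 \<in> W"
    "\<forall>z \<in> W. \<forall>h \<in> S. f (glue (g, z)) = glue (h, z) \<longrightarrow> glue (h, z0) = glue (h0, z0)"
proof -
  obtain s0 t0 where st: "z0 = (s0, t0)" by (rule prod.exhaust)
  let ?U = "glue ` star (glue (h0, z0))"
  have q0: "(h0, z0) \<in> cells" using h0 z0 by simp
  have "openin (surface \<O>) {P \<in> surface_points \<O>. f P \<in> ?U}"
    using openin_continuous_map_preimage[OF f openin_star[OF q0]] by (simp add: topspace_surface)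
  then have "openin (disjoint_squares \<O>) {q \<in> cells. glue q \<in> {P \<in> surface_points \<O>. f P \<in> ?U}}"
    unfolding openin_surface by blast
  then have W1: "openin (top_of_set unit_square) {z. (g, z) \<in> {q \<in> cells. glue q \<in> {P \<in> surface_points \<O>. f P \<in> ?U}}}"
    (is "openin _ ?W1") using g unfolding openin_cells_iff by blast
  define W where "W = ?W1 \<inter> (ball s0 (1/2) \<times> ball t0 (1/2))"
  have "open (ball s0 (1/2) \<times> ball t0 (1/2 :: real))" by (intro open_Times open_ball)
  then have W: "openin (top_of_set unit_square) W"
    unfolding W_def using W1 openin_Int_open by blast
  have "glue (h0, z0) \<in> ?U"
    using star_self[OF q0] by blast
  then have "z0 \<in> W"
    using g z0 val by (auto simp: W_def st surface_points_def)
  moreover have "glue (h, z0) = glue (h0, z0)" if z: "z \<in> W" and h: "h \<in> S" and eq: "f (glue (g, z)) = glue (h, z)" for z h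
  proof -
    obtain s t where z': "z = (s, t)" by (rule prod.exhaust)
    have "glue (h, z) \<in> ?U" using z eq by (auto simp: W_def)
    then have "(h, z) \<in> star (glue (h0, z0))"
      using glue_in_star_iff[OF q0] by blast
    then obtain s1 t1 where 1: "(h, s1, t1) \<in> glue (h0, s0, t0)" "near s s1" "near t t1"
      by (auto simp: star_def z' st)
    have "s1 = s0" "t1 = t0"
      using 1 coordinates_in_class[OF 1(1)] z near_unique[of s s1 s0] near_unique[of t t1 t0]
      by (auto simp: W_def z' st dist_real_def abs_minus_commute)
    then show ?thesis using 1(1) glue_eqI by (auto simp: st)
  qed
  ultimately show thesis using W by (intro that) blast+
qed

lemma open_square_dense:
  assumes "openin (top_of_set unit_square) W" "z0 \<in> W"
  shows "\<exists>z \<in> W. z \<in> open_square"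
proof -
  obtain s t where st: "z0 = (s, t)" by (rule prod.exhaust)
  obtain e where e: "e > 0" "\<And>z. z \<in> unit_square \<Longrightarrow> dist z z0 < e \<Longrightarrow> z \<in> W"
    using assms by (auto simp: openin_euclidean_subtopology_iff)
  have z0: "0 \<le> s" "s \<le> 1" "0 \<le> t" "t \<le> 1"
    using assms by (auto simp: openin_euclidean_subtopology_iff st unit_square_def subset_iff)
  \<comment> \<open>Move \<open>z0\<close> slightly towards the centre of the square.\<close>
  define d where "d = min (1 / 2) (e / 2)"
  have d: "0 < d" "d < 1" "d < e" using e by (auto simp: d_def)
  define z where "z = ((1 - d) * s + d / 2, (1 - d) * t + d / 2)"
  have pos: "0 < (1 - d) * a + d / 2 \<and> (1 - d) * a + d / 2 < 1 \<and> \<bar>(1 - d) * a + d / 2 - a\<bar> \<le> d / 2"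
    if "0 \<le> a" "a \<le> 1" for a
  proof -
    define c where "c = d * a"
    have "(1 - d) * a \<le> 1 - d" "0 \<le> (1 - d) * a" "c \<le> d" "0 \<le> c"
      using that d mult_left_mono[of a 1 "1 - d"] mult_left_mono[of a 1 d] by (auto simp: c_def)
    moreover have "(1 - d) * a = a - c" by (simp add: c_def algebra_simps)
    moreover from calculation have "\<bar>d / 2 - c\<bar> \<le> d / 2" by (intro abs_leI) linarith+
    ultimately show ?thesis using d by auto
  qed
  have "z \<in> open_square" using pos z0 by (auto simp: z_def open_square_def)
  moreover have "dist z z0 < e"
  proof -
    have "dist z z0 \<le> \<bar>(1 - d) * s + d / 2 - s\<bar> + \<bar>(1 - d) * t + d / 2 - t\<bar>"
      using sqrt_sum_squares_le_sum_abs by (simp add: dist_prod_def z_def st dist_real_def)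
    also have "\<dots> \<le> d" using pos[of s] pos[of t] z0 by linarith
    finally show ?thesis using d by linarith
  qed
  ultimately show ?thesis using e(2) by (auto simp: open_square_def unit_square_def)
qed

text \<open>Lying over the identity of the torus, \<open>f\<close> sends the position \<open>z\<close> in \<open>g\<close> to the position \<open>z\<close> in some
  square \<open>H g z\<close>. In the open square this is locally constant in \<open>z\<close>, hence constant, and positions
  on the boundary are limits of interior ones.\<close>

lemma deck_transformation_permutes_squares:
  assumes "f \<in> deck_transformations \<O>"
  obtains \<phi> where "\<phi> \<in> S \<rightarrow> S" "\<And>g z. g \<in> S \<Longrightarrow> z \<in> unit_square \<Longrightarrow> f (glue (g, z)) = glue (\<phi> g, z)"
proof -
  have hom: "homeomorphic_map (surface \<O>) (surface \<O>) f"
    and cov: "\<And>P. P \<in> surface_points \<O> \<Longrightarrow> covering \<O> (f P) = covering \<O> P"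
    using assms by (auto simp: deck_transformations_def topspace_surface)
  have cont: "continuous_map (surface \<O>) (surface \<O>) f"
    using hom by (rule homeomorphic_imp_continuous_map)
  have sp: "glue (g, z) \<in> surface_points \<O>" if "g \<in> S" "z \<in> unit_square" for g z
    using that by (auto simp: surface_points_def)
  have "f P \<in> surface_points \<O>" if "P \<in> surface_points \<O>" for P
    using that continuous_map_image_subset_topspace[OF cont] by (auto simp: topspace_surface)
  then have "\<exists>h \<in> S. f (glue (g, z)) = glue (h, z)" if "g \<in> S" "z \<in> unit_square" for g z
    using that sp cov by (intro fibre_of_covering) auto
  then obtain H where H: "\<And>g z. g \<in> S \<Longrightarrow> z \<in> unit_square \<Longrightarrow> H g z \<in> S \<and> f (glue (g, z)) = glue (H g z, z)"
    by metis
  have sub: "open_square \<subseteq> unit_square" by (auto simp: open_square_def unit_square_def)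
  have "H g constant_on open_square" if g: "g \<in> S" for g
  proof (rule locally_constant_imp_constant)
    show "connected open_square"
      unfolding open_square_def by (intro connected_Times) auto
    fix z0 assume z0: "z0 \<in> open_square"
    then have z0': "z0 \<in> unit_square" using sub by blast
    obtain W where W: "openin (top_of_set unit_square) W" "z0 \<in> W"
      "\<forall>z \<in> W. \<forall>h \<in> S. f (glue (g, z)) = glue (h, z) \<longrightarrow> glue (h, z0) = glue (H g z0, z0)"
      using continuous_value_near[OF cont g z0' conjunct1[OF H[OF g z0']] conjunct2[OF H[OF g z0']]] .
    have const: "H g z = H g z0" if z: "z \<in> W" "z \<in> open_square" for z
    proof -
      have "glue (H g z, z0) = glue (H g z0, z0)"
        using W(3) z(1) H[OF g] z(2) sub by blast
      moreover have "H g z \<in> S" "H g z0 \<in> S"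
        using H[OF g] z(2) z0 sub by blast+
      ultimately show ?thesis
        using z0 z(2) glue_eq_noncorner[of "H g z" "H g z0" "fst z0" "snd z0"]
        by (auto simp: open_square_def)
    qed
    have opn: "openin (top_of_set open_square) (open_square \<inter> W)"
      using W(1) sub by (metis Int_commute openin_subtopology_Int2 inf.absorb_iff2 subtopology_subtopology)
    show "\<exists>T. openin (top_of_set open_square) T \<and> z0 \<in> T \<and> (\<forall>z \<in> T. H g z = H g z0)"
    proof (intro exI conjI ballI)
      show "z0 \<in> open_square \<inter> W" using W(2) z0 by blast
      show "H g z = H g z0" if "z \<in> open_square \<inter> W" for z using const that by blast
    qed (rule opn)
  qed
  then obtain \<phi> where \<phi>: "\<And>g z. g \<in> S \<Longrightarrow> z \<in> open_square \<Longrightarrow> H g z = \<phi> g"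
    unfolding constant_on_def by metis
  show thesis
  proof
    have centre: "(1 / 2, 1 / 2) \<in> open_square" by (simp add: open_square_def)
    then show "\<phi> \<in> S \<rightarrow> S" using H \<phi> sub by (metis Pi_I subsetD)
    fix g z0 assume g: "g \<in> S" and z0: "z0 \<in> unit_square"
    obtain W where W: "openin (top_of_set unit_square) W" "z0 \<in> W"
      "\<forall>z \<in> W. \<forall>h \<in> S. f (glue (g, z)) = glue (h, z) \<longrightarrow> glue (h, z0) = glue (H g z0, z0)"
      using continuous_value_near[OF cont g z0 conjunct1[OF H[OF g z0]] conjunct2[OF H[OF g z0]]] .
    obtain z where z: "z \<in> W" "z \<in> open_square" using open_square_dense[OF W(1,2)] by blast
    have "glue (\<phi> g, z0) = glue (H g z0, z0)"
      using W(3) z(1) H[OF g, of z] z(2) \<phi>[OF g] sub by auto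
    then show "f (glue (g, z0)) = glue (\<phi> g, z0)" using H[OF g z0] by simp
  qed
qed

text \<open>The midpoint of a side belongs to exactly two squares, so the images of midpoints show which
  squares are neighbours.\<close>

lemma permutation_of_squares_commutes:
  assumes \<phi>: "\<phi> \<in> S \<rightarrow> S" and f: "\<And>g z. g \<in> S \<Longrightarrow> z \<in> unit_square \<Longrightarrow> f (glue (g, z)) = glue (\<phi> g, z)"
    and g: "g \<in> S"
  shows "\<phi> (r g) = r (\<phi> g)" "\<phi> (u g) = u (\<phi> g)"
proof -
  have mid: "(1, 1/2) \<in> unit_square" "(0, 1/2) \<in> unit_square" "(1/2, 1) \<in> unit_square" "(1/2, 0) \<in> unit_square"
    by (auto simp: unit_square_def)
  have "\<phi> g \<in> S" "\<phi> (r g) \<in> S" "\<phi> (u g) \<in> S" using \<phi> g by auto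
  moreover have "glue (r (\<phi> g), 0, 1/2) = glue (\<phi> (r g), 0, 1/2)"
    using f[OF g mid(1)] f[OF neighbours_in(1)[OF g] mid(2)] glue_horizontal[OF g, of "1/2"]
      glue_horizontal[OF \<open>\<phi> g \<in> S\<close>, of "1/2"] by simp
  moreover have "glue (u (\<phi> g), 1/2, 0) = glue (\<phi> (u g), 1/2, 0)"
    using f[OF g mid(3)] f[OF neighbours_in(2)[OF g] mid(4)] glue_vertical[OF g, of "1/2"]
      glue_vertical[OF \<open>\<phi> g \<in> S\<close>, of "1/2"] by simp
  ultimately show "\<phi> (r g) = r (\<phi> g)" "\<phi> (u g) = u (\<phi> g)"
    using glue_eq_noncorner[of "r (\<phi> g)" "\<phi> (r g)" 0 "1/2"] glue_eq_noncorner[of "u (\<phi> g)" "\<phi> (u g)" "1/2" 0] by auto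
qed


section \<open>Cone angles, singularities and genus\<close>

lemma canonical_point:
  assumes "a \<in> cells"
  obtains g s t where "g \<in> S" "0 \<le> s" "s < 1" "0 \<le> t" "t < 1" "glue a = glue (g, s, t)"
proof -
  obtain g s t where a: "a = (g, s, t)" by (rule prod_cases3)
  obtain h s' t' where h: "canonical_rep a = (h, s', t')" by (rule prod_cases3)
  have "h \<in> S" "0 \<le> s'" "s' < 1" "0 \<le> t'" "t' < 1"
    using assms h by (auto simp: a canonical_rep_def unit_square_def Let_def split: if_splits)
  then show thesis using that glue_canonical[OF assms] h by metis
qed

lemma glue_noncorner:
  assumes "g \<in> S" "0 \<le> s" "s < 1" "0 \<le> t" "t < 1" "s \<noteq> 0 \<or> t \<noteq> 0"
  shows "b \<in> glue (g, s, t) \<longleftrightarrow> b \<in> cells \<and> canonical_rep b = (g, s, t)"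
proof -
  have "(g, s, t) \<in> cells" using assms by (simp add: unit_square_def)
  then have "b \<in> glue (g, s, t) \<longleftrightarrow> b \<in> cells \<and> point_label b = ({g}, s, t)"
    using assms by (subst glue_eq_set) (auto simp: point_label_simps)
  also have "point_label b = ({g}, s, t) \<longleftrightarrow> canonical_rep b = (g, s, t)"
  proof (cases "canonical_rep b")
    case (fields h s' t')
    then show ?thesis using assms(6) by (cases "s' = 0 \<and> t' = 0") (auto simp: point_label_def)
  qed
  finally show ?thesis .
qed

lemma glue_interior:
  assumes "g \<in> S" "0 < s" "s < 1" "0 < t" "t < 1"
  shows "glue (g, s, t) = {(g, s, t)}"
proof (rule Set.set_eqI)
  fix b show "b \<in> glue (g, s, t) \<longleftrightarrow> b \<in> {(g, s, t)}"
  proof (cases b)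
    case (fields h s' t')
    have "b \<in> glue (g, s, t) \<longleftrightarrow> b \<in> cells \<and> canonical_rep b = (g, s, t)"
      using assms by (intro glue_noncorner) auto
    then show ?thesis using assms
      by (cases "s' = 1"; cases "t' = 1") (auto simp: fields canonical_rep_def unit_square_def)
  qed
qed

lemma glue_vertical_side:
  assumes "g \<in> S" "0 < t" "t < 1"
  shows "glue (g, 0, t) = {(g, 0, t), (left_nb g, 1, t)}"
proof (rule Set.set_eqI)
  fix b show "b \<in> glue (g, 0, t) \<longleftrightarrow> b \<in> {(g, 0, t), (left_nb g, 1, t)}"
  proof (cases b)
    case (fields h s' t')
    have "b \<in> glue (g, 0, t) \<longleftrightarrow> b \<in> cells \<and> canonical_rep b = (g, 0, t)"
      using assms by (intro glue_noncorner) auto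
    then show ?thesis using assms
      by (cases "s' = 1"; cases "t' = 1") (auto simp: fields canonical_rep_def unit_square_def)
  qed
qed

lemma glue_horizontal_side:
  assumes "g \<in> S" "0 < s" "s < 1"
  shows "glue (g, s, 0) = {(g, s, 0), (lower_nb g, s, 1)}"
proof (rule Set.set_eqI)
  fix b show "b \<in> glue (g, s, 0) \<longleftrightarrow> b \<in> {(g, s, 0), (lower_nb g, s, 1)}"
  proof (cases b)
    case (fields h s' t')
    have "b \<in> glue (g, s, 0) \<longleftrightarrow> b \<in> cells \<and> canonical_rep b = (g, s, 0)"
      using assms by (intro glue_noncorner) auto
    then show ?thesis using assms
      by (cases "s' = 1"; cases "t' = 1") (auto simp: fields canonical_rep_def unit_square_def)
  qed
qed

lemma point_label_corners:
  "point_label (h, 0, 0) = (corner_orbit h, 0, 0)" "point_label (h, 1, 0) = (corner_orbit (r h), 0, 0)"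
  "point_label (h, 0, 1) = (corner_orbit (u h), 0, 0)" "point_label (h, 1, 1) = (corner_orbit (r (u h)), 0, 0)"
  by (simp_all add: point_label_def canonical_rep_def)

text \<open>Each of the four kinds of corners of a square is carried by a neighbour map to a lower left
  corner; applying the inverse maps to the orbit lists all corners that are glued together.\<close>

lemma glue_corner:
  assumes "g \<in> S"
  shows "glue (g, 0, 0) = (\<lambda>h. (h, 0, 0)) ` corner_orbit g \<union> (\<lambda>h. (left_nb h, 1, 0)) ` corner_orbit g \<union>
    (\<lambda>h. (lower_nb h, 0, 1)) ` corner_orbit g \<union> (\<lambda>h. (lower_nb (left_nb h), 1, 1)) ` corner_orbit g"
    (is "_ = ?R")
proof (intro equalityI subsetI)
  have orb: "h \<in> corner_orbit g \<longleftrightarrow> corner_orbit h = corner_orbit g" if "h \<in> S" for h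
    using corner_orbit_eq[OF assms, of h] corner_orbit_self[of h] by blast
  have cell: "(g, 0, 0) \<in> cells" using assms by (simp add: unit_square_def)
  {
    fix b assume "b \<in> glue (g, 0, 0)"
    then have b: "b \<in> cells" "point_label b = (corner_orbit g, 0, 0)"
      using glue_eq_set[OF cell] by (simp_all add: point_label_corners)
    obtain h s t where bh: "b = (h, s, t)" by (rule prod_cases3)
    have h: "h \<in> S" using b by (simp add: bh)
    consider "s = 0" "t = 0" "corner_orbit h = corner_orbit g"
      | "s = 1" "t = 0" "corner_orbit (r h) = corner_orbit g"
      | "s = 0" "t = 1" "corner_orbit (u h) = corner_orbit g"
      | "s = 1" "t = 1" "corner_orbit (r (u h)) = corner_orbit g"
    proof -
      have "s = 1 \<or> s = 0" "t = 1 \<or> t = 0"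
        using b(2) by (auto simp: bh point_label_def canonical_rep_def Let_def split: if_splits)
      then show thesis
        using b(2) that by (elim disjE) (simp_all add: bh point_label_corners)
    qed
    then show "b \<in> ?R"
    proof cases
      case 1
      then have "h \<in> corner_orbit g" using orb h by simp
      then have "(h, 0, 0) \<in> ?R" by (rule UnI1[OF UnI1[OF UnI1[OF imageI]]])
      then show ?thesis using 1 by (simp add: bh)
    next
      case 2
      then have "r h \<in> corner_orbit g" using orb[of "r h"] h by simp
      then have "(left_nb (r h), 1, 0) \<in> ?R" by (rule UnI1[OF UnI1[OF UnI2[OF imageI]]])
      then show ?thesis using 2 h by (simp add: bh)
    next
      case 3
      then have "u h \<in> corner_orbit g" using orb[of "u h"] h by simp
      then have "(lower_nb (u h), 0, 1) \<in> ?R" by (rule UnI1[OF UnI2[OF imageI]])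
      then show ?thesis using 3 h by (simp add: bh)
    next
      case 4
      then have "r (u h) \<in> corner_orbit g" using orb[of "r (u h)"] h by simp
      then have "(lower_nb (left_nb (r (u h))), 1, 1) \<in> ?R" by (rule UnI2[OF imageI])
      then show ?thesis using 4 h by (simp add: bh)
    qed
  next
    fix b assume b: "b \<in> ?R"
    have sub: "h \<in> S \<and> corner_orbit h = corner_orbit g" if "h \<in> corner_orbit g" for h
      using that corner_orbit_subset[OF assms] corner_orbit_eq[OF assms] by blast
    have "b \<in> cells \<and> point_label b = (corner_orbit g, 0, 0)"
    proof -
      obtain h where h: "h \<in> corner_orbit g"
          "b = (h, 0, 0) \<or> b = (left_nb h, 1, 0) \<or> b = (lower_nb h, 0, 1) \<or> b = (lower_nb (left_nb h), 1, 1)"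
        using b by (elim UnE imageE) blast+
      have "h \<in> S" "corner_orbit h = corner_orbit g" using sub[OF h(1)] by blast+
      then show ?thesis
        using h(2) by (elim disjE) (simp_all add: point_label_corners unit_square_def)
    qed
    then show "b \<in> glue (g, 0, 0)"
      using glue_eq_set[OF cell] by (simp add: point_label_corners)
  }
qed

text \<open>The corners at this vertex form four copies of the orbit, one for each kind of corner, and
  contribute \<open>pi / 2\<close> each.\<close>

lemma cone_angle_corner:
  assumes "g \<in> S"
  shows "cone_angle (glue (g, 0, 0)) = 2 * pi * real (card (corner_orbit g))"
proof -
  let ?O = "corner_orbit g"
  have sub: "?O \<subseteq> S" by (rule corner_orbit_subset[OF assms])
  then have fin: "finite ?O" using finite_squares finite_subset by blast
  have inj: "inj_on left_nb S" "inj_on lower_nb S" "inj_on (\<lambda>h. lower_nb (left_nb h)) S"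
    by (rule inj_on_inverseI[where g = r], simp, rule inj_on_inverseI[where g = u], simp,
        rule inj_on_inverseI[where g = "\<lambda>h. r (u h)"], simp)
  have sum: "(\<Sum>(h, z) \<in> (\<lambda>h. (\<psi> h, c)) ` ?O. square_angle z) = real (card ?O) * square_angle c"
    if "inj_on \<psi> S" for \<psi> :: "'a \<Rightarrow> 'a" and c
    using inj_on_subset[OF that sub] by (subst sum.reindex) (auto simp: inj_on_def)
  let ?f = "\<lambda>(h, z). square_angle z"
  let ?A = "(\<lambda>h. (h, 0, 0)) ` ?O" and ?B = "(\<lambda>h. (left_nb h, 1, 0)) ` ?O"
  let ?C = "(\<lambda>h. (lower_nb h, 0, 1)) ` ?O" and ?D = "(\<lambda>h. (lower_nb (left_nb h), 1, 1)) ` ?O"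
  have "sum ?f (?A \<union> ?B \<union> ?C \<union> ?D) = sum ?f (?A \<union> ?B \<union> ?C) + sum ?f ?D"
    using fin by (intro sum.union_disjoint) auto
  also have "sum ?f (?A \<union> ?B \<union> ?C) = sum ?f (?A \<union> ?B) + sum ?f ?C"
    using fin by (intro sum.union_disjoint) auto
  also have "sum ?f (?A \<union> ?B) = sum ?f ?A + sum ?f ?B"
    using fin by (intro sum.union_disjoint) auto
  finally have "cone_angle (glue (g, 0, 0)) = sum ?f ?A + sum ?f ?B + sum ?f ?C + sum ?f ?D"
    by (simp only: cone_angle_def glue_corner[OF assms])
  also have "\<dots> = 2 * pi * real (card ?O)"
    using sum[of "\<lambda>h. h"] sum[OF inj(1)] sum[OF inj(2)] sum[OF inj(3)]
    by (simp add: square_angle_def inj_on_def)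
  finally show ?thesis .
qed

lemma cone_angle_noncorner:
  assumes "g \<in> S" "0 \<le> s" "s < 1" "0 \<le> t" "t < 1" "s \<noteq> 0 \<or> t \<noteq> 0"
  shows "cone_angle (glue (g, s, t)) = 2 * pi"
proof -
  consider "s > 0" "t > 0" | "s = 0" "t > 0" | "s > 0" "t = 0" using assms by fastforce
  then show ?thesis
    by cases (use assms in \<open>simp_all add: cone_angle_def glue_interior glue_vertical_side glue_horizontal_side square_angle_def\<close>)
qed

lemma point_multiplicity_eq:
  assumes "cone_angle P = 2 * pi * real m" "m > 0"
  shows "point_multiplicity P = m"
  unfolding point_multiplicity_def by (rule the_equality) (use assms in auto)

lemma card_corner_orbit_pos: "g \<in> S \<Longrightarrow> card (corner_orbit g) > 0"
  using corner_orbit_subset finite_squares corner_orbit_self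
  by (metis card_gt_0_iff empty_iff finite_subset)

text \<open>The hypothesis says that the cycle of \<open>turn\<close> through \<open>g\<close> has length \<open>d\<close>.\<close>

lemma card_corner_orbit:
  assumes "d > 0" "\<And>m. (turn ^^ m) g = g \<longleftrightarrow> d dvd m" "g \<in> S"
  shows "card (corner_orbit g) = d"
proof -
  have add: "(turn ^^ (i + j)) g = (turn ^^ i) ((turn ^^ j) g)" for i j
    by (simp add: funpow_add)
  have "(turn ^^ (d * k)) g = g" for k
    using assms(2) by simp
  then have "(turn ^^ i) g = (turn ^^ (i mod d)) g" for i
    using add[of "i mod d" "d * (i div d)"] by simp
  then have "corner_orbit g = (\<lambda>i. (turn ^^ i) g) ` {..<d}"
    using \<open>d > 0\<close> unfolding corner_orbit_def by (auto simp: image_iff) (metis lessThan_iff mod_less_divisor)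
  moreover have "inj_on (\<lambda>i. (turn ^^ i) g) {..<d}"
  proof -
    have "i = j" if "i \<le> j" "j < d" "(turn ^^ i) g = (turn ^^ j) g" for i j
    proof -
      have "(turn ^^ i) ((turn ^^ (j - i)) g) = (turn ^^ i) g"
        using that add[of i "j - i"] by simp
      then have "(turn ^^ (j - i)) g = g"
        using inj_onD[OF bij_betw_imp_inj_on[OF bij_betw_funpow[OF bij_turn]]] assms(3) turn_funpow_in by blast
      then have "d dvd j - i" using assms(2) by simp
      then show "i = j" using that by (metis diff_is_0_eq dvd_imp_le le_antisym less_imp_diff_less linorder_not_le zero_less_diff)
    qed
    then show ?thesis by (intro inj_onI) (metis lessThan_iff nat_le_linear)
  qed
  ultimately show ?thesis by (simp add: card_image)
qed

lemma glue_corner_eq_iff: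
  assumes "g \<in> S" "h \<in> S"
  shows "glue (g, 0, 0) = glue (h, 0, 0) \<longleftrightarrow> corner_orbit g = corner_orbit h"
  using assms by (subst glue_eq_iff) (auto simp: point_label_simps unit_square_def)

lemma card_corners:
  assumes d: "\<And>g. g \<in> S \<Longrightarrow> card (corner_orbit g) = d"
  shows "d * card ((\<lambda>g. glue (g, 0, 0)) ` S) = card S"
proof -
  have "card ((\<lambda>g. glue (g, 0, 0)) ` S) = card (corner_orbit ` S)"
    by (intro card_image_same_fibres glue_corner_eq_iff)
  moreover have "d * card (corner_orbit ` S) = card (\<Union> (corner_orbit ` S))"
  proof (rule card_partition)
    have un: "\<Union> (corner_orbit ` S) = S"
      using corner_orbit_subset corner_orbit_self by blast
    then show "finite (\<Union> (corner_orbit ` S))" using finite_squares by simp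
    show "c1 \<inter> c2 = {}" if c: "c1 \<in> corner_orbit ` S" "c2 \<in> corner_orbit ` S" "c1 \<noteq> c2" for c1 c2
    proof (rule equals0I)
      fix x assume x: "x \<in> c1 \<inter> c2"
      obtain g h where "g \<in> S" "c1 = corner_orbit g" "h \<in> S" "c2 = corner_orbit h" using c by blast
      then show False using x \<open>c1 \<noteq> c2\<close> corner_orbit_eq[of g x] corner_orbit_eq[of h x] by simp
    qed
    show "finite (corner_orbit ` S)" using finite_squares by simp
    show "card c = d" if "c \<in> corner_orbit ` S" for c using that d by blast
  qed
  moreover have "\<Union> (corner_orbit ` S) = S"
    using corner_orbit_subset corner_orbit_self by blast
  ultimately show ?thesis by simp
qed

lemma surface_points_cases:
  assumes "P \<in> surface_points \<O>"
  obtains (corner) g where "g \<in> S" "P = glue (g, 0, 0)"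
    | (flat) "point_multiplicity P = 1"
proof -
  obtain a where a: "a \<in> cells" "P = glue a" using assms by (auto simp: surface_points_def)
  then obtain g s t where g: "g \<in> S" "0 \<le> s" "s < 1" "0 \<le> t" "t < 1" "P = glue (g, s, t)"
    using canonical_point[OF a(1)] by metis
  show thesis
  proof (cases "s = 0 \<and> t = 0")
    case True
    then show ?thesis using g corner by simp
  next
    case False
    then show ?thesis
      using cone_angle_noncorner[OF g(1-5)] g(6) flat point_multiplicity_eq[of P 1] by simp
  qed
qed

lemma singularities_uniform:
  assumes d: "\<And>g. g \<in> S \<Longrightarrow> card (corner_orbit g) = d"
  shows "d = 1 \<Longrightarrow> singularities \<O> = {}"
    and "d > 1 \<Longrightarrow> singularities \<O> = (\<lambda>g. glue (g, 0, 0)) ` S"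
    and "P \<in> singularities \<O> \<Longrightarrow> point_multiplicity P = d"
proof -
  have mult: "point_multiplicity (glue (g, 0, 0)) = d" if "g \<in> S" for g
    using cone_angle_corner[OF that] card_corner_orbit_pos[OF that] d[OF that] by (intro point_multiplicity_eq) auto
  have mem: "P \<in> singularities \<O> \<longleftrightarrow> P \<in> surface_points \<O> \<and> point_multiplicity P > 1" for P
    by (simp add: singularities_def topspace_surface)
  have sing: "P \<in> (\<lambda>g. glue (g, 0, 0)) ` S" if "P \<in> singularities \<O>" for P
  proof -
    have "P \<in> surface_points \<O>" "point_multiplicity P > 1" using that mem by auto
    then show ?thesis by (cases rule: surface_points_cases) auto
  qed
  then show *: "P \<in> singularities \<O> \<Longrightarrow> point_multiplicity P = d" for P
    using mult by blast
  show "singularities \<O> = {}" if "d = 1"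
    using * mem that by (metis equals0I less_irrefl)
  show "singularities \<O> = (\<lambda>g. glue (g, 0, 0)) ` S" if "d > 1"
  proof
    show "singularities \<O> \<subseteq> (\<lambda>g. glue (g, 0, 0)) ` S" using sing by blast
    show "(\<lambda>g. glue (g, 0, 0)) ` S \<subseteq> singularities \<O>"
      using mult that by (auto simp: mem surface_points_def unit_square_def)
  qed
qed

text \<open>If every corner orbit is a single square, there is one vertex per square. There are two edges per
  square, its left and its lower side, so the Euler characteristic vanishes.\<close>

lemma genus_flat:
  assumes "\<And>g. g \<in> S \<Longrightarrow> card (corner_orbit g) = 1"
  shows "genus \<O> = 1"
proof -
  have vertices: "origami_vertices \<O> = (\<lambda>g. glue (g, 0, 0)) ` S"
  proof
    show "origami_vertices \<O> \<subseteq> (\<lambda>g. glue (g, 0, 0)) ` S"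
      unfolding origami_vertices_def
    proof (rule image_subsetI)
      fix q assume q: "q \<in> S \<times> ({0, 1 :: real} \<times> {0, 1 :: real})"
      then obtain h s t where h: "q = (h, s, t)" "h \<in> S" "s \<in> {0, 1}" "t \<in> {0, 1}" by auto
      define h' where "h' = fst (canonical_rep q)"
      have "h' \<in> S" "canonical_rep q = (h', 0, 0)"
        using h by (auto simp: h'_def canonical_rep_def)
      moreover have "q \<in> cells" using h by (auto simp: unit_square_def)
      ultimately have "glue q = glue (h', 0, 0)" "h' \<in> S"
        using glue_canonical[of q] by simp_all
      then show "glue q \<in> (\<lambda>g. glue (g, 0, 0)) ` S" by (rule image_eqI)
    qed
    show "(\<lambda>g. glue (g, 0, 0)) ` S \<subseteq> origami_vertices \<O>"
      unfolding origami_vertices_def by (intro image_subsetI imageI) simp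
  qed
  then have V: "card (origami_vertices \<O>) = card S"
    using card_corners[OF assms] by simp
  let ?L = "\<lambda>g. glue ` ({g} \<times> ({0} \<times> {0<..<1}))" and ?B = "\<lambda>g. glue ` ({g} \<times> ({0<..<1} \<times> {0}))"
  let ?F = "\<lambda>g. glue ` ({g} \<times> ({0<..<1} \<times> {0<..<1}))"
  have L_eq: "?L g = (\<lambda>t. glue (g, 0, t)) ` {0<..<1}" for g by force
  have B_eq: "?B g = (\<lambda>s. glue (g, s, 0)) ` {0<..<1}" for g by force
  have "glue ` ({g} \<times> ({1} \<times> {0<..<1})) = (\<lambda>t. glue (g, 1, t)) ` {0<..<1}" for g by force
  then have right: "glue ` ({g} \<times> ({1} \<times> {0<..<1})) = ?L (r g)" if "g \<in> S" for g
    unfolding L_eq using glue_horizontal[OF that] by simp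
  have "glue ` ({g} \<times> ({0<..<1} \<times> {1})) = (\<lambda>s. glue (g, s, 1)) ` {0<..<1}" for g by force
  then have top: "glue ` ({g} \<times> ({0<..<1} \<times> {1})) = ?B (u g)" if "g \<in> S" for g
    unfolding B_eq using glue_vertical[OF that] by simp
  have edges: "origami_edges \<O> = ?L ` S \<union> ?B ` S"
  proof
    show "origami_edges \<O> \<subseteq> ?L ` S \<union> ?B ` S"
    proof
      fix e assume "e \<in> origami_edges \<O>"
      then obtain g s where "g \<in> S" "s \<in> open_sides" "e = glue ` ({g} \<times> s)"
        unfolding origami_edges_def by blast
      then have "e = ?L g \<or> e = ?L (r g) \<or> e = ?B g \<or> e = ?B (u g)"
        unfolding open_sides_def insert_iff using right[OF \<open>g \<in> S\<close>] top[OF \<open>g \<in> S\<close>] by (elim disjE) simp_all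
      then show "e \<in> ?L ` S \<union> ?B ` S"
        using \<open>g \<in> S\<close> by (elim disjE) simp_all
    qed
    have "glue ` ({g} \<times> s) \<in> origami_edges \<O>" if "g \<in> S" "s \<in> open_sides" for g s
      using that unfolding origami_edges_def by blast
    then show "?L ` S \<union> ?B ` S \<subseteq> origami_edges \<O>"
      by (intro Un_least image_subsetI) (simp_all add: open_sides_def)
  qed
  have inL: "glue (h, 0, 1/2) \<in> ?L h" and inB: "glue (h, 1/2, 0) \<in> ?B h" and inF: "glue (h, 1/2, 1/2) \<in> ?F h" for h
    by (intro imageI; simp)+
  have L: "g = h" if "g \<in> S" "h \<in> S" "glue (g, 0, 1/2) \<in> ?L h" for g h
  proof -
    obtain t where "0 < t" "t < 1" "glue (g, 0, 1/2) = glue (h, 0, t)"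
      using \<open>glue (g, 0, 1/2) \<in> ?L h\<close> unfolding L_eq by auto
    then show ?thesis using self_in_glue[of "(g, 0, 1/2)"] glue_vertical_side[OF that(2), of t] by simp
  qed
  have B: "g = h" if "g \<in> S" "h \<in> S" "glue (g, 1/2, 0) \<in> ?B h" for g h
  proof -
    obtain t where "0 < t" "t < 1" "glue (g, 1/2, 0) = glue (h, t, 0)"
      using \<open>glue (g, 1/2, 0) \<in> ?B h\<close> unfolding B_eq by auto
    then show ?thesis using self_in_glue[of "(g, 1/2, 0)"] glue_horizontal_side[OF that(2), of t] by simp
  qed
  have F: "g = h" if "g \<in> S" "h \<in> S" "glue (g, 1/2, 1/2) \<in> ?F h" for g h
  proof -
    obtain s t where "0 < s" "s < 1" "0 < t" "t < 1" "glue (g, 1/2, 1/2) = glue (h, s, t)"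
      using \<open>glue (g, 1/2, 1/2) \<in> ?F h\<close> by auto
    then show ?thesis using self_in_glue[of "(g, 1/2, 1/2)"] glue_interior[OF that(2), of s t] by simp
  qed
  have LB: "glue (g, 0, 1/2) \<notin> ?B h" if "g \<in> S" "h \<in> S" for g h
  proof
    assume "glue (g, 0, 1/2) \<in> ?B h"
    then obtain t where "0 < t" "t < 1" "glue (g, 0, 1/2) = glue (h, t, 0)"
      unfolding B_eq by auto
    then show False using self_in_glue[of "(g, 0, 1/2)"] glue_horizontal_side[OF that(2), of t] by simp
  qed
  have "card (?L ` S) = card S" "card (?B ` S) = card S"
    by (intro card_image inj_onI; metis L inL B inB)+
  moreover have "?L ` S \<inter> ?B ` S = {}"
  proof (rule equals0I)
    fix e assume "e \<in> ?L ` S \<inter> ?B ` S"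
    then obtain g h where "g \<in> S" "h \<in> S" "?L g = ?B h" by blast
    then show False using inL[of g] LB by simp
  qed
  ultimately have E: "card (origami_edges \<O>) = 2 * card S"
    unfolding edges using finite_squares by (subst card_Un_disjoint) auto
  have "origami_faces \<O> = ?F ` S"
    by (auto simp: origami_faces_def)
  moreover have "card (?F ` S) = card S"
    by (intro card_image inj_onI) (metis F inF)
  ultimately have "euler_characteristic \<O> = 0"
    using V E by (simp add: euler_characteristic_def)
  then show ?thesis
    unfolding genus_def by (intro the_equality) auto
qed

section \<open>Connectedness\<close>

text \<open>An injective map of the finite set \<open>T\<close> to itself is onto, so nothing outside enters \<open>T\<close>.\<close>

lemma invariant_iff:
  assumes "T \<subseteq> S" "\<And>g. g \<in> T \<Longrightarrow> r g \<in> T" "\<And>g. g \<in> T \<Longrightarrow> u g \<in> T" "g \<in> S"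
  shows "r g \<in> T \<longleftrightarrow> g \<in> T" "u g \<in> T \<longleftrightarrow> g \<in> T"
proof -
  have fin: "finite T" using assms(1) finite_squares finite_subset by blast
  have backwards: "g \<in> T" if f: "bij_betw f S S" "\<And>h. h \<in> T \<Longrightarrow> f h \<in> T" "f g \<in> T" for f
  proof -
    have "inj_on f S" using f(1) by (rule bij_betw_imp_inj_on)
    then have "f ` T = T"
      using f(2) assms(1) by (intro endo_inj_surj[OF fin] image_subsetI) (auto intro: inj_on_subset)
    then obtain h where "h \<in> T" "f h = f g" using f(3) by (metis imageE)
    then show ?thesis using inj_onD[OF \<open>inj_on f S\<close>, of h g] assms(1,4) by blast
  qed
  show "r g \<in> T \<longleftrightarrow> g \<in> T" using backwards[OF bij_right assms(2)] assms(2) by blast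
  show "u g \<in> T \<longleftrightarrow> g \<in> T" using backwards[OF bij_upper assms(3)] assms(3) by blast
qed

text \<open>The squares of an invariant set cover an open set, and so do the remaining squares.\<close>

lemma connected_imp_transitive:
  assumes conn: "connected_space (surface \<O>)"
    and T: "T \<subseteq> S" "T \<noteq> {}" "\<And>g. g \<in> T \<Longrightarrow> r g \<in> T" "\<And>g. g \<in> T \<Longrightarrow> u g \<in> T"
  shows "T = S"
proof -
  have glued: "fst a \<in> T \<longleftrightarrow> fst b \<in> T" if "glued \<O> a b" for a b
    using that by cases (simp_all add: invariant_iff[OF T(1,3,4)])
  have eq: "fst a \<in> T \<longleftrightarrow> fst b \<in> T" if "glue a = glue b" for a b
  proof -
    have "equivclp (glued \<O>) a b" using that by (simp add: glue_class_eq_iff)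
    then show ?thesis by (induction rule: equivclp_induct) (use glued in auto)
  qed
  have open_part: "openin (surface \<O>) (glue ` (X \<times> unit_square))"
    if X: "X \<subseteq> S" "X = T \<or> X = S - T" for X
  proof -
    have "q \<in> X \<times> unit_square" if "q \<in> cells" "glue q \<in> glue ` (X \<times> unit_square)" for q
    proof -
      obtain q' where "q' \<in> X \<times> unit_square" "glue q = glue q'" using \<open>glue q \<in> _\<close> by blast
      then have "fst q \<in> X" using eq[of q q'] X(2) \<open>q \<in> cells\<close> by auto
      then show ?thesis using \<open>q \<in> cells\<close> by auto
    qed
    moreover have "X \<times> unit_square \<subseteq> cells" using X(1) by blast
    ultimately have "{q \<in> cells. glue q \<in> glue ` (X \<times> unit_square)} = X \<times> unit_square" by blast
    moreover have "{z. (g, z) \<in> X \<times> unit_square} = (if g \<in> X then unit_square else {})" for g by auto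
    ultimately show ?thesis
      using X(1) unfolding openin_surface openin_cells_iff by (auto simp: surface_points_def)
  qed
  let ?U = "glue ` (T \<times> unit_square)"
  have "surface_points \<O> - ?U = glue ` ((S - T) \<times> unit_square)"
  proof
    show "surface_points \<O> - ?U \<subseteq> glue ` ((S - T) \<times> unit_square)"
      by (auto simp: surface_points_def)
    have "glue q \<notin> ?U" if "q \<in> (S - T) \<times> unit_square" for q
    proof
      assume "glue q \<in> ?U"
      then obtain q' where "q' \<in> T \<times> unit_square" "glue q = glue q'" by blast
      then show False using eq[of q q'] that by auto
    qed
    then show "glue ` ((S - T) \<times> unit_square) \<subseteq> surface_points \<O> - ?U"
      unfolding surface_points_def by blast
  qed
  then have "openin (surface \<O>) ?U" "closedin (surface \<O>) ?U"
    using open_part[of T] open_part[of "S - T"] T(1) by (auto simp: closedin_def topspace_surface surface_points_def)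
  then have "?U = {} \<or> ?U = surface_points \<O>"
    using conn unfolding connected_space_clopen_in topspace_surface by blast
  moreover have 0: "(0, 0) \<in> unit_square" by (simp add: unit_square_def)
  ultimately have U: "?U = surface_points \<O>" using T(2) by blast
  have "g \<in> T" if "g \<in> S" for g
  proof -
    have "glue (g, 0, 0) \<in> ?U" unfolding U surface_points_def using that 0 by blast
    then obtain q' where "q' \<in> T \<times> unit_square" "glue (g, 0, 0) = glue q'" by blast
    then show ?thesis using eq[of "(g, 0, 0)" q'] by auto
  qed
  then show ?thesis using T(1) by blast
qed

text \<open>A set that is open and closed contains all or nothing of each square, because squares are
  connected. Neighbouring squares share a point, so the squares contained in the set are invariant.\<close>

lemma transitive_imp_connected:
  assumes trans: "\<And>T. T \<subseteq> S \<Longrightarrow> T \<noteq> {} \<Longrightarrow> (\<And>g. g \<in> T \<Longrightarrow> r g \<in> T) \<Longrightarrow> (\<And>g. g \<in> T \<Longrightarrow> u g \<in> T) \<Longrightarrow> T = S"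
  shows "connected_space (surface \<O>)"
  unfolding connected_space_clopen_in
proof (intro allI impI)
  fix W assume W: "openin (surface \<O>) W \<and> closedin (surface \<O>) W"
  then have open_parts: "openin (surface \<O>) W" "openin (surface \<O>) (surface_points \<O> - W)" "W \<subseteq> surface_points \<O>"
    by (auto simp: closedin_def topspace_surface)
  define V where "V g = {z \<in> unit_square. glue (g, z) \<in> W}" for g
  have V: "V g = {} \<or> V g = unit_square" if g: "g \<in> S" for g
  proof -
    have eqs: "{z. (g, z) \<in> {q \<in> cells. glue q \<in> W}} = V g"
      "{z. (g, z) \<in> {q \<in> cells. glue q \<in> surface_points \<O> - W}} = unit_square - V g"
      using g by (auto simp: V_def surface_points_def)
    have "openin (top_of_set unit_square) (V g)" "openin (top_of_set unit_square) (unit_square - V g)"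
    proof -
      have part: "openin (top_of_set unit_square) {z. (g, z) \<in> {q \<in> cells. glue q \<in> X}}" if "openin (surface \<O>) X" for X
        using that g unfolding openin_surface openin_cells_iff by blast
      show "openin (top_of_set unit_square) (V g)" "openin (top_of_set unit_square) (unit_square - V g)"
        using part[OF open_parts(1)] part[OF open_parts(2)] by (simp_all only: eqs)
    qed
    moreover have "connected unit_square"
      unfolding unit_square_def by (intro connected_Times) auto
    moreover have "V g \<subseteq> unit_square" by (auto simp: V_def)
    ultimately show ?thesis
      by (auto simp: connected_clopen closedin_def)
  qed
  define T where "T = {g \<in> S. V g = unit_square}"
  have mem: "(1, 0) \<in> unit_square" "(0, 0) \<in> unit_square" "(0, 1) \<in> unit_square" by (auto simp: unit_square_def)
  have step: "r g \<in> T \<and> u g \<in> T" if "g \<in> T" for g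
  proof -
    have g: "g \<in> S" "V g = unit_square" using that by (auto simp: T_def)
    then have "glue (g, 1, 0) \<in> W" "glue (g, 0, 1) \<in> W" using mem by (auto simp: V_def)
    then have "(0, 0) \<in> V (r g)" "(0, 0) \<in> V (u g)"
      using glue_horizontal[OF g(1), of 0] glue_vertical[OF g(1), of 0] mem by (auto simp: V_def)
    then show ?thesis using V[of "r g"] V[of "u g"] g by (auto simp: T_def)
  qed
  have "T = {} \<or> T = S"
    using trans[of T] step by (auto simp: T_def)
  then show "W = {} \<or> W = topspace (surface \<O>)"
  proof
    assume "T = {}"
    then have "glue q \<notin> W" if "q \<in> cells" for q
      using that V mem by (auto simp: T_def V_def)
    then show ?thesis using open_parts(3) by (auto simp: surface_points_def)
  next
    assume "T = S"
    then have "glue q \<in> W" if "q \<in> cells" for q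
      using that by (auto simp: T_def V_def)
    then show ?thesis using open_parts(3) by (auto simp: topspace_surface surface_points_def)
  qed
qed

section \<open>Automorphisms and the deck group\<close>

text \<open>The automorphisms of the gluing. Bijectivity is automatic if the surface is connected.\<close>

definition commuting :: "('a \<Rightarrow> 'a) \<Rightarrow> bool" where
  "commuting \<phi> \<longleftrightarrow> \<phi> \<in> S \<rightarrow> S \<and> (\<forall>g \<in> S. \<phi> (r g) = r (\<phi> g) \<and> \<phi> (u g) = u (\<phi> g))"

lemma commuting_agree:
  assumes conn: "connected_space (surface \<O>)" and "commuting \<phi>" "commuting \<psi>" "g \<in> S" "\<phi> g = \<psi> g" "h \<in> S"
  shows "\<phi> h = \<psi> h"
proof -
  have "{g \<in> S. \<phi> g = \<psi> g} = S"
    using assms by (intro connected_imp_transitive[OF conn]) (auto simp: commuting_def)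
  then show ?thesis using \<open>h \<in> S\<close> by blast
qed

lemma commuting_bij:
  assumes conn: "connected_space (surface \<O>)" and \<phi>: "commuting \<phi>"
  shows "bij_betw \<phi> S S"
proof (cases "S = {}")
  case False
  have sub: "\<phi> ` S \<subseteq> S" using \<phi> by (auto simp: commuting_def)
  have "\<phi> ` S = S"
  proof (rule connected_imp_transitive[OF conn sub])
    fix g assume "g \<in> \<phi> ` S"
    then obtain h where h: "h \<in> S" "g = \<phi> h" by blast
    then have "r g = \<phi> (r h)" "u g = \<phi> (u h)" using \<phi> by (simp_all add: commuting_def)
    then show "r g \<in> \<phi> ` S" "u g \<in> \<phi> ` S" using h neighbours_in(1,2) by simp_all
  qed (use False in auto)
  then show ?thesis
    using finite_squares by (simp add: bij_betw_def eq_card_imp_inj_on)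
qed (simp add: bij_betw_def)

lemma commuting_inv:
  assumes bij: "bij_betw \<phi> S S" and \<phi>: "commuting \<phi>"
  shows "commuting (inv_into S \<phi>)"
proof -
  have inv: "inv_into S \<phi> g \<in> S" "\<phi> (inv_into S \<phi> g) = g" if "g \<in> S" for g
    using bij that by (auto simp: bij_betw_def inv_into_into f_inv_into_f)
  have eq: "inv_into S \<phi> (\<phi> g) = g" if "g \<in> S" for g
    using bij that by (simp add: bij_betw_def)
  have "inv_into S \<phi> (r g) = r (inv_into S \<phi> g) \<and> inv_into S \<phi> (u g) = u (inv_into S \<phi> g)" if g: "g \<in> S" for g
  proof -
    have "\<phi> (r (inv_into S \<phi> g)) = r g" "\<phi> (u (inv_into S \<phi> g)) = u g"
      using \<phi> inv[OF g] by (simp_all add: commuting_def)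
    then show ?thesis using eq[of "r (inv_into S \<phi> g)"] eq[of "u (inv_into S \<phi> g)"] inv[OF g] by simp
  qed
  then show ?thesis using inv by (auto simp: commuting_def)
qed

definition move :: "('a \<Rightarrow> 'a) \<Rightarrow> 'a \<times> real \<times> real \<Rightarrow> 'a \<times> real \<times> real" where
  "move \<phi> q = (\<phi> (fst q), snd q)"

text \<open>A point of the surface is the set of its representatives, so that a map of the squares acts on
  points by taking images.\<close>

definition lift :: "('a \<Rightarrow> 'a) \<Rightarrow> 'a point \<Rightarrow> 'a point" where
  "lift \<phi> = (\<lambda>P \<in> surface_points \<O>. move \<phi> ` P)"

lemma move_equivclp:
  assumes "commuting \<phi>" "equivclp (glued \<O>) a b"
  shows "equivclp (glued \<O>) (move \<phi> a) (move \<phi> b)"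
  using assms(2)
proof (induction rule: equivclp_induct)
  case (step b c)
  have "glued \<O> (move \<phi> b) (move \<phi> c)" if "glued \<O> b c" for b c
    using that
  proof cases
    case (horizontal g t)
    then show ?thesis using assms(1) glued.horizontal[of "\<phi> g" \<O> t] by (auto simp: move_def commuting_def)
  next
    case (vertical g t)
    then show ?thesis using assms(1) glued.vertical[of "\<phi> g" \<O> t] by (auto simp: move_def commuting_def)
  qed
  then have "equivclp (glued \<O>) (move \<phi> b) (move \<phi> c)"
    using step.hyps(2) by (metis r_into_equivclp equivclp_sym)
  then show ?case using step.IH equivclp_trans by metis
qed simp

lemma lift_glue:
  assumes bij: "bij_betw \<phi> S S" and \<phi>: "commuting \<phi>" and g: "g \<in> S" and z: "z \<in> unit_square"
  shows "lift \<phi> (glue (g, z)) = glue (\<phi> g, z)"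
proof -
  have "move \<phi> ` glue (g, z) = glue (\<phi> g, z)"
  proof
    show "move \<phi> ` glue (g, z) \<subseteq> glue (\<phi> g, z)"
    proof (rule image_subsetI)
      fix q assume "q \<in> glue (g, z)"
      then have "equivclp (glued \<O>) (g, z) q" by (simp add: glue_class_def)
      then have "equivclp (glued \<O>) (move \<phi> (g, z)) (move \<phi> q)" by (rule move_equivclp[OF \<phi>])
      then show "move \<phi> q \<in> glue (\<phi> g, z)" by (simp add: move_def glue_class_def)
    qed
    show "glue (\<phi> g, z) \<subseteq> move \<phi> ` glue (g, z)"
    proof
      fix q assume "q \<in> glue (\<phi> g, z)"
      then have q: "equivclp (glued \<O>) (\<phi> g, z) q" by (simp add: glue_class_def)
      moreover have "(\<phi> g, z) \<in> cells" using \<phi> g z by (auto simp: commuting_def)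
      ultimately have "q \<in> cells" using equivclp_in_cells by blast
      then have "\<phi> (inv_into S \<phi> (fst q)) = fst q"
        using bij by (auto simp: bij_betw_def f_inv_into_f)
      then have 1: "q = move \<phi> (move (inv_into S \<phi>) q)" by (simp add: move_def)
      have "equivclp (glued \<O>) (move (inv_into S \<phi>) (\<phi> g, z)) (move (inv_into S \<phi>) q)"
        by (rule move_equivclp[OF commuting_inv[OF bij \<phi>] q])
      moreover have "move (inv_into S \<phi>) (\<phi> g, z) = (g, z)"
        using bij g by (simp add: move_def bij_betw_def)
      ultimately have "move (inv_into S \<phi>) q \<in> glue (g, z)" by (simp add: glue_class_def)
      then show "q \<in> move \<phi> ` glue (g, z)" using 1 by (rule image_eqI[rotated])
    qed
  qed
  then show ?thesis using g z by (auto simp: lift_def surface_points_def)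
qed

lemma continuous_lift:
  assumes bij: "bij_betw \<phi> S S" and \<phi>: "commuting \<phi>"
  shows "continuous_map (surface \<O>) (surface \<O>) (lift \<phi>)"
proof (rule continuous_compose_quotient_map[OF quotient_map_surface])
  have maps: "\<phi> g \<in> S" if "g \<in> S" for g using \<phi> that by (auto simp: commuting_def)
  have "continuous_map (disjoint_squares \<O>) (disjoint_squares \<O>) (move \<phi>)"
    unfolding continuous_map_def
  proof (intro conjI allI impI)
    show "move \<phi> \<in> topspace (disjoint_squares \<O>) \<rightarrow> topspace (disjoint_squares \<O>)"
      using maps by (auto simp: topspace_disjoint_squares move_def)
    fix U assume U: "openin (disjoint_squares \<O>) U"
    have "{z. (g, z) \<in> {q \<in> topspace (disjoint_squares \<O>). move \<phi> q \<in> U}} = {z. (\<phi> g, z) \<in> U}"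
      if "g \<in> S" for g
      using that U by (auto simp: topspace_disjoint_squares move_def openin_cells_iff)
    then show "openin (disjoint_squares \<O>) {q \<in> topspace (disjoint_squares \<O>). move \<phi> q \<in> U}"
      using U maps unfolding openin_cells_iff by (auto simp: topspace_disjoint_squares)
  qed
  then have "continuous_map (disjoint_squares \<O>) (surface \<O>) (glue \<circ> move \<phi>)"
    using quotient_imp_continuous_map[OF quotient_map_surface] by (rule continuous_map_compose)
  then show "continuous_map (disjoint_squares \<O>) (surface \<O>) (lift \<phi> \<circ> glue)"
    by (rule continuous_map_eq) (auto simp: topspace_disjoint_squares move_def lift_glue[OF bij \<phi>])
qed

lemma surface_pointsE:
  assumes "P \<in> surface_points \<O>"
  obtains g z where "g \<in> S" "z \<in> unit_square" "P = glue (g, z)"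
  using assms by (auto simp: surface_points_def)

lemma lift_deck:
  assumes bij: "bij_betw \<phi> S S" and \<phi>: "commuting \<phi>"
  shows "lift \<phi> \<in> deck_transformations \<O>"
proof -
  let ?\<psi> = "inv_into S \<phi>"
  have bij': "bij_betw ?\<psi> S S" using bij by (rule bij_betw_inv_into)
  have \<psi>: "commuting ?\<psi>" by (rule commuting_inv[OF bij \<phi>])
  have inv: "\<phi> g \<in> S" "?\<psi> g \<in> S" "?\<psi> (\<phi> g) = g" "\<phi> (?\<psi> g) = g" if "g \<in> S" for g
    using that bij by (auto simp: bij_betw_def inv_into_into f_inv_into_f)
  have "homeomorphic_maps (surface \<O>) (surface \<O>) (lift \<phi>) (lift ?\<psi>)"
    unfolding homeomorphic_maps_def topspace_surface
  proof (intro conjI ballI continuous_lift bij bij' \<phi> \<psi>)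
    fix P assume "P \<in> surface_points \<O>"
    then obtain g z where "g \<in> S" "z \<in> unit_square" "P = glue (g, z)" by (rule surface_pointsE)
    then show "lift ?\<psi> (lift \<phi> P) = P" "lift \<phi> (lift ?\<psi> P) = P"
      using inv by (simp_all add: lift_glue[OF bij \<phi>] lift_glue[OF bij' \<psi>])
  qed
  then have "homeomorphic_map (surface \<O>) (surface \<O>) (lift \<phi>)"
    using homeomorphic_map_maps by blast
  moreover have "covering \<O> (lift \<phi> P) = covering \<O> P" if "P \<in> surface_points \<O>" for P
    using that by (rule surface_pointsE) (simp add: lift_glue[OF bij \<phi>] covering_glue_class)
  ultimately show ?thesis
    by (simp add: deck_transformations_def topspace_surface lift_def)
qed

lemma deck_transformation_cases:
  assumes "f \<in> deck_transformations \<O>"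
  obtains \<phi> where "commuting \<phi>" "\<And>g z. g \<in> S \<Longrightarrow> z \<in> unit_square \<Longrightarrow> f (glue (g, z)) = glue (\<phi> g, z)"
proof -
  obtain \<phi> where \<phi>: "\<phi> \<in> S \<rightarrow> S" "\<And>g z. g \<in> S \<Longrightarrow> z \<in> unit_square \<Longrightarrow> f (glue (g, z)) = glue (\<phi> g, z)"
    using deck_transformation_permutes_squares[OF assms] by metis
  have "commuting \<phi>"
    using \<phi>(1) permutation_of_squares_commutes[OF \<phi>] unfolding commuting_def by blast
  then show thesis by (rule that) (rule \<phi>(2))
qed

lemma subgroup_deck_transformations:
  "subgroup (deck_transformations \<O>) (BijGroup (topspace (surface \<O>)))"
proof (rule group.subgroupI[OF group_BijGroup])
  let ?X = "topspace (surface \<O>)"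
  have bijX: "bij_betw f ?X ?X" if "f \<in> deck_transformations \<O>" for f
    using that homeomorphic_imp_injective_map homeomorphic_imp_surjective_map
    unfolding deck_transformations_def bij_betw_def by blast
  then show sub: "deck_transformations \<O> \<subseteq> carrier (BijGroup ?X)"
    by (auto simp: BijGroup_def Bij_def deck_transformations_def)
  have "(\<lambda>P \<in> ?X. P) \<in> deck_transformations \<O>"
    using homeomorphic_map_eq[of "surface \<O>" "surface \<O>" id "\<lambda>P \<in> ?X. P"]
    by (simp add: deck_transformations_def)
  then show "deck_transformations \<O> \<noteq> {}" by blast
  fix f assume f: "f \<in> deck_transformations \<O>"
  then have fB: "f \<in> Bij ?X" using sub by (auto simp: BijGroup_def)
  have hf: "homeomorphic_map (surface \<O>) (surface \<O>) f" and cf: "\<And>P. P \<in> ?X \<Longrightarrow> covering \<O> (f P) = covering \<O> P"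
    using f by (auto simp: deck_transformations_def)
  have inv: "inv_into ?X f P \<in> ?X" "f (inv_into ?X f P) = P" if "P \<in> ?X" for P
    using bijX[OF f] that by (auto simp: bij_betw_def inv_into_into f_inv_into_f)
  obtain k where k: "homeomorphic_maps (surface \<O>) (surface \<O>) f k"
    using hf homeomorphic_map_maps by blast
  have "inv_into ?X f P = k P" if "P \<in> ?X" for P
  proof (rule inv_into_f_eq)
    show "inj_on f ?X" using bijX[OF f] by (rule bij_betw_imp_inj_on)
    show "k P \<in> ?X" "f (k P) = P"
      using k that continuous_map_image_subset_topspace[of "surface \<O>" "surface \<O>" k]
      unfolding homeomorphic_maps_def by blast+
  qed
  note inv_eq = this
  have "homeomorphic_map (surface \<O>) (surface \<O>) (\<lambda>P \<in> ?X. inv_into ?X f P)"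
  proof (rule homeomorphic_map_eq)
    show "homeomorphic_map (surface \<O>) (surface \<O>) k" using k homeomorphic_maps_map by blast
  qed (simp add: inv_eq)
  moreover have "covering \<O> (inv_into ?X f P) = covering \<O> P" if "P \<in> ?X" for P
    using cf[OF inv(1)[OF that]] inv(2)[OF that] by simp
  ultimately show "inv\<^bsub>BijGroup ?X\<^esub> f \<in> deck_transformations \<O>"
    by (simp add: inv_BijGroup[OF fB] deck_transformations_def)
  fix k assume k: "k \<in> deck_transformations \<O>"
  then have kB: "k \<in> Bij ?X" using sub by (auto simp: BijGroup_def)
  have hk: "homeomorphic_map (surface \<O>) (surface \<O>) k" and ck: "\<And>P. P \<in> ?X \<Longrightarrow> covering \<O> (k P) = covering \<O> P"
    using k by (auto simp: deck_transformations_def)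
  have "k P \<in> ?X" if "P \<in> ?X" for P
    using bijX[OF k] that by (auto simp: bij_betw_def)
  then have "covering \<O> (f (k P)) = covering \<O> P" if "P \<in> ?X" for P
    using cf ck that by simp
  moreover have "homeomorphic_map (surface \<O>) (surface \<O>) (compose ?X f k)"
    using homeomorphic_map_compose[OF hk hf] by (rule homeomorphic_map_eq) (simp add: compose_def)
  ultimately have "compose ?X f k \<in> deck_transformations \<O>"
    by (simp add: deck_transformations_def compose_def)
  then show "f \<otimes>\<^bsub>BijGroup ?X\<^esub> k \<in> deck_transformations \<O>"
    using fB kB by (simp add: BijGroup_def)
qed

lemma group_deck_group: "group (deck_group \<O>)"
  unfolding deck_group_def
  by (rule subgroup.subgroup_is_group[OF subgroup_deck_transformations group_BijGroup])

lemma carrier_deck_group: "carrier (deck_group \<O>) = deck_transformations \<O>"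
  by (simp add: deck_group_def)

lemma centre_in_unit_square: "(1/2, 1/2) \<in> unit_square"
  by (simp add: unit_square_def)

text \<open>As the surface is connected, a deck transformation is determined by the image of the centre of
  one square, and by assumption all squares are possible.\<close>

lemma card_deck_transformations:
  assumes conn: "connected_space (surface \<O>)" and g0: "g0 \<in> S"
    and trans: "\<And>h. h \<in> S \<Longrightarrow> \<exists>\<phi>. commuting \<phi> \<and> \<phi> g0 = h"
  shows "card (deck_transformations \<O>) = card S"
proof -
  let ?c = "(1/2, 1/2) :: real \<times> real"
  let ?e = "\<lambda>f. f (glue (g0, ?c))"
  have c: "?c \<in> unit_square" by (rule centre_in_unit_square)
  have inj: "inj_on ?e (deck_transformations \<O>)"
  proof (rule inj_onI)
    fix f k assume f: "f \<in> deck_transformations \<O>" and k: "k \<in> deck_transformations \<O>" and eq: "?e f = ?e k"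
    obtain \<phi> where \<phi>: "commuting \<phi>" "\<And>g z. g \<in> S \<Longrightarrow> z \<in> unit_square \<Longrightarrow> f (glue (g, z)) = glue (\<phi> g, z)"
      using deck_transformation_cases[OF f] by metis
    obtain \<psi> where \<psi>: "commuting \<psi>" "\<And>g z. g \<in> S \<Longrightarrow> z \<in> unit_square \<Longrightarrow> k (glue (g, z)) = glue (\<psi> g, z)"
      using deck_transformation_cases[OF k] by metis
    have "\<phi> g0 \<in> S" "\<psi> g0 \<in> S" using \<phi>(1) \<psi>(1) g0 by (auto simp: commuting_def)
    moreover have "glue (\<phi> g0, ?c) = glue (\<psi> g0, ?c)" using eq \<phi>(2)[OF g0 c] \<psi>(2)[OF g0 c] by simp
    ultimately have "\<phi> g0 = \<psi> g0" using glue_eq_noncorner[of "\<phi> g0" "\<psi> g0" "1/2" "1/2"] by simp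
    then have "\<phi> g = \<psi> g" if "g \<in> S" for g
      using commuting_agree[OF conn \<phi>(1) \<psi>(1) g0 _ that] by blast
    then have "f P = k P" if "P \<in> surface_points \<O>" for P
      using that \<phi>(2) \<psi>(2) by (elim surface_pointsE) simp
    moreover have "f \<in> extensional (surface_points \<O>)" "k \<in> extensional (surface_points \<O>)"
      using f k by (auto simp: deck_transformations_def topspace_surface)
    ultimately show "f = k" by (metis extensionalityI)
  qed
  have "?e ` deck_transformations \<O> = (\<lambda>h. glue (h, ?c)) ` S"
  proof
    show "?e ` deck_transformations \<O> \<subseteq> (\<lambda>h. glue (h, ?c)) ` S"
    proof (rule image_subsetI)
      fix f assume "f \<in> deck_transformations \<O>"
      then obtain \<phi> where \<phi>: "commuting \<phi>" "\<And>g z. g \<in> S \<Longrightarrow> z \<in> unit_square \<Longrightarrow> f (glue (g, z)) = glue (\<phi> g, z)"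
        using deck_transformation_cases by metis
      then show "?e f \<in> (\<lambda>h. glue (h, ?c)) ` S"
        using g0 c by (auto simp: commuting_def)
    qed
    show "(\<lambda>h. glue (h, ?c)) ` S \<subseteq> ?e ` deck_transformations \<O>"
    proof (rule image_subsetI)
      fix h assume "h \<in> S"
      then obtain \<phi> where \<phi>: "commuting \<phi>" "\<phi> g0 = h" using trans by blast
      have bij: "bij_betw \<phi> S S" by (rule commuting_bij[OF conn \<phi>(1)])
      have "glue (h, ?c) = ?e (lift \<phi>)" using lift_glue[OF bij \<phi>(1) g0 c] \<phi>(2) by simp
      then show "glue (h, ?c) \<in> ?e ` deck_transformations \<O>"
        using lift_deck[OF bij \<phi>(1)] by blast
    qed
  qed
  moreover have "inj_on (\<lambda>h. glue (h, ?c)) S"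
    using glue_eq_noncorner[of _ _ "1/2" "1/2"] by (auto intro!: inj_onI)
  ultimately show ?thesis using card_image[OF inj] card_image by metis
qed

lemma deck_transformation_maps_squares:
  assumes \<phi>: "\<And>z. z \<in> unit_square \<Longrightarrow> f (glue (g, z)) = glue (\<phi> g, z)"
  shows "f ` square_in_surface \<O> g = square_in_surface \<O> (\<phi> g)"
proof -
  have "square_in_surface \<O> h = (\<lambda>z. glue (h, z)) ` unit_square" for h
    by (force simp: square_in_surface_def)
  then show ?thesis using \<phi> by (simp add: image_image)
qed

lemma square_in_surface_inj:
  assumes "g \<in> S" "h \<in> S" "square_in_surface \<O> g = square_in_surface \<O> h"
  shows "g = h"
proof -
  have "glue (g, 1/2, 1/2) \<in> square_in_surface \<O> h"
    using assms(3) centre_in_unit_square unfolding square_in_surface_def by blast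
  then obtain z where "z \<in> unit_square" "glue (g, 1/2, 1/2) = glue (h, z)"
    by (auto simp: square_in_surface_def)
  then have "(h, z) \<in> glue (g, 1/2, 1/2)" using self_in_glue[of "(h, z)"] by simp
  then show ?thesis using glue_interior[OF assms(1), of "1/2" "1/2"] by simp
qed

lemma normal_origami_iff:
  assumes "origami \<O>"
  shows "normal_origami \<O> \<longleftrightarrow> (\<forall>g \<in> S. \<forall>h \<in> S. \<exists>\<phi>. commuting \<phi> \<and> \<phi> g = h)"
proof -
  have conn: "connected_space (surface \<O>)" using assms by (simp add: origami_def)
  have "(\<exists>f \<in> deck_transformations \<O>. f ` square_in_surface \<O> g = square_in_surface \<O> h) \<longleftrightarrow>
      (\<exists>\<phi>. commuting \<phi> \<and> \<phi> g = h)" if g: "g \<in> S" and h: "h \<in> S" for g h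
  proof
    assume "\<exists>f \<in> deck_transformations \<O>. f ` square_in_surface \<O> g = square_in_surface \<O> h"
    then obtain f where f: "f \<in> deck_transformations \<O>" "f ` square_in_surface \<O> g = square_in_surface \<O> h" by blast
    obtain \<phi> where \<phi>: "commuting \<phi>" "\<And>g z. g \<in> S \<Longrightarrow> z \<in> unit_square \<Longrightarrow> f (glue (g, z)) = glue (\<phi> g, z)"
      using deck_transformation_cases[OF f(1)] by metis
    have "\<phi> g \<in> S" using \<phi>(1) g by (auto simp: commuting_def)
    then have "\<phi> g = h"
      using f(2) deck_transformation_maps_squares[of f g \<phi>, OF \<phi>(2)[OF g]] square_in_surface_inj[OF _ h] by simp
    then show "\<exists>\<phi>. commuting \<phi> \<and> \<phi> g = h" using \<phi>(1) by blast
  next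
    assume "\<exists>\<phi>. commuting \<phi> \<and> \<phi> g = h"
    then obtain \<phi> where \<phi>: "commuting \<phi>" "\<phi> g = h" by blast
    have bij: "bij_betw \<phi> S S" by (rule commuting_bij[OF conn \<phi>(1)])
    have "lift \<phi> ` square_in_surface \<O> g = square_in_surface \<O> (\<phi> g)"
      by (rule deck_transformation_maps_squares) (rule lift_glue[OF bij \<phi>(1) g])
    then show "\<exists>f \<in> deck_transformations \<O>. f ` square_in_surface \<O> g = square_in_surface \<O> h"
      using lift_deck[OF bij \<phi>(1)] \<phi>(2) by blast
  qed
  then have "(\<forall>g \<in> S. \<forall>h \<in> S. \<exists>f \<in> deck_transformations \<O>. f ` square_in_surface \<O> g = square_in_surface \<O> h) \<longleftrightarrow>
      (\<forall>g \<in> S. \<forall>h \<in> S. \<exists>\<phi>. commuting \<phi> \<and> \<phi> g = h)"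
    by (intro ball_cong refl)
  then show ?thesis
    using assms by (simp add: normal_origami_def carrier_deck_group)
qed

lemma p_origamiI:
  assumes "origami \<O>" "card S = p ^ n" and trans: "\<And>g h. g \<in> S \<Longrightarrow> h \<in> S \<Longrightarrow> \<exists>\<phi>. commuting \<phi> \<and> \<phi> g = h"
  shows "p_origami p \<O>"
proof -
  obtain g0 where g0: "g0 \<in> S" using assms(1) by (auto simp: origami_def)
  have "card (deck_transformations \<O>) = p ^ n"
    using card_deck_transformations[OF _ g0 trans[OF g0]] assms(1,2) by (simp add: origami_def)
  moreover have "card S > 0" using g0 finite_squares by (auto simp: card_gt_0_iff)
  then have "finite (deck_transformations \<O>)"
    using calculation assms(2) by (intro card_ge_0_finite) simp
  ultimately show ?thesis
    using group_deck_group normal_origami_iff[OF assms(1)] trans assms(1,2)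
    by (auto simp: p_origami_def finite_p_group_def carrier_deck_group Coset.order_def)
qed

section \<open>The monodromy group\<close>

text \<open>The permutations of the squares that commute with all automorphisms of the gluing. If the
  automorphisms act transitively and the surface is connected, this is the group generated by the
  neighbour maps. Describing it as a centralizer has the advantage that freeness is immediate
  (\<open>monodromy_free\<close>) and that it only takes membership of the neighbour maps to get
  transitivity (\<open>card_monodromy\<close>).\<close>

definition monodromy :: "('a \<Rightarrow> 'a) monoid" where
  "monodromy = (BijGroup S)\<lparr>carrier := {m \<in> Bij S. \<forall>\<phi>. commuting \<phi> \<longrightarrow> (\<forall>g \<in> S. m (\<phi> g) = \<phi> (m g))}\<rparr>"

lemma carrier_monodromy:
  "m \<in> carrier monodromy \<longleftrightarrow> m \<in> Bij S \<and> (\<forall>\<phi>. commuting \<phi> \<longrightarrow> (\<forall>g \<in> S. m (\<phi> g) = \<phi> (m g)))"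
  by (simp add: monodromy_def)

lemma Bij_in: "m \<in> Bij S \<Longrightarrow> g \<in> S \<Longrightarrow> m g \<in> S"
  using Bij_imp_funcset by blast

lemma commuting_in: "commuting \<phi> \<Longrightarrow> g \<in> S \<Longrightarrow> \<phi> g \<in> S"
  by (auto simp: commuting_def)

lemma subgroup_monodromy: "subgroup (carrier monodromy) (BijGroup S)"
proof (rule group.subgroupI[OF group_BijGroup])
  show "carrier monodromy \<subseteq> carrier (BijGroup S)"
    by (auto simp: carrier_monodromy BijGroup_def)
  have "(\<lambda>g \<in> S. g) \<in> carrier monodromy"
    by (simp add: carrier_monodromy id_Bij commuting_in)
  then show "carrier monodromy \<noteq> {}" by blast
  fix m assume m: "m \<in> carrier monodromy"
  then have mB: "m \<in> Bij S" by (simp add: carrier_monodromy)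
  have inv: "inv_into S m g \<in> S" "m (inv_into S m g) = g" if "g \<in> S" for g
    using mB that by (auto simp: Bij_def bij_betw_def inv_into_into f_inv_into_f)
  have "inv_into S m (\<phi> g) = \<phi> (inv_into S m g)" if \<phi>: "commuting \<phi>" and g: "g \<in> S" for \<phi> g
  proof (rule inv_into_f_eq)
    show "inj_on m S" using mB by (simp add: Bij_def bij_betw_def)
    show "\<phi> (inv_into S m g) \<in> S" using commuting_in[OF \<phi> inv(1)[OF g]] .
    show "m (\<phi> (inv_into S m g)) = \<phi> g"
      using m \<phi> inv[OF g] by (simp add: carrier_monodromy)
  qed
  then show "inv\<^bsub>BijGroup S\<^esub> m \<in> carrier monodromy"
    by (simp add: inv_BijGroup[OF mB] carrier_monodromy restrict_inv_into_Bij[OF mB] commuting_in)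
  fix m' assume m': "m' \<in> carrier monodromy"
  then have m'B: "m' \<in> Bij S" by (simp add: carrier_monodromy)
  have "compose S m m' \<in> carrier monodromy"
    using m m' Bij_in[OF m'B] compose_Bij[OF mB m'B] commuting_in by (simp add: carrier_monodromy compose_def)
  then show "m \<otimes>\<^bsub>BijGroup S\<^esub> m' \<in> carrier monodromy"
    using mB m'B by (simp add: BijGroup_def)
qed

lemma group_monodromy: "group monodromy"
  using subgroup.subgroup_is_group[OF subgroup_monodromy group_BijGroup] by (simp add: monodromy_def)

lemma mult_monodromy:
  "m \<in> carrier monodromy \<Longrightarrow> m' \<in> carrier monodromy \<Longrightarrow> g \<in> S \<Longrightarrow> (m \<otimes>\<^bsub>monodromy\<^esub> m') g = m (m' g)"
  by (simp add: monodromy_def BijGroup_def compose_def)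

lemma one_monodromy: "g \<in> S \<Longrightarrow> \<one>\<^bsub>monodromy\<^esub> g = g"
  by (simp add: monodromy_def BijGroup_def)

definition right_perm :: "'a \<Rightarrow> 'a" where "right_perm = restrict r S"
definition upper_perm :: "'a \<Rightarrow> 'a" where "upper_perm = restrict u S"

lemma perms_in_monodromy: "right_perm \<in> carrier monodromy" "upper_perm \<in> carrier monodromy"
  using bij_right bij_upper
  by (auto simp: carrier_monodromy Bij_def right_perm_def upper_perm_def commuting_def)

lemma monodromy_free:
  assumes trans: "\<And>g h. g \<in> S \<Longrightarrow> h \<in> S \<Longrightarrow> \<exists>\<phi>. commuting \<phi> \<and> \<phi> g = h"
    and m: "m \<in> carrier monodromy" "m' \<in> carrier monodromy" and g: "g \<in> S" "m g = m' g"
  shows "m = m'"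
proof (rule extensionalityI)
  show "m \<in> extensional S" "m' \<in> extensional S"
    using m by (auto simp: carrier_monodromy Bij_def)
  fix h assume "h \<in> S"
  then obtain \<phi> where \<phi>: "commuting \<phi>" "\<phi> g = h" using trans g by blast
  have "m (\<phi> g) = \<phi> (m g)" "m' (\<phi> g) = \<phi> (m' g)"
    using m \<phi>(1) g(1) by (auto simp: carrier_monodromy)
  then show "m h = m' h" using \<phi>(2) g(2) by simp
qed

lemma card_monodromy:
  assumes conn: "connected_space (surface \<O>)" and g0: "g0 \<in> S"
    and trans: "\<And>g h. g \<in> S \<Longrightarrow> h \<in> S \<Longrightarrow> \<exists>\<phi>. commuting \<phi> \<and> \<phi> g = h"
  shows "card (carrier monodromy) = card S"
proof -
  interpret group monodromy by (rule group_monodromy)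
  let ?T = "(\<lambda>m. m g0) ` carrier monodromy"
  have "inj_on (\<lambda>m. m g0) (carrier monodromy)"
    using monodromy_free[OF trans _ _ g0] by (intro inj_onI) blast
  moreover have "?T = S"
  proof (rule connected_imp_transitive[OF conn])
    show "?T \<subseteq> S" using g0 Bij_in by (auto simp: carrier_monodromy)
    show "?T \<noteq> {}" using one_closed by blast
    fix g assume "g \<in> ?T"
    then obtain m where m: "m \<in> carrier monodromy" "g = m g0" by blast
    have "m g0 \<in> S" using m(1) g0 Bij_in by (auto simp: carrier_monodromy)
    then have "r g = (right_perm \<otimes>\<^bsub>monodromy\<^esub> m) g0" "u g = (upper_perm \<otimes>\<^bsub>monodromy\<^esub> m) g0"
      using mult_monodromy[OF _ m(1) g0] perms_in_monodromy m(2) by (simp_all add: right_perm_def upper_perm_def)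
    then show "r g \<in> ?T" "u g \<in> ?T"
      using perms_in_monodromy m(1) m_closed by blast+
  qed
  ultimately show ?thesis by (metis card_image)
qed

lemma commutator_eq_turn:
  fixes c
  defines "c \<equiv> upper_perm \<otimes>\<^bsub>monodromy\<^esub> right_perm \<otimes>\<^bsub>monodromy\<^esub> inv\<^bsub>monodromy\<^esub> upper_perm \<otimes>\<^bsub>monodromy\<^esub> inv\<^bsub>monodromy\<^esub> right_perm"
  assumes g: "g \<in> S"
  shows "c g = turn g"
proof -
  interpret group monodromy by (rule group_monodromy)
  note P = perms_in_monodromy
  have c: "c \<in> carrier monodromy" using P by (simp add: c_def)
  define h where "h = lower_nb (left_nb g)"
  have h: "h \<in> S" "r (u h) = g" using g by (simp_all add: h_def)
  have "c \<otimes>\<^bsub>monodromy\<^esub> (right_perm \<otimes>\<^bsub>monodromy\<^esub> upper_perm) = upper_perm \<otimes>\<^bsub>monodromy\<^esub> right_perm"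
    using P by (simp add: c_def m_assoc inv_solve_left')
  then have "(c \<otimes>\<^bsub>monodromy\<^esub> (right_perm \<otimes>\<^bsub>monodromy\<^esub> upper_perm)) h = (upper_perm \<otimes>\<^bsub>monodromy\<^esub> right_perm) h"
    by simp
  then have "c (r (u h)) = u (r h)"
    using P c h by (simp add: mult_monodromy right_perm_def upper_perm_def)
  then show ?thesis using turn_eq[OF h(1)] h(2) by simp
qed

text \<open>The powers of the commutator act as the powers of \<open>turn\<close>. As the group acts freely, a power that
  fixes one square is trivial.\<close>

lemma card_corner_orbit_eq_ord:
  fixes c
  defines "c \<equiv> upper_perm \<otimes>\<^bsub>monodromy\<^esub> right_perm \<otimes>\<^bsub>monodromy\<^esub> inv\<^bsub>monodromy\<^esub> upper_perm \<otimes>\<^bsub>monodromy\<^esub> inv\<^bsub>monodromy\<^esub> right_perm"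
  assumes conn: "connected_space (surface \<O>)" and g: "g \<in> S"
    and trans: "\<And>g h. g \<in> S \<Longrightarrow> h \<in> S \<Longrightarrow> \<exists>\<phi>. commuting \<phi> \<and> \<phi> g = h"
  shows "card (corner_orbit g) = group.ord monodromy c"
proof (rule card_corner_orbit[OF _ _ g])
  interpret group monodromy by (rule group_monodromy)
  have c: "c \<in> carrier monodromy" using perms_in_monodromy by (simp add: c_def)
  have pow: "(c [^]\<^bsub>monodromy\<^esub> m) h = (turn ^^ m) h" if "h \<in> S" for m :: nat and h
    using that
  proof (induction m arbitrary: h)
    case (Suc m)
    have "(c [^]\<^bsub>monodromy\<^esub> Suc m) h = (c [^]\<^bsub>monodromy\<^esub> m) (turn h)"
      using commutator_eq_turn[OF Suc.prems] c Suc.prems by (simp add: mult_monodromy c_def)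
    also have "\<dots> = (turn ^^ Suc m) h"
      using Suc by (simp only: turn_in funpow_Suc_right comp_apply)
    finally show ?case .
  qed (simp add: one_monodromy)
  have "(turn ^^ m) g = g \<longleftrightarrow> c [^]\<^bsub>monodromy\<^esub> m = \<one>\<^bsub>monodromy\<^esub>" for m :: nat
    using pow[OF g, of m] monodromy_free[OF trans _ one_closed g, of "c [^]\<^bsub>monodromy\<^esub> m"] c one_monodromy[OF g]
    by (metis nat_pow_closed)
  then show "(turn ^^ m) g = g \<longleftrightarrow> ord c dvd m" for m
    using pow_eq_id[OF c] by simp
  have "card (carrier monodromy) > 0"
    using card_monodromy[OF conn g trans] g finite_squares by (auto simp: card_gt_0_iff)
  then show "ord c > 0"
    using ord_ge_1[OF _ c] card_ge_0_finite by fastforce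
qed

lemma uniform_in_stratum:
  assumes "origami \<O>" and d: "\<And>g. g \<in> S \<Longrightarrow> card (corner_orbit g) = d" "d > 1" and K: "d * K = card S"
  shows "\<O> \<in> stratum K (d - 1)"
proof -
  have "d * card (singularities \<O>) = d * K"
    using card_corners[OF d(1)] singularities_uniform(2)[OF d(1) d(2)] K by simp
  then have "card (singularities \<O>) = K" using d(2) by simp
  moreover have "finite (singularities \<O>)"
    using singularities_uniform(2)[OF d(1) d(2)] finite_squares by simp
  ultimately show ?thesis
    using assms(1) singularities_uniform(3)[OF d(1)] d(2) by (simp add: stratum_def)
qed

end

lemma origami_imp_square_gluing: "origami \<O> \<Longrightarrow> square_gluing \<O>"
  by (simp add: origami_def square_gluing_def)

text \<open>All corner orbits have the order \<open>p\<^sup>k\<close> of the commutator as their size, so its bounds are bounds on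
  the multiplicity of the singularities.\<close>

theorem p_origami_strata:
  fixes \<O> :: "'a origami_gluing"
  assumes p: "prime p" and "p_origami p \<O>" and deg: "origami_degree \<O> = p ^ n"
  shows "(singularities \<O> = {} \<and> genus \<O> = 1) \<or>
    (\<exists>k. 1 \<le> k \<and> (p = 2 \<longrightarrow> k + 2 \<le> n) \<and> (p > 2 \<longrightarrow> 2 * k < n) \<and> \<O> \<in> stratum (p ^ (n - k)) (p ^ k - 1))"
proof -
  have norm: "normal_origami \<O>" and ori: "origami \<O>"
    using assms(2) by (auto simp: p_origami_def normal_origami_def)
  interpret square_gluing \<O> by (rule origami_imp_square_gluing[OF ori])
  have conn: "connected_space (surface \<O>)" using ori by (simp add: origami_def)
  have cardS: "card S = p ^ n" using deg by (simp add: origami_degree_def)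
  have trans: "\<And>g h. g \<in> S \<Longrightarrow> h \<in> S \<Longrightarrow> \<exists>\<phi>. commuting \<phi> \<and> \<phi> g = h"
    using norm normal_origami_iff[OF ori] by blast
  obtain g0 where g0: "g0 \<in> S" using ori by (auto simp: origami_def)
  interpret G: prime_power_group monodromy p n
    using group_monodromy p card_monodromy[OF conn g0 trans] cardS
    by (simp add: prime_power_group_def prime_power_group_axioms_def)
  define c where "c = upper_perm \<otimes>\<^bsub>monodromy\<^esub> right_perm \<otimes>\<^bsub>monodromy\<^esub> inv\<^bsub>monodromy\<^esub> upper_perm \<otimes>\<^bsub>monodromy\<^esub> inv\<^bsub>monodromy\<^esub> right_perm"
  have c: "c \<in> carrier monodromy" using perms_in_monodromy by (simp add: c_def)
  obtain k where k: "group.ord monodromy c = p ^ k" using G.ord_prime_power[OF c] .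
  have orbit: "card (corner_orbit g) = p ^ k" if "g \<in> S" for g
    using card_corner_orbit_eq_ord[OF conn that trans] k by (simp add: c_def)
  show ?thesis
  proof (cases "k = 0")
    case True
    then show ?thesis using singularities_uniform(1)[of 1] genus_flat orbit by simp
  next
    case False
    have bound: "e * (k - 1) + 3 \<le> n" if "e = 1 \<or> e = 2 \<and> odd p" for e
      using commutator_order_bound[OF G.prime_power_group_axioms perms_in_monodromy(2,1) _ _ that] k False
      by (simp add: c_def)
    have kn: "k + 2 \<le> n" using bound[of 1] False by simp
    have "2 * k < n" if "p > 2"
    proof -
      have "odd p" using that p by (simp add: prime_odd_nat)
      then show ?thesis using bound[of 2] False by simp
    qed
    moreover have "p ^ k * p ^ (n - k) = card S"
      using kn cardS by (simp flip: power_add)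
    then have "\<O> \<in> stratum (p ^ (n - k)) (p ^ k - 1)"
      using False prime_gt_1_nat[OF p] by (intro uniform_in_stratum ori orbit one_less_power) auto
    ultimately show ?thesis using kn False by (intro disjI2 exI[of _ k]) auto
  qed
qed

section \<open>Semidirect products of cyclic groups\<close>

lemma mod_add_cancel:
  fixes i i' a N :: nat
  assumes "i < N" "i' < N" "(i + a) mod N = (i' + a) mod N"
  shows "i = i'"
  using assms by (metis cong_add_rcancel_nat cong_def mod_less)

text \<open>The pair \<open>(i, j)\<close> stands for \<open>x\<^sup>i y\<^sup>j\<close> in the semidirect product of the cyclic groups of orders \<open>N\<close> and
  \<open>M\<close> with \<open>y x y\<^sup>-\<^sup>1 = x\<^sup>w\<close>. The factor \<open>1 + (N - 1) * w\<close> is \<open>1 - w\<close> modulo \<open>N\<close>, and the last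
  assumption says that \<open>x\<^sup>1\<^sup>-\<^sup>w\<close>, to which the commutator is conjugate, has order \<open>d\<close>.\<close>

locale semidirect_cyclic =
  fixes N M w d :: nat
  assumes N: "N > 0" and M: "M > 0" and wM: "[w ^ M = 1] (mod N)"
    and d: "d > 0" "\<And>m. N dvd m * (1 + (N - 1) * w) \<longleftrightarrow> d dvd m"
begin

text \<open>Right multiplication by \<open>x\<close> and \<open>y\<close>, where \<open>x\<^sup>i y\<^sup>j x = x\<^sup>i\<^sup>+\<^sup>v y\<^sup>j\<close> with \<open>v = w\<^sup>j\<close>.\<close>

definition gluing :: "nat origami_gluing" where
  "gluing = \<lparr>squares = prod_encode ` ({..<N} \<times> {..<M}),
     right_nb = (\<lambda>q. case prod_decode q of (i, j) \<Rightarrow> prod_encode ((i + w ^ j) mod N, j)),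
     upper_nb = (\<lambda>q. case prod_decode q of (i, j) \<Rightarrow> prod_encode (i, Suc j mod M))\<rparr>"

abbreviation "sq i j \<equiv> prod_encode (i, j)"

lemma gluing_simps [simp]:
  "right_nb gluing (sq i j) = sq ((i + w ^ j) mod N) j"
  "upper_nb gluing (sq i j) = sq i (Suc j mod M)"
  by (simp_all add: gluing_def)

lemma squares_iff [simp]: "sq i j \<in> squares gluing \<longleftrightarrow> i < N \<and> j < M"
  by (auto simp: gluing_def)

lemma squaresE:
  assumes "g \<in> squares gluing"
  obtains i j where "i < N" "j < M" "g = sq i j"
  using assms by (auto simp: gluing_def)

lemma card_squares: "card (squares gluing) = N * M"
  by (simp add: gluing_def card_image inj_on_def card_cartesian_product)

sublocale square_gluing gluing
proof
  show fin: "finite (squares gluing)" by (simp add: gluing_def)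
  have "inj_on (right_nb gluing) (squares gluing)"
  proof (rule inj_onI)
    fix g h assume "g \<in> squares gluing" "h \<in> squares gluing" and eq: "right_nb gluing g = right_nb gluing h"
    then obtain i j i' j' where "i < N" "j < M" "g = sq i j" "i' < N" "j' < M" "h = sq i' j'"
      by (metis squaresE)
    then show "g = h" using eq mod_add_cancel[of i N i' "w ^ j"] by auto
  qed
  moreover have "right_nb gluing ` squares gluing \<subseteq> squares gluing"
    using N by (auto elim: squaresE)
  ultimately show "bij_betw (right_nb gluing) (squares gluing) (squares gluing)"
    using endo_inj_surj[OF fin] by (simp add: bij_betw_def)
  have "inj_on (upper_nb gluing) (squares gluing)"
  proof (rule inj_onI)
    fix g h assume "g \<in> squares gluing" "h \<in> squares gluing" and eq: "upper_nb gluing g = upper_nb gluing h"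
    then obtain i j i' j' where "i < N" "j < M" "g = sq i j" "i' < N" "j' < M" "h = sq i' j'"
      by (metis squaresE)
    then show "g = h" using eq mod_add_cancel[of j M j' 1] by simp
  qed
  moreover have "upper_nb gluing ` squares gluing \<subseteq> squares gluing"
    using M by (auto elim: squaresE)
  ultimately show "bij_betw (upper_nb gluing) (squares gluing) (squares gluing)"
    using endo_inj_surj[OF fin] by (simp add: bij_betw_def)
qed

lemma pow_mod_M: "[w ^ (j mod M) = w ^ j] (mod N)"
proof -
  have "[w ^ (j mod M) * (w ^ M) ^ (j div M) = w ^ (j mod M) * 1 ^ (j div M)] (mod N)"
    by (intro cong_mult cong_refl cong_pow wM)
  moreover have "w ^ (j mod M) * (w ^ M) ^ (j div M) = w ^ j"
    by (metis mod_mult_div_eq power_add power_mult)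
  ultimately show ?thesis by (simp add: cong_sym)
qed

text \<open>Left multiplication by \<open>x\<^sup>a y\<^sup>b\<close>, which commutes with right multiplications.\<close>

definition left_mult :: "nat \<Rightarrow> nat \<Rightarrow> nat \<Rightarrow> nat" where
  "left_mult a b q = (case prod_decode q of (i, j) \<Rightarrow> sq ((a + w ^ b * i) mod N) ((b + j) mod M))"

lemma left_mult_sq [simp]: "left_mult a b (sq i j) = sq ((a + w ^ b * i) mod N) ((b + j) mod M)"
  by (simp add: left_mult_def)

lemma commuting_left_mult: "commuting (left_mult a b)"
proof -
  have "left_mult a b g \<in> S" if "g \<in> S" for g
    using that N M by (auto elim!: squaresE)
  moreover have "left_mult a b (r g) = r (left_mult a b g) \<and> left_mult a b (u g) = u (left_mult a b g)" if gS: "g \<in> S" for g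
  proof -
    obtain i j where "i < N" "j < M" and g: "g = sq i j" using gS by (rule squaresE)
    have "[a + w ^ b * ((i + w ^ j) mod N) = a + w ^ b * (i + w ^ j)] (mod N)"
      by (intro cong_add cong_mult cong_refl) (simp add: cong_def)
    also have "a + w ^ b * (i + w ^ j) = (a + w ^ b * i) + w ^ (b + j)"
      by (simp add: algebra_simps power_add)
    also have "[(a + w ^ b * i) + w ^ (b + j) = (a + w ^ b * i) mod N + w ^ ((b + j) mod M)] (mod N)"
      by (intro cong_add cong_sym[OF pow_mod_M]) (simp add: cong_def)
    finally show ?thesis by (simp add: g cong_def mod_simps)
  qed
  ultimately show ?thesis by (auto simp: commuting_def)
qed

lemma transitive_automorphisms:
  assumes "g \<in> S" "h \<in> S"
  shows "\<exists>\<phi>. commuting \<phi> \<and> \<phi> g = h"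
proof -
  obtain i j where g: "i < N" "j < M" "g = sq i j" using assms(1) by (rule squaresE)
  obtain i' j' where h: "i' < N" "j' < M" "h = sq i' j'" using assms(2) by (rule squaresE)
  \<comment> \<open>\<open>M - j\<close> and the factor \<open>N - 1\<close> stand for \<open>- j\<close> modulo \<open>M\<close> and \<open>- 1\<close> modulo \<open>N\<close>.\<close>
  define b where "b = j' + (M - j)"
  define a where "a = i' + (N - 1) * (w ^ b * i)"
  have "b + j = j' + M" using g by (simp add: b_def)
  then have 1: "(b + j) mod M = j'" using h by simp
  have "a + w ^ b * i = i' + ((N - 1) + 1) * (w ^ b * i)" by (simp add: a_def)
  also have "(N - 1) + 1 = N" using N by simp
  finally have "(a + w ^ b * i) mod N = i'" using h by simp
  then have "left_mult a b g = h" using 1 by (simp add: g h)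
  then show ?thesis using commuting_left_mult by blast
qed

lemma connected_gluing: "connected_space (surface gluing)"
proof (rule transitive_imp_connected)
  fix T assume T: "T \<subseteq> S" "T \<noteq> {}" and r: "\<And>g. g \<in> T \<Longrightarrow> r g \<in> T" and u: "\<And>g. g \<in> T \<Longrightarrow> u g \<in> T"
  have up: "sq i ((j + m) mod M) \<in> T" if "sq i j \<in> T" for i j m
  proof (induction m)
    case 0
    have "j < M" using that T(1) by auto
    then show ?case using that by simp
  next
    case (Suc m)
    then show ?case using u[OF Suc] by (simp add: mod_Suc_eq)
  qed
  have right: "sq ((i + m * w ^ j) mod N) j \<in> T" if "sq i j \<in> T" for i j m
  proof (induction m)
    case 0
    have "i < N" using that T(1) by auto
    then show ?case using that by simp
  next
    case (Suc m)
    then show ?case using r[OF Suc] by (simp add: mod_simps algebra_simps)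
  qed
  obtain g where "g \<in> T" using T(2) by blast
  then obtain i j where g: "i < N" "j < M" "sq i j \<in> T" using T(1) by (metis squaresE subsetD)
  have 0: "sq i 0 \<in> T" using up[OF g(3), of "M - j"] g(2) by simp
  have "sq i' j' \<in> T" if "i' < N" "j' < M" for i' j'
  proof -
    have "sq i' 0 \<in> T" using right[OF 0, of "(N - i) + i'"] g(1) that(1) by simp
    then show ?thesis using up[of i' 0 j'] that(2) by simp
  qed
  then show "T = S" using T(1) by (auto elim!: squaresE)
qed

lemma origami_gluing: "origami gluing"
  using finite_squares bij_right bij_upper connected_gluing N M
  by (auto simp: origami_def gluing_def lessThan_empty_iff)

lemma coprime_w: "coprime (w ^ j) N"
proof -
  have "coprime (w ^ M) N" using wM by (metis cong_imp_coprime cong_sym coprime_1_left)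
  then show ?thesis using M by (simp add: coprime_power_left_iff)
qed

text \<open>This is \<open>w\<^sup>j\<^sup>-\<^sup>1 - w\<^sup>j\<close> modulo \<open>N\<close>, written with natural numbers.\<close>

definition shift :: "nat \<Rightarrow> nat" where
  "shift j = (N - 1) * w ^ j + w ^ ((j + M - 1) mod M)"

lemma turn_sq:
  assumes "i < N" "j < M"
  shows "turn (sq i j) = sq ((i + shift j) mod N) j"
proof -
  define i0 where "i0 = (i + (N - 1) * w ^ j) mod N"
  define j0 where "j0 = (j + M - 1) mod M"
  have g: "sq i0 j0 \<in> S" using N M by (simp add: i0_def j0_def)
  have j0: "Suc j0 mod M = j" using assms M by (simp add: j0_def mod_Suc_eq)
  have "(i0 + w ^ j) mod N = (i + ((N - 1) + 1) * w ^ j) mod N"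
    by (simp add: i0_def mod_simps algebra_simps)
  also have "(N - 1) + 1 = N" using N by simp
  finally have "(i0 + w ^ j) mod N = i" using assms by simp
  then have A: "r (u (sq i0 j0)) = sq i j" by (simp add: j0)
  have B: "u (r (sq i0 j0)) = sq ((i + shift j) mod N) j"
    by (simp add: j0) (simp add: i0_def j0_def shift_def mod_simps add.assoc)
  show ?thesis using turn_eq[OF g] unfolding A B .
qed

lemma shift_dvd: "j < M \<Longrightarrow> N dvd m * shift j \<longleftrightarrow> d dvd m"
proof -
  assume j: "j < M"
  define j0 where "j0 = (j + M - 1) mod M"
  have "Suc j0 mod M = j" using j M by (simp add: j0_def mod_Suc_eq)
  then have "[w ^ j = w ^ Suc j0] (mod N)" using pow_mod_M[of "Suc j0"] by simp
  then have "[m * shift j = m * ((N - 1) * w ^ Suc j0 + w ^ j0)] (mod N)"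
    unfolding shift_def j0_def[symmetric] by (intro cong_mult cong_add cong_refl)
  also have "m * ((N - 1) * w ^ Suc j0 + w ^ j0) = w ^ j0 * (m * (1 + (N - 1) * w))"
    by (simp add: algebra_simps)
  finally have "N dvd m * shift j \<longleftrightarrow> N dvd w ^ j0 * (m * (1 + (N - 1) * w))"
    by (simp only: cong_def dvd_eq_mod_eq_0)
  also have "\<dots> \<longleftrightarrow> d dvd m"
    using coprime_w[of j0] d(2) by (simp add: coprime_dvd_mult_right_iff coprime_commute)
  finally show ?thesis .
qed

lemma corner_orbit_gluing:
  assumes "g \<in> S"
  shows "card (corner_orbit g) = d"
proof (rule card_corner_orbit[OF d(1) _ assms])
  fix m
  obtain i j where g: "i < N" "j < M" "g = sq i j" using assms by (rule squaresE)
  have "(turn ^^ m) (sq i j) = sq ((i + m * shift j) mod N) j"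
  proof (induction m)
    case (Suc m)
    then show ?case using turn_sq[of "(i + m * shift j) mod N" j] g N
      by (simp add: mod_simps algebra_simps)
  qed (use g in simp)
  moreover have "(i + x) mod N = i \<longleftrightarrow> N dvd x" for x
    using g(1) by (metis cong_add_lcancel_0_nat cong_def cong_0_iff mod_less)
  ultimately show "(turn ^^ m) g = g \<longleftrightarrow> d dvd m"
    using shift_dvd[OF g(2)] by (simp add: g(3))
qed

lemma gluing_in_stratum:
  assumes "d > 1" "d * K = N * M"
  shows "gluing \<in> stratum K (d - 1)"
  using uniform_in_stratum[OF origami_gluing corner_orbit_gluing assms(1)] assms(2) card_squares by simp

lemma p_origami_gluing: "N * M = p ^ n \<Longrightarrow> p_origami p gluing"
  using p_origamiI[OF origami_gluing _ transitive_automorphisms] card_squares by simp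

end

section \<open>All strata occur\<close>

text \<open>Each \<open>p\<close>-th power gains a factor \<open>p\<close>: if \<open>y\<close> is \<open>1\<close> modulo \<open>p\<close>, the cofactor of \<open>y - 1\<close> in
  \<open>y\<^sup>p - 1\<close> is a sum of \<open>p\<close> terms that are \<open>1\<close> modulo \<open>p\<close>.\<close>

lemma one_plus_prime_power_cong:
  fixes p :: nat
  shows "[(1 + p) ^ (p ^ k) = 1] (mod p ^ Suc k)"
proof -
  have "int p ^ Suc k dvd (1 + int p) ^ (p ^ k) - 1"
  proof (induction k)
    case (Suc k)
    define y where "y = (1 + int p) ^ (p ^ k)"
    have y: "int p ^ Suc k dvd y - 1" using Suc by (simp add: y_def)
    then have "int p dvd y - 1" by (metis dvd_trans dvd_power zero_less_Suc)
    then have "[y = 1] (mod int p)" by (simp add: cong_iff_dvd_diff)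
    then have "[(\<Sum>i<p. y ^ i) = (\<Sum>i<p. 1 ^ i)] (mod int p)"
      by (intro cong_sum cong_pow)
    then have "int p dvd (\<Sum>i<p. y ^ i)" by (simp add: cong_def dvd_eq_mod_eq_0)
    then have "int p ^ Suc k * int p dvd (y - 1) * (\<Sum>i<p. y ^ i)"
      using y by (intro mult_dvd_mono)
    moreover have "(1 + int p) ^ (p ^ Suc k) = y ^ p"
      by (simp add: y_def mult.commute flip: power_mult)
    ultimately show ?case
      using power_diff_1_eq[of y p] by (simp add: mult.commute)
  qed simp
  then have "[int ((1 + p) ^ (p ^ k)) = int 1] (mod int (p ^ Suc k))"
    by (simp add: cong_iff_dvd_diff)
  then show ?thesis by (simp only: cong_int_iff)
qed

text \<open>Multiplication by \<open>1 + p\<close> modulo \<open>p\<^sup>k\<^sup>+\<^sup>1\<close> has an order that divides \<open>p\<^sup>k\<close>. The condition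
  \<open>2 * k < n\<close> ensures that \<open>p\<^sup>k\<close> divides the order \<open>p\<^sup>n\<^sup>-\<^sup>k\<^sup>-\<^sup>1\<close> of the acting group.\<close>

lemma odd_stratum_occurs:
  fixes p :: nat
  assumes p: "prime p" and k: "1 \<le> k" "2 * k < n"
  shows "\<exists>\<O> :: nat origami_gluing. p_origami p \<O> \<and> origami_degree \<O> = p ^ n \<and> \<O> \<in> stratum (p ^ (n - k)) (p ^ k - 1)"
proof -
  define N where "N = p ^ Suc k"
  define M where "M = p ^ (n - k - 1)"
  have p1: "p > 1" using prime_gt_1_nat[OF p] .
  have NM: "N * M = p ^ n" unfolding N_def M_def power_add[symmetric] using k by simp
  interpret semidirect_cyclic N M "1 + p" "p ^ k"
  proof
    show "N > 0" "M > 0" "p ^ k > 0" using p1 by (simp_all add: N_def M_def)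
    have "M = p ^ k * p ^ (n - k - 1 - k)" using k by (simp add: M_def flip: power_add)
    moreover have "[((1 + p) ^ (p ^ k)) ^ (p ^ (n - k - 1 - k)) = 1 ^ (p ^ (n - k - 1 - k))] (mod N)"
      unfolding N_def by (intro cong_pow one_plus_prime_power_cong)
    ultimately show "[(1 + p) ^ M = 1] (mod N)" by (simp add: power_mult)
    fix m
    have "1 + (N - 1) * (1 + p) + p = N * (1 + p)"
    proof -
      have "N * (1 + p) = (N - 1 + 1) * (1 + p)" using \<open>N > 0\<close> by simp
      then show ?thesis by (simp add: algebra_simps)
    qed
    then have "m * (1 + (N - 1) * (1 + p)) + m * p = N * (m * (1 + p))"
      by (metis distrib_left mult.left_commute)
    then have "N dvd m * (1 + (N - 1) * (1 + p)) + m * p" by simp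
    then have "N dvd m * (1 + (N - 1) * (1 + p)) \<longleftrightarrow> N dvd m * p"
      by (metis dvd_add_left_iff dvd_add_right_iff)
    also have "\<dots> \<longleftrightarrow> p ^ k dvd m"
      using p1 by (simp add: N_def mult.commute)
    finally show "N dvd m * (1 + (N - 1) * (1 + p)) \<longleftrightarrow> p ^ k dvd m" .
  qed
  have "p ^ k * p ^ (n - k) = N * M" unfolding NM using k by (simp flip: power_add)
  moreover have "p ^ k > 1" using one_less_power[OF p1] k(1) by simp
  ultimately show ?thesis
    using gluing_in_stratum p_origami_gluing[OF NM] card_squares NM unfolding origami_degree_def by metis
qed

text \<open>Here the acting group inverts the elements of a cyclic group of order \<open>2\<^sup>k\<^sup>+\<^sup>1\<close>, for which
  it only has to have even order. For \<open>n = k + 2\<close> this is a dihedral group.\<close>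

lemma even_stratum_occurs:
  assumes k: "1 \<le> k" "k + 2 \<le> n"
  shows "\<exists>\<O> :: nat origami_gluing. p_origami 2 \<O> \<and> origami_degree \<O> = 2 ^ n \<and> \<O> \<in> stratum (2 ^ (n - k)) (2 ^ k - 1)"
proof -
  define N :: nat where "N = 2 ^ Suc k"
  define M :: nat where "M = 2 ^ (n - k - 1)"
  have NM: "N * M = 2 ^ n" unfolding N_def M_def power_add[symmetric] using k by simp
  interpret semidirect_cyclic N M "N - 1" "2 ^ k"
  proof
    show N0: "N > 0" and "M > 0" "(2::nat) ^ k > 0" by (simp_all add: N_def M_def)
    obtain l where l: "N = Suc l" using N0 by (cases N) auto
    have "(N - 1) ^ 2 + 2 * N = 1 + N * (N + 0)"
      by (simp add: l power2_eq_square)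
    then have "((N - 1) ^ 2 + 2 * N) mod N = (1 + N * N) mod N" by simp
    then have sq: "[(N - 1) ^ 2 = 1] (mod N)" by (simp only: cong_def mod_mult_self1)
    have "M = 2 * 2 ^ (n - k - 2)" using k by (simp add: M_def flip: power_Suc)
    moreover have "[((N - 1) ^ 2) ^ (2 ^ (n - k - 2)) = 1 ^ (2 ^ (n - k - 2))] (mod N)"
      by (intro cong_pow sq)
    ultimately show "[(N - 1) ^ M = 1] (mod N)" by (simp add: power_mult)
    fix m
    have "1 + (N - 1) * (N - 1) + 2 * N = 2 + N * N"
      by (simp add: l)
    then have "m * (1 + (N - 1) * (N - 1)) + N * (2 * m) = m * 2 + N * (N * m)"
      by (metis (no_types, opaque_lifting) distrib_left mult.commute mult.left_commute)
    then have "N dvd m * (1 + (N - 1) * (N - 1)) \<longleftrightarrow> N dvd m * 2"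
      by (metis dvd_add_left_iff dvd_triv_left)
    also have "\<dots> \<longleftrightarrow> 2 ^ k dvd m"
      by (simp add: N_def mult.commute)
    finally show "N dvd m * (1 + (N - 1) * (N - 1)) \<longleftrightarrow> 2 ^ k dvd m" .
  qed
  have "2 ^ k * 2 ^ (n - k) = N * M" unfolding NM using k by (simp flip: power_add)
  moreover have "(2::nat) ^ k > 1" using one_less_power[of "2 :: nat" k] k(1) by simp
  ultimately show ?thesis
    using gluing_in_stratum p_origami_gluing[OF NM] card_squares NM unfolding origami_degree_def by metis
qed

theorem theorem1:
  fixes p n :: nat
  assumes "prime p"
  shows
    "(\<forall>\<O> :: 'a origami_gluing. p_origami p \<O> \<and> origami_degree \<O> = p ^ n \<longrightarrow>
        (singularities \<O> = {} \<and> genus \<O> = 1) \<or>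
        (p = 2 \<and> (\<exists>k. 1 \<le> k \<and> k + 2 \<le> n \<and> \<O> \<in> stratum (2 ^ (n - k)) (2 ^ k - 1))) \<or>
        (p > 2 \<and> (\<exists>k. 1 \<le> k \<and> real k < real n / 2 \<and> \<O> \<in> stratum (p ^ (n - k)) (p ^ k - 1))))
     \<and> (p = 2 \<longrightarrow> (\<forall>k. 1 \<le> k \<and> k + 2 \<le> n \<longrightarrow>
          (\<exists>\<O> :: nat origami_gluing. p_origami 2 \<O> \<and> origami_degree \<O> = 2 ^ n \<and>
             \<O> \<in> stratum (2 ^ (n - k)) (2 ^ k - 1))))
     \<and> (p > 2 \<longrightarrow> (\<forall>k. 1 \<le> k \<and> real k < real n / 2 \<longrightarrow>
          (\<exists>\<O> :: nat origami_gluing. p_origami p \<O> \<and> origami_degree \<O> = p ^ n \<and>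
             \<O> \<in> stratum (p ^ (n - k)) (p ^ k - 1))))"
proof (intro conjI allI impI)
  have half: "real k < real n / 2 \<longleftrightarrow> 2 * k < n" for k by linarith
  fix \<O> :: "'a origami_gluing"
  assume "p_origami p \<O> \<and> origami_degree \<O> = p ^ n"
  moreover have "p = 2 \<or> p > 2" using prime_ge_2_nat[OF assms] by linarith
  ultimately show "(singularities \<O> = {} \<and> genus \<O> = 1) \<or>
        (p = 2 \<and> (\<exists>k. 1 \<le> k \<and> k + 2 \<le> n \<and> \<O> \<in> stratum (2 ^ (n - k)) (2 ^ k - 1))) \<or>
        (p > 2 \<and> (\<exists>k. 1 \<le> k \<and> real k < real n / 2 \<and> \<O> \<in> stratum (p ^ (n - k)) (p ^ k - 1)))"
    using p_origami_strata[OF assms, of \<O> n] unfolding half by auto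
next
  fix k assume "1 \<le> k \<and> k + 2 \<le> n"
  then show "\<exists>\<O> :: nat origami_gluing. p_origami 2 \<O> \<and> origami_degree \<O> = 2 ^ n \<and> \<O> \<in> stratum (2 ^ (n - k)) (2 ^ k - 1)"
    by (intro even_stratum_occurs) auto
next
  fix k assume "1 \<le> k \<and> real k < real n / 2"
  then show "\<exists>\<O> :: nat origami_gluing. p_origami p \<O> \<and> origami_degree \<O> = p ^ n \<and> \<O> \<in> stratum (p ^ (n - k)) (p ^ k - 1)"
    by (intro odd_stratum_occurs[OF assms]) auto
qed

end
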